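(* Let $1<p<\infty$, $\alpha\ge0$, $\beta>0$, and let $\mathcal{C}_\beta:\mathcal{T}_p^{(\alpha)}(t^\alpha)\to\mathcal{T}_p^{(\alpha)}(t^\alpha)$ be the generalized Cesàro operator. Then $$\sigma(\mathcal{C}_\beta)=\Gamma(\beta+1)\,\overline{\left\{\frac{\Gamma(1-\frac1p+it)}{\Gamma(\beta+1-\frac1p+it)}:\ t\in\mathbb{R}\right\}}=\beta\,\overline{B(\beta,1-1/p+i\mathbb{R})},$$ where $B$ is the Beta function.
   Context: $\mathcal{S}_+$ denotes the Schwartz class on $[0,\infty)$. For $\alpha>0$ and $f\in\mathcal{S}_+$, the Weyl fractional integral is $W_+^{-\alpha}f(t)=\frac{1}{\Gamma(\alpha)}\int_t^\infty (s-t)^{\alpha-1}f(s)\,ds$, and the Weyl fractional derivative is $W_+^{\alpha}f(t)=(-1)^n\frac{d^n}{dt^n}W_+^{-(n-\alpha)}f(t)$ with $n=[\alpha]+1$. For $\alpha>0$ and $1\le p<\infty$, $\mathcal{T}_p^{(\alpha)}(t^\alpha)$ is the completion of $\mathcal{S}_+$ in the norm $\|f\|_{\alpha,p}=\frac{1}{\Gamma(\alpha+1)}\left(\int_0^\infty |W_+^\alpha f(t)|^p t^{\alpha p}\,dt\right)^{1/p}$; $\mathcal{T}_p^{(0)}(t^0)=L^p(\mathbb{R}^+)$. These spaces embed continuously into $L^p(\mathbb{R}^+)$. The generalized Cesàro operator is $\mathcal{C}_\beta f(t)=\frac{\beta}{t^\beta}\int_0^t(t-s)^{\beta-1}f(s)\,ds$,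 $t>0$; it is bounded on $\mathcal{T}_p^{(\alpha)}(t^\alpha)$ for $p>1$. $\sigma$ denotes the spectrum and $B(x,y)=\Gamma(x)\Gamma(y)/\Gamma(x+y)$. *)

theory Defs
  imports "HOL-Analysis.Analysis"
begin

text \<open>Functions are complex valued functions on the real line; only their values
on the half-line (0,infinity) (resp. [0,infinity) for the Schwartz class) matter.\<close>

definition schwartz_plus :: "(real \<Rightarrow> complex) set" where
  "schwartz_plus = {f. \<exists>D :: nat \<Rightarrow> real \<Rightarrow> complex. D 0 = f \<and>
      (\<forall>k t. t \<ge> 0 \<longrightarrow> (D k has_vector_derivative D (Suc k) t) (at t within {0..})) \<and>
      (\<forall>k m. \<exists>C. \<forall>t\<ge>0. t ^ m * norm (D k t) \<le> C)}"

definition weyl_int :: "real \<Rightarrow> (real \<Rightarrow> complex) \<Rightarrow> real \<Rightarrow> complex" where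
  "weyl_int a f t = complex_of_real (1 / Gamma a) *
      (LINT s:{t<..}|lborel. complex_of_real ((s - t) powr (a - 1)) * f s)"

definition weyl_der :: "real \<Rightarrow> (real \<Rightarrow> complex) \<Rightarrow> real \<Rightarrow> complex" where
  "weyl_der a f t = (let n = nat \<lfloor>a\<rfloor> + 1 in
      (-1) ^ n * (((\<lambda>g x. vector_derivative g (at x)) ^^ n) (weyl_int (real n - a) f)) t)"

text \<open>The norm of T_p^(a)(t^a) on the Schwartz class (for a = 0 it is the L^p norm).\<close>
definition wnorm :: "real \<Rightarrow> real \<Rightarrow> (real \<Rightarrow> complex) \<Rightarrow> real" where
  "wnorm a p f = enn2real (\<integral>\<^sup>+ t. ennreal (norm (weyl_der a f t) powr p * t powr (a * p))
        * indicator {0<..} t \<partial>lborel) powr (1 / p) / Gamma (a + 1)"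

definition lp_pow :: "real \<Rightarrow> (real \<Rightarrow> complex) \<Rightarrow> ennreal" where
  "lp_pow p f = (\<integral>\<^sup>+ t. ennreal (norm (f t) powr p) * indicator {0<..} t \<partial>lborel)"

definition in_Lp :: "real \<Rightarrow> (real \<Rightarrow> complex) \<Rightarrow> bool" where
  "in_Lp p f \<longleftrightarrow> set_borel_measurable lborel {0<..} f \<and> lp_pow p f < \<infinity>"

definition approx_seq :: "real \<Rightarrow> real \<Rightarrow> (nat \<Rightarrow> real \<Rightarrow> complex) \<Rightarrow> (real \<Rightarrow> complex) \<Rightarrow> bool" where
  "approx_seq a p \<phi> f \<longleftrightarrow> (\<forall>n. \<phi> n \<in> schwartz_plus) \<and>
     (\<forall>e>0. \<exists>N. \<forall>m\<ge>N. \<forall>n\<ge>N. wnorm a p (\<lambda>t. \<phi> m t - \<phi> n t) < e) \<and>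
     (\<lambda>n. lp_pow p (\<lambda>t. \<phi> n t - f t)) \<longlonglongrightarrow> 0"

text \<open>The completion T_p^(a)(t^a), realized inside L^p(R^+) via the continuous
(injective) embedding; elements are identified when equal a.e. on (0,infinity).\<close>
definition Tspace :: "real \<Rightarrow> real \<Rightarrow> (real \<Rightarrow> complex) set" where
  "Tspace a p = {f. in_Lp p f \<and> (\<exists>\<phi>. approx_seq a p \<phi> f)}"

definition Tnorm :: "real \<Rightarrow> real \<Rightarrow> (real \<Rightarrow> complex) \<Rightarrow> real" where
  "Tnorm a p f = (THE r. \<exists>\<phi>. approx_seq a p \<phi> f \<and> (\<lambda>n. wnorm a p (\<phi> n)) \<longlonglongrightarrow> r)"

definition ae_eq :: "(real \<Rightarrow> complex) \<Rightarrow> (real \<Rightarrow> complex) \<Rightarrow> bool" where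
  "ae_eq f g \<longleftrightarrow> (AE t in lborel. t > 0 \<longrightarrow> f t = g t)"

definition cesaro :: "real \<Rightarrow> (real \<Rightarrow> complex) \<Rightarrow> real \<Rightarrow> complex" where
  "cesaro \<beta> f t = complex_of_real (\<beta> / t powr \<beta>) *
      (LINT s:{0<..<t}|lborel. complex_of_real ((t - s) powr (\<beta> - 1)) * f s)"

definition op_invertible :: "real \<Rightarrow> real \<Rightarrow> ((real \<Rightarrow> complex) \<Rightarrow> real \<Rightarrow> complex) \<Rightarrow> complex \<Rightarrow> bool" where
  "op_invertible a p T z \<longleftrightarrow>
     (\<forall>f\<in>Tspace a p. ae_eq (\<lambda>t. z * f t - T f t) (\<lambda>t. 0) \<longrightarrow> ae_eq f (\<lambda>t. 0)) \<and>
     (\<forall>g\<in>Tspace a p. \<exists>f\<in>Tspace a p. ae_eq (\<lambda>t. z * f t - T f t) g) \<and>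
     (\<exists>K. \<forall>f\<in>Tspace a p. Tnorm a p f \<le> K * Tnorm a p (\<lambda>t. z * f t - T f t))"

definition op_spectrum :: "real \<Rightarrow> real \<Rightarrow> ((real \<Rightarrow> complex) \<Rightarrow> real \<Rightarrow> complex) \<Rightarrow> complex set" where
  "op_spectrum a p T = {z. \<not> op_invertible a p T z}"

end

theory Submission
  imports Defs "HOL-Probability.Probability"
begin

text \<open>In the coordinate \<open>t = exp x\<close>, weighted so that \<open>L\<^sup>p(0,\<infinity>)\<close> becomes \<open>L\<^sup>p(\<real>)\<close>, all
  operators in sight commute with translations. The Cesaro operator becomes convolution with a
  positive integrable kernel \<open>\<kappa>\<close> whose Fourier transform is \<open>\<beta> B(\<beta>, 1 - 1/p + i\<xi>)\<close>, and the inverse of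
  \<open>f \<mapsto> t\<^sup>\<alpha> W\<^sup>\<alpha> f / \<Gamma>(\<alpha>+1)\<close> becomes convolution with an integrable kernel as well. The latter operator
  \<open>V\<close> is injective and commutes with the Cesaro operator, and the completed space is \<open>V(L\<^sup>p)\<close> with the norm
  carried over from \<open>L\<^sup>p\<close>; the image of the Schwartz class is dense because it contains all
  \<open>t\<^sup>\<alpha> exp(-jt)\<close>. So the spectrum is that of convolution with \<open>\<kappa>\<close> on \<open>L\<^sup>p(\<real>)\<close>.

  Points of the curve are approximate eigenvalues, with approximate eigenvectors
  \<open>exp(i\<xi>x - \<delta>|x|)\<close>. If \<open>z\<close> has positive distance to the curve, write \<open>q\<close> for the transform of \<open>\<kappa>\<close> and expand
  \<open>1/(z - q) = \<Sum>\<^sub>j\<^sub><\<^sub>N q\<^sup>j/z\<^sup>j\<^sup>+\<^sup>1 + q\<^sup>N/(z\<^sup>N(z - q))\<close>. Since \<open>q\<close> decays like a power, the last term and its first two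
  derivatives are integrable for large \<open>N\<close>, hence it is the transform of an integrable function, and the
  resolvent is \<open>1/z\<close> plus a convolution operator.\<close>

section \<open>The spaces \<open>L\<^sup>p\<close> on the real line\<close>

text \<open>Several constraints shape the details. For \<beta> < 1 the kernel \<kappa> is unbounded
  and its transform \<open>q\<close> is only known to decay like |\<xi>|^(-\<beta>), so low powers
  of \<open>q\<close> need not be integrable; hence the expansion up to a high power of
  \<open>q\<close>. Fourier inversion is taken from Levy's formula for probability distributions and
  therefore covers nonnegative functions. This suffices, because the only functions ever inverted
  are convolution powers of \<kappa>, which are nonnegative; the remainder of the expansion is
  defined as an inverse transform and enters only through the equation it satisfies. The assumption
  p > 1 makes the exponent 1 - 1/p positive, which is the exponential decay rate of \<kappa>. It
  yields integrability, the second moment behind the two derivatives of \<open>q\<close>, and the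
  exponential moment behind the approximate eigenvectors. The parameter \<alpha> disappears because
  V carries the norm of L^p to the completed space by construction. What has to be proved is that V
  inverts the weighted Weyl derivative on Schwartz functions, that V is injective, and that the
  images of Schwartz functions are dense.\<close>

definition Lp :: "real \<Rightarrow> (real \<Rightarrow> complex) \<Rightarrow> bool" where
  "Lp p F \<longleftrightarrow> F \<in> borel_measurable borel \<and> integrable lborel (\<lambda>x. norm (F x) powr p)"

definition Lp_norm :: "real \<Rightarrow> (real \<Rightarrow> complex) \<Rightarrow> real" where
  "Lp_norm p F = (\<integral>x. norm (F x) powr p \<partial>lborel) powr (1 / p)"

lemma Lp_measurable [measurable_dest]: "Lp p F \<Longrightarrow> F \<in> borel_measurable borel"
  by (simp add: Lp_def)

lemma Lp_integrable: "Lp p F \<Longrightarrow> integrable lborel (\<lambda>x. norm (F x) powr p)"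
  by (simp add: Lp_def)

lemma Lp_norm_nonneg [simp]: "0 \<le> Lp_norm p F"
  by (simp add: Lp_norm_def)

lemma Lp_norm_powr: "1 < p \<Longrightarrow> Lp_norm p F powr p = (\<integral>x. norm (F x) powr p \<partial>lborel)"
  by (simp add: Lp_norm_def powr_powr)

lemma Lp_norm_cong_AE:
  assumes "F \<in> borel_measurable borel" "G \<in> borel_measurable borel" "AE x in lborel. F x = G x"
  shows "Lp_norm p F = Lp_norm p G"
proof -
  have "(\<integral>x. norm (F x) powr p \<partial>lborel) = (\<integral>x. norm (G x) powr p \<partial>lborel)"
    by (rule integral_cong_AE) (use assms in auto)
  then show ?thesis by (simp add: Lp_norm_def)
qed

lemma Lp_bound:
  assumes "Lp p F" "1 < p" "G \<in> borel_measurable borel" "0 \<le> c"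
    and "AE x in lborel. norm (G x) \<le> c * norm (F x)"
  shows "Lp p G" "Lp_norm p G \<le> c * Lp_norm p F"
proof -
  have i: "integrable lborel (\<lambda>x. c powr p * norm (F x) powr p)"
    using assms by (auto simp: Lp_def)
  have le: "AE x in lborel. norm (G x) powr p \<le> c powr p * norm (F x) powr p"
    using assms(5)
  proof eventually_elim
    case (elim x)
    then have "norm (G x) powr p \<le> (c * norm (F x)) powr p"
      using assms(2) by (intro powr_mono2) auto
    then show ?case using assms(4) by (simp add: powr_mult)
  qed
  have iG: "integrable lborel (\<lambda>x. norm (G x) powr p)"
    by (rule Bochner_Integration.integrable_bound[OF i]) (use assms(3) le in auto)
  then show "Lp p G" using assms(3) by (simp add: Lp_def)
  have "(\<integral>x. norm (G x) powr p \<partial>lborel) \<le> (\<integral>x. c powr p * norm (F x) powr p \<partial>lborel)"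
    by (rule integral_mono_AE[OF iG i le])
  also have "\<dots> = c powr p * (\<integral>x. norm (F x) powr p \<partial>lborel)" by simp
  finally have "Lp_norm p G \<le> (c powr p * (\<integral>x. norm (F x) powr p \<partial>lborel)) powr (1 / p)"
    unfolding Lp_norm_def using assms(2) by (intro powr_mono2) auto
  also have "\<dots> = c * Lp_norm p F"
    using assms(2,4) by (simp add: Lp_norm_def powr_mult powr_powr)
  finally show "Lp_norm p G \<le> c * Lp_norm p F" .
qed

lemma Lp_scale:
  assumes "Lp p F" "1 < p"
  shows "Lp p (\<lambda>x. c * F x)" "Lp_norm p (\<lambda>x. c * F x) = norm c * Lp_norm p F"
proof -
  have m: "(\<lambda>x. c * F x) \<in> borel_measurable borel" using assms by (auto simp: Lp_def)
  show L: "Lp p (\<lambda>x. c * F x)"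
    by (rule Lp_bound[OF assms m, of "norm c"]) (auto simp: norm_mult)
  show "Lp_norm p (\<lambda>x. c * F x) = norm c * Lp_norm p F"
    using assms by (simp add: Lp_norm_def norm_mult powr_mult powr_powr)
qed

lemma powr_convex_combination:
  fixes x y :: real
  assumes "1 < p" "0 \<le> x" "0 \<le> y" "0 < a" "0 < b" "a + b = 1"
  shows "(a * x + b * y) powr p \<le> a * x powr p + b * y powr p"
proof -
  \<comment> \<open>Convexity of the power is applied to two positive points; when one point is 0
    the claim reduces to c^p <= c for the remaining weight.\<close>
  have s: "c powr p \<le> c" if "0 < c" "c < 1" for c :: real
    using powr_mono'[of 1 p c] that assms(1) by simp
  consider "x = 0" | "y = 0" | "x > 0" "y > 0" using assms by fastforce
  then show ?thesis
  proof cases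
    case 1
    then show ?thesis using s[of b] assms by (simp add: powr_mult mult_right_mono)
  next
    case 2
    then show ?thesis using s[of a] assms by (simp add: powr_mult mult_right_mono)
  next
    case 3
    have a: "a = 1 - b" using assms by simp
    have "((1 - b) *\<^sub>R x + b *\<^sub>R y) powr p \<le> (1 - b) * x powr p + b * y powr p"
      by (rule convex_onD[OF powr_convex[of p]]) (use assms 3 in auto)
    then show ?thesis unfolding a by simp
  qed
qed

text \<open>Minkowski's inequality. With a and b the two norms, F + G is (a + b) times a convex
  combination of F/a and G/b, and convexity of x^p integrates to (a + b)^p. Adding e to both norms
  keeps the denominators positive; e tends to 0 at the end.\<close>

lemma Lp_add:
  assumes F: "Lp p F" and G: "Lp p G" and p: "1 < p"
  shows "Lp p (\<lambda>x. F x + G x)" "Lp_norm p (\<lambda>x. F x + G x) \<le> Lp_norm p F + Lp_norm p G"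
proof -
  have mF[measurable]: "F \<in> borel_measurable borel" and mG[measurable]: "G \<in> borel_measurable borel"
    and iF: "integrable lborel (\<lambda>x. norm (F x) powr p)" and iG: "integrable lborel (\<lambda>x. norm (G x) powr p)"
    using F G by (auto simp: Lp_def)
  have *: "integrable lborel (\<lambda>x. norm (F x + G x) powr p) \<and>
      Lp_norm p (\<lambda>x. F x + G x) \<le> (Lp_norm p F + e) + (Lp_norm p G + e)" if e: "0 < e" for e
  proof -
    define a b where "a = Lp_norm p F + e" and "b = Lp_norm p G + e"
    have ab: "a > 0" "b > 0" using e by (auto simp: a_def b_def add_nonneg_pos)
    define B where "B x = (a + b) powr p * (a / (a + b) * (norm (F x) powr p / a powr p)
        + b / (a + b) * (norm (G x) powr p / b powr p))" for x
    have iB: "integrable lborel B" unfolding B_def using iF iG by auto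
    have le: "norm (F x + G x) powr p \<le> B x" for x
    proof -
      have "norm (F x + G x) \<le> norm (F x) + norm (G x)" by (rule norm_triangle_ineq)
      also have "\<dots> = (a + b) * (a / (a + b) * (norm (F x) / a) + b / (a + b) * (norm (G x) / b))"
      proof -
        have "a / (a + b) * (norm (F x) / a) = norm (F x) / (a + b)"
          "b / (a + b) * (norm (G x) / b) = norm (G x) / (a + b)" using ab by simp_all
        then show ?thesis using ab by (simp add: add_divide_distrib[symmetric])
      qed
      finally have "norm (F x + G x) powr p \<le> ((a + b) * (a / (a + b) * (norm (F x) / a) + b / (a + b) * (norm (G x) / b))) powr p"
        using p by (intro powr_mono2) auto
      also have "\<dots> = (a + b) powr p * (a / (a + b) * (norm (F x) / a) + b / (a + b) * (norm (G x) / b)) powr p"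
        using ab by (intro powr_mult)
      also have "(a / (a + b) * (norm (F x) / a) + b / (a + b) * (norm (G x) / b)) powr p
          \<le> a / (a + b) * (norm (F x) / a) powr p + b / (a + b) * (norm (G x) / b) powr p"
        using ab p by (intro powr_convex_combination) (auto simp: add_divide_distrib[symmetric])
      finally show ?thesis using ab by (simp add: B_def powr_divide mult_left_mono)
    qed
    have i: "integrable lborel (\<lambda>x. norm (F x + G x) powr p)"
      by (rule Bochner_Integration.integrable_bound[OF iB]) (use le in \<open>auto intro: order_trans[OF _ abs_ge_self]\<close>)
    have q: "Lp_norm p H powr p / (Lp_norm p H + e) powr p \<le> 1" for H
      using e p add_nonneg_pos[OF Lp_norm_nonneg e, of p H]
      by (subst divide_le_eq_1_pos) (auto intro!: powr_mono2)
    have "(\<integral>x. norm (F x + G x) powr p \<partial>lborel) \<le> (\<integral>x. B x \<partial>lborel)"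
      by (rule integral_mono[OF i iB le])
    also have "\<dots> = (a + b) powr p * (a / (a + b) * (Lp_norm p F powr p / a powr p)
        + b / (a + b) * (Lp_norm p G powr p / b powr p))"
      unfolding B_def using iF iG p by (simp add: Lp_norm_powr)
    also have "\<dots> \<le> (a + b) powr p * (a / (a + b) * 1 + b / (a + b) * 1)"
      using ab q[of F] q[of G] unfolding a_def[symmetric] b_def[symmetric]
      by (intro mult_left_mono add_mono) auto
    also have "\<dots> = (a + b) powr p" using ab by (simp add: add_divide_distrib[symmetric])
    finally have "Lp_norm p (\<lambda>x. F x + G x) \<le> ((a + b) powr p) powr (1 / p)"
      unfolding Lp_norm_def using p by (intro powr_mono2) auto
    also have "\<dots> = a + b" using p ab by (simp add: powr_powr)
    finally show ?thesis using i by (simp add: a_def b_def)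
  qed
  show "Lp p (\<lambda>x. F x + G x)" using *[of 1] by (simp add: Lp_def)
  show "Lp_norm p (\<lambda>x. F x + G x) \<le> Lp_norm p F + Lp_norm p G"
  proof (rule field_le_epsilon)
    fix e :: real assume "0 < e"
    then show "Lp_norm p (\<lambda>x. F x + G x) \<le> Lp_norm p F + Lp_norm p G + e"
      using *[of "e / 2"] by simp
  qed
qed

lemma Lp_diff:
  assumes F: "Lp p F" and G: "Lp p G" and p: "1 < p"
  shows "Lp p (\<lambda>x. F x - G x)" "Lp_norm p (\<lambda>x. F x - G x) \<le> Lp_norm p F + Lp_norm p G"
  using Lp_add[OF F Lp_scale(1)[OF G p, of "-1"] p] Lp_scale(2)[OF G p, of "-1"] by simp_all

lemma Lp_norm_diff_le:
  assumes F: "Lp p F" and G: "Lp p G" and p: "1 < p"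
  shows "\<bar>Lp_norm p F - Lp_norm p G\<bar> \<le> Lp_norm p (\<lambda>x. F x - G x)"
proof -
  have "Lp_norm p F \<le> Lp_norm p (\<lambda>x. F x - G x) + Lp_norm p G"
    using Lp_add(2)[OF Lp_diff(1)[OF F G p] G p] by simp
  moreover have "Lp_norm p G \<le> Lp_norm p (\<lambda>x. F x - G x) + Lp_norm p F"
    using Lp_diff(2)[OF F Lp_diff(1)[OF F G p] p] by simp
  ultimately show ?thesis by linarith
qed

lemma Lp_norm_eq_0_iff:
  assumes F: "Lp p F" and p: "1 < p"
  shows "Lp_norm p F = 0 \<longleftrightarrow> (AE x in lborel. F x = 0)"
proof -
  have "Lp_norm p F = 0 \<longleftrightarrow> (\<integral>x. norm (F x) powr p \<partial>lborel) = 0"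
    using p by (simp add: Lp_norm_def)
  also have "\<dots> \<longleftrightarrow> (AE x in lborel. norm (F x) powr p = 0)"
    using Lp_integrable[OF F] by (intro integral_nonneg_eq_0_iff_AE) auto
  finally show ?thesis by simp
qed

lemma Lp_norm_minus_commute: "Lp_norm p (\<lambda>x. F x - G x) = Lp_norm p (\<lambda>x. G x - F x)"
  by (simp add: Lp_norm_def norm_minus_commute)

lemma Lp_limit_unique:
  assumes F: "\<And>n. Lp p (F n)" and G: "Lp p G" and H: "Lp p H" and p: "1 < p"
    and "(\<lambda>n. Lp_norm p (\<lambda>x. F n x - G x)) \<longlonglongrightarrow> 0"
    and "(\<lambda>n. Lp_norm p (\<lambda>x. F n x - H x)) \<longlonglongrightarrow> 0"
  shows "AE x in lborel. G x = H x"
proof -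
  have le: "Lp_norm p (\<lambda>x. G x - H x) \<le> Lp_norm p (\<lambda>x. F n x - H x) + Lp_norm p (\<lambda>x. F n x - G x)" for n
    using Lp_diff(2)[OF Lp_diff(1)[OF F H p] Lp_diff(1)[OF F G p] p, of n n] by (simp add: algebra_simps)
  have "(\<lambda>n. Lp_norm p (\<lambda>x. F n x - H x) + Lp_norm p (\<lambda>x. F n x - G x)) \<longlonglongrightarrow> 0 + 0"
    by (intro tendsto_add assms)
  then have "Lp_norm p (\<lambda>x. G x - H x) \<le> 0 + 0"
    by (rule LIMSEQ_le_const) (use le in auto)
  then have "Lp_norm p (\<lambda>x. G x - H x) = 0" by (simp add: order_antisym)
  then show ?thesis using Lp_norm_eq_0_iff[OF Lp_diff(1)[OF G H p] p] by simp
qed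

text \<open>The Riesz-Fischer argument: a fast subsequence converges almost everywhere, and Fatou's
  lemma turns the Cauchy bound along it into norm convergence of the full sequence.\<close>

lemma Lp_complete:
  assumes F: "\<And>n. Lp p (F n)" and p: "1 < p"
    and cauchy: "\<And>e. 0 < e \<Longrightarrow> \<exists>N. \<forall>m\<ge>N. \<forall>n\<ge>N. Lp_norm p (\<lambda>x. F m x - F n x) < e"
  obtains G where "Lp p G" "(\<lambda>n. Lp_norm p (\<lambda>x. F n x - G x)) \<longlonglongrightarrow> 0"
proof -
  have mF[measurable]: "F n \<in> borel_measurable borel" for n using F by (auto simp: Lp_def)
  have "\<exists>N. \<forall>m\<ge>N. \<forall>n\<ge>N. Lp_norm p (\<lambda>x. F m x - F n x) < (1 / 4) ^ k" for k
    by (rule cauchy) simp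
  then obtain N where N: "\<And>k m n. m \<ge> N k \<Longrightarrow> n \<ge> N k \<Longrightarrow> Lp_norm p (\<lambda>x. F m x - F n x) < (1 / 4) ^ k"
    by metis
  \<comment> \<open>Summing the thresholds makes \<open>r k\<close> exceed \<open>N k\<close>, and
    \<open>r (Suc k)\<close> exceed it too; the summand k forces \<open>r\<close> to
    infinity.\<close>
  define r where "r k = (\<Sum>i\<le>k. N i) + k" for k
  have rN: "r k \<ge> N k" "r (Suc k) \<ge> N k" "k \<le> r k" for k
    by (auto simp: r_def intro: order_trans[OF member_le_sum[of k "{..k}" N]])
  define d where "d k x = F (r (Suc k)) x - F (r k) x" for k x
  have [measurable]: "d k \<in> borel_measurable borel" for k unfolding d_def by measurable
  have d: "Lp p (d k)" "Lp_norm p (d k) \<le> (1/4) ^ k" for k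
    using Lp_diff(1)[OF F F p] N[of k "r (Suc k)" "r k"] rN by (auto simp: d_def[abs_def] intro: less_imp_le)
  have di: "(\<integral>x. norm (d k x) powr p \<partial>lborel) \<le> ((1/4) ^ k) powr p" for k
    using d(2)[of k] p by (subst Lp_norm_powr[symmetric]) (auto intro!: powr_mono2)
  \<comment> \<open>The increments have norm at most 4^(-k), so even with the factor 2^k the
    integrals of \<open>w k\<close> are summable. Almost everywhere the terms then drop below 1,
    which gives |d k x| <= 2^(-k) and a convergent telescoping series.\<close>
  define w where "w k x = (2 ^ k * norm (d k x)) powr p" for k x
  have wi: "integrable lborel (w k)" for k
    unfolding w_def using d(1)[of k] by (simp add: powr_mult Lp_def)
  have "(\<integral>\<^sup>+x. (\<Sum>k. ennreal (w k x)) \<partial>lborel) = (\<Sum>k. \<integral>\<^sup>+x. ennreal (w k x) \<partial>lborel)"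
    by (intro nn_integral_suminf) (auto simp: w_def)
  also have "\<dots> = (\<Sum>k. ennreal (\<integral>x. w k x \<partial>lborel))"
    by (intro suminf_cong nn_integral_eq_integral wi) (auto simp: w_def)
  also have "\<dots> \<le> (\<Sum>k. ennreal ((1/2) ^ k))"
  proof (intro suminf_le ennreal_leI)
    fix k
    have "(\<integral>x. w k x \<partial>lborel) = (2 ^ k) powr p * (\<integral>x. norm (d k x) powr p \<partial>lborel)"
      by (simp add: w_def powr_mult)
    also have "\<dots> \<le> (2 ^ k) powr p * ((1/4) ^ k) powr p"
      by (intro mult_left_mono di) auto
    also have "\<dots> = ((1/2) ^ k) powr p" by (simp add: powr_mult[symmetric] power_mult_distrib[symmetric])
    also have "\<dots> \<le> ((1/2) ^ k) powr 1" using p by (intro powr_mono') (auto simp: power_le_one)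
    finally show "(\<integral>x. w k x \<partial>lborel) \<le> (1/2) ^ k" by simp
  qed auto
  also have "\<dots> = ennreal (\<Sum>k. (1/2) ^ k)"
    by (rule suminf_ennreal_eq) (auto intro!: summable_sums)
  finally have "(\<integral>\<^sup>+x. (\<Sum>k. ennreal (w k x)) \<partial>lborel) < \<infinity>" by (simp add: top.not_eq_extremum le_less_trans)
  then have "AE x in lborel. (\<Sum>k. ennreal (w k x)) \<noteq> \<infinity>"
    by (intro nn_integral_PInf_AE) (auto simp: w_def)
  then have conv: "AE x in lborel. convergent (\<lambda>k. F (r k) x)"
  proof eventually_elim
    case (elim x)
    have sw: "summable (\<lambda>k. w k x)"
      using elim by (intro summable_suminf_not_top) (auto simp: w_def)
    have "eventually (\<lambda>k. w k x < 1) sequentially"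
      using summable_LIMSEQ_zero[OF sw] by (rule order_tendstoD) simp
    then have ev: "eventually (\<lambda>k. norm (d k x) \<le> (1/2) ^ k) sequentially"
    proof eventually_elim
      case (elim k)
      then have "(2 ^ k * norm (d k x)) powr p < 1 powr p" by (simp add: w_def)
      then have "2 ^ k * norm (d k x) < 1"
        using p ge_one_powr_ge_zero[of "2 ^ k * norm (d k x)" p] by (cases "2 ^ k * norm (d k x) < 1") auto
      then show ?case by (simp add: field_simps power_divide)
    qed
    have "summable (\<lambda>k. d k x)"
      by (rule summable_comparison_test_ev[OF ev]) auto
    then have "convergent (\<lambda>n. (\<Sum>k<n. d k x))" by (simp add: summable_iff_convergent)
    moreover have "(\<Sum>k<n. d k x) = F (r n) x - F (r 0) x" for n
      unfolding d_def by (rule sum_lessThan_telescope)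
    ultimately have "convergent (\<lambda>n. F (r n) x - F (r 0) x)" by simp
    then have "convergent (\<lambda>n. (F (r n) x - F (r 0) x) + F (r 0) x)"
      by (intro convergent_add convergent_const)
    then show ?case by simp
  qed
  define G where "G x = lim (\<lambda>k. F (r k) x)" for x
  have [measurable]: "G \<in> borel_measurable borel" unfolding G_def by measurable
  have lim: "AE x in lborel. (\<lambda>k. F (r k) x) \<longlonglongrightarrow> G x"
    using conv by eventually_elim (simp add: G_def convergent_LIMSEQ_iff)
  \<comment> \<open>Fatou's lemma along the subsequence: a bound e on the distance from
    \<open>F n\<close> to all late members passes to the distance from \<open>F n\<close> to the
    limit.\<close>
  have key: "integrable lborel (\<lambda>x. norm (F n x - G x) powr p) \<and>
      (\<integral>x. norm (F n x - G x) powr p \<partial>lborel) \<le> e powr p"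
    if n: "\<And>m. m \<ge> M \<Longrightarrow> Lp_norm p (\<lambda>x. F n x - F m x) < e" for n M e
  proof -
    have "(\<integral>\<^sup>+x. ennreal (norm (F n x - G x) powr p) \<partial>lborel)
        = (\<integral>\<^sup>+x. liminf (\<lambda>k. ennreal (norm (F n x - F (r k) x) powr p)) \<partial>lborel)"
    proof (rule nn_integral_cong_AE)
      show "AE x in lborel. ennreal (norm (F n x - G x) powr p) = liminf (\<lambda>k. ennreal (norm (F n x - F (r k) x) powr p))"
        using lim
      proof eventually_elim
        case (elim x)
        have "(\<lambda>k. ennreal (norm (F n x - F (r k) x) powr p)) \<longlonglongrightarrow> ennreal (norm (F n x - G x) powr p)"
          using p elim by (intro tendsto_ennrealI tendsto_powr2 tendsto_intros) auto
        then show ?case by (intro lim_imp_Liminf[symmetric]) auto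
      qed
    qed
    also have "\<dots> \<le> liminf (\<lambda>k. \<integral>\<^sup>+x. ennreal (norm (F n x - F (r k) x) powr p) \<partial>lborel)"
      by (intro nn_integral_liminf) auto
    also have "\<dots> \<le> ennreal (e powr p)"
    proof (rule Liminf_le)
      have "\<forall>\<^sub>F k in sequentially. k \<ge> M" by (rule eventually_ge_at_top)
      then show "\<forall>\<^sub>F k in sequentially. (\<integral>\<^sup>+x. ennreal (norm (F n x - F (r k) x) powr p) \<partial>lborel) \<le> ennreal (e powr p)"
      proof eventually_elim
        case (elim k)
        have "Lp_norm p (\<lambda>x. F n x - F (r k) x) powr p \<le> e powr p"
          using n[of "r k"] elim rN(3)[of k] p by (intro powr_mono2) auto
        moreover have "(\<integral>\<^sup>+x. ennreal (norm (F n x - F (r k) x) powr p) \<partial>lborel)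
            = ennreal (\<integral>x. norm (F n x - F (r k) x) powr p \<partial>lborel)"
          using Lp_diff(1)[OF F F p] by (intro nn_integral_eq_integral) (auto simp: Lp_def)
        ultimately show ?case using p by (simp add: Lp_norm_powr ennreal_leI)
      qed
    qed auto
    finally have b: "(\<integral>\<^sup>+x. ennreal (norm (F n x - G x) powr p) \<partial>lborel) \<le> ennreal (e powr p)" .
    then have i: "integrable lborel (\<lambda>x. norm (F n x - G x) powr p)"
      by (intro integrableI_bounded) (auto simp: top.not_eq_extremum le_less_trans)
    then show ?thesis using b by (simp add: nn_integral_eq_integral)
  qed
  obtain N0 where N0: "\<And>m n. m \<ge> N0 \<Longrightarrow> n \<ge> N0 \<Longrightarrow> Lp_norm p (\<lambda>x. F m x - F n x) < 1"
    using cauchy[of 1] by auto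
  have "Lp p (\<lambda>x. F N0 x - G x)" using key[of N0 N0 1] N0 by (auto simp: Lp_def)
  from Lp_diff(1)[OF F this p, of N0] have LG: "Lp p G" by simp
  have "(\<lambda>n. Lp_norm p (\<lambda>x. F n x - G x)) \<longlonglongrightarrow> 0"
  proof (rule LIMSEQ_I)
    fix e :: real assume e: "0 < e"
    obtain M where M: "\<And>m n. m \<ge> M \<Longrightarrow> n \<ge> M \<Longrightarrow> Lp_norm p (\<lambda>x. F m x - F n x) < e / 2"
      using cauchy[of "e / 2"] e by auto
    have "Lp_norm p (\<lambda>x. F n x - G x) < e" if "n \<ge> M" for n
    proof -
      have "Lp_norm p (\<lambda>x. F n x - G x) \<le> ((e / 2) powr p) powr (1 / p)"
        unfolding Lp_norm_def using key[of M n "e / 2"] M[OF that] p by (intro powr_mono2) auto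
      also have "\<dots> = e / 2" using e p by (simp add: powr_powr)
      finally show ?thesis using e by simp
    qed
    then show "\<exists>no. \<forall>n\<ge>no. norm (Lp_norm p (\<lambda>x. F n x - G x) - 0) < e" by auto
  qed
  with LG show thesis by (rule that)
qed

section \<open>Convolution operators\<close>

text \<open>Correlation is used instead of convolution because exp(i\<xi>x) is then an eigenfunction
  with eigenvalue exactly \<open>ftrans k \<xi>\<close>, with no reflection; composing correlations
  still convolves the kernels.\<close>

definition corr :: "(real \<Rightarrow> complex) \<Rightarrow> (real \<Rightarrow> complex) \<Rightarrow> real \<Rightarrow> complex" where
  "corr k F x = (\<integral>y. k y * F (x + y) \<partial>lborel)"

definition conv :: "(real \<Rightarrow> complex) \<Rightarrow> (real \<Rightarrow> complex) \<Rightarrow> real \<Rightarrow> complex" where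
  "conv f g x = (\<integral>y. f y * g (x - y) \<partial>lborel)"

text \<open>The graph of u^p lies above its tangent at c. This is Young's inequality for the
  conjugate exponents p and p/(p-1), applied to u and c^(p-1).\<close>

lemma powr_tangent_le:
  fixes u c :: real
  assumes "1 < p" "0 \<le> u" "0 \<le> c"
  shows "p * (u * c powr (p - 1)) \<le> u powr p + (p - 1) * c powr p"
proof -
  have "u * c powr (p - 1) \<le> u powr p / p + (c powr (p - 1)) powr (p / (p - 1)) / (p / (p - 1))"
    using assms by (intro Youngs_inequality) (auto simp: field_simps)
  also have "(c powr (p - 1)) powr (p / (p - 1)) = c powr p"
    using assms by (simp add: powr_powr)
  finally have "p * (u * c powr (p - 1)) \<le> p * (u powr p / p + c powr p / (p / (p - 1)))"
    using assms by (intro mult_left_mono) auto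
  also have "\<dots> = u powr p + (p - 1) * c powr p"
    using assms by (simp add: distrib_left)
  finally show ?thesis .
qed

text \<open>Jensen's inequality for the finite measure with density \<open>k\<close>, total mass m:
  integrate the tangent inequality with c the mean X/m of \<open>u\<close>, which leaves m c^p <= Y,
  and multiply by m^(p-1). Integrability of \<open>k u\<close> comes from u <= u^p + 1.\<close>

lemma Jensen_powr:
  fixes k u :: "real \<Rightarrow> real"
  assumes p: "1 < p" and k: "integrable lborel k" "\<And>y. 0 \<le> k y"
    and u: "u \<in> borel_measurable borel" "\<And>y. 0 \<le> u y"
    and ku: "integrable lborel (\<lambda>y. k y * u y powr p)"
  shows "integrable lborel (\<lambda>y. k y * u y)"
    and "(\<integral>y. k y * u y \<partial>lborel) powr p \<le> (\<integral>y. k y \<partial>lborel) powr (p - 1) * (\<integral>y. k y * u y powr p \<partial>lborel)"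
proof -
  have [measurable]: "k \<in> borel_measurable borel" using k(1) by auto
  note [measurable] = u(1)
  have tan: "p * (k y * u y * c powr (p - 1)) \<le> k y * u y powr p + (p - 1) * c powr p * k y" if "0 \<le> c" for y c
    using mult_left_mono[OF powr_tangent_le[OF p u(2) that] k(2), of y y] by (simp add: algebra_simps)
  have u1: "u y \<le> u y powr p + 1" for y
  proof (cases "u y \<le> 1")
    case False
    then have "u y powr 1 \<le> u y powr p" using p by (intro powr_mono) auto
    then show ?thesis using False by simp
  next
    case True
    then show ?thesis by (simp add: add_increasing)
  qed
  have i2: "integrable lborel (\<lambda>y. k y * u y powr p + k y)" using k ku by auto
  show iu: "integrable lborel (\<lambda>y. k y * u y)"
  proof (rule Bochner_Integration.integrable_bound[OF i2])
    show "AE y in lborel. norm (k y * u y) \<le> norm (k y * u y powr p + k y)"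
    proof (rule AE_I2)
      fix y
      have "k y * u y \<le> k y * (u y powr p + 1)" by (intro mult_left_mono u1 k)
      then show "norm (k y * u y) \<le> norm (k y * u y powr p + k y)"
        using k(2)[of y] u(2)[of y] by (simp add: algebra_simps)
    qed
  qed auto
  define X Y m where "X = (\<integral>y. k y * u y \<partial>lborel)" and "Y = (\<integral>y. k y * u y powr p \<partial>lborel)" and "m = (\<integral>y. k y \<partial>lborel)"
  have X0: "X \<ge> 0" unfolding X_def using k u by (intro Bochner_Integration.integral_nonneg) auto
  have m0: "m \<ge> 0" unfolding m_def using k by (intro Bochner_Integration.integral_nonneg) auto
  have "X powr p \<le> m powr (p - 1) * Y"
  proof (cases "m = 0")
    case True
    then have "AE y in lborel. k y = 0"
      using integral_nonneg_eq_0_iff_AE[of lborel k] k by (auto simp: m_def)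
    then have "X = (\<integral>y. 0 \<partial>(lborel :: real measure))" unfolding X_def
      by (intro integral_cong_AE) auto
    then show ?thesis using True by simp
  next
    case False
    with m0 have m: "m > 0" by simp
    define c where "c = X / m"
    have c: "c \<ge> 0" using X0 m by (simp add: c_def)
    have "(\<integral>y. p * (k y * u y * c powr (p - 1)) \<partial>lborel) \<le> (\<integral>y. k y * u y powr p + (p - 1) * c powr p * k y \<partial>lborel)"
      using iu ku k by (intro integral_mono tan c) auto
    also have "\<dots> = Y + (p - 1) * c powr p * m" using ku k by (simp add: Y_def m_def)
    also have "(\<integral>y. p * (k y * u y * c powr (p - 1)) \<partial>lborel) = p * (X * c powr (p - 1))"
      by (simp add: X_def)
    finally have *: "p * (X * c powr (p - 1)) \<le> Y + (p - 1) * c powr p * m" .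
    have Xc: "X = c * m" using m by (simp add: c_def)
    have cc: "c * c powr (p - 1) = c powr p" using c p
      by (cases "c = 0") (simp_all add: powr_mult_base)
    have mm: "m * m powr (p - 1) = m powr p" using m by (simp add: powr_mult_base)
    have "X * c powr (p - 1) = m * c powr p" using cc by (simp add: Xc mult.assoc mult.left_commute)
    with * have "m * c powr p \<le> Y" by (simp add: algebra_simps)
    then have "m powr (p - 1) * (m * c powr p) \<le> m powr (p - 1) * Y" by (intro mult_left_mono) auto
    moreover have "m powr (p - 1) * (m * c powr p) = X powr p"
      using c m mm by (simp add: Xc powr_mult mult.left_commute mult.commute[of "c powr p"] mult.assoc[symmetric])
    ultimately show ?thesis by simp
  qed
  then show "(\<integral>y. k y * u y \<partial>lborel) powr p \<le> (\<integral>y. k y \<partial>lborel) powr (p - 1) * (\<integral>y. k y * u y powr p \<partial>lborel)"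
    by (simp add: X_def Y_def m_def)
qed

section \<open>Translations, reflections and product integrability\<close>

lemma integrable_shift_iff:
  fixes f :: "real \<Rightarrow> 'a::{banach, second_countable_topology}"
  shows "integrable lborel (\<lambda>x. f (x + a)) \<longleftrightarrow> integrable lborel f"
  using lborel_integrable_real_affine_iff[of 1 f a] by (simp add: add.commute)

lemma integral_shift:
  fixes f :: "real \<Rightarrow> 'a::{banach, second_countable_topology}"
  shows "(\<integral>x. f (x + a) \<partial>lborel) = (\<integral>x. f x \<partial>lborel)"
  using lborel_integral_real_affine[of 1 f a] by (simp add: add.commute)

lemma integrable_reflect_iff:
  fixes f :: "real \<Rightarrow> 'a::{banach, second_countable_topology}"
  shows "integrable lborel (\<lambda>x. f (a - x)) \<longleftrightarrow> integrable lborel f"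
  using lborel_integrable_real_affine_iff[of "-1" f a] by simp

lemma integral_reflect:
  fixes f :: "real \<Rightarrow> 'a::{banach, second_countable_topology}"
  shows "(\<integral>x. f (a - x) \<partial>lborel) = (\<integral>x. f x \<partial>lborel)"
  using lborel_integral_real_affine[of "-1" f a] by simp

lemma integrable_prod_shift:
  fixes f g :: "real \<Rightarrow> 'a::{real_normed_field, banach, second_countable_topology}"
  assumes f: "integrable lborel f" and g: "integrable lborel g"
  shows "integrable (lborel \<Otimes>\<^sub>M lborel) (\<lambda>(x, y). f y * g (x + y))"
    and "integrable (lborel \<Otimes>\<^sub>M lborel) (\<lambda>(x, y). f y * g (x - y))"
proof -
  have [measurable]: "f \<in> borel_measurable borel" "g \<in> borel_measurable borel" using f g by auto
  have *: "integrable (lborel \<Otimes>\<^sub>M lborel) (\<lambda>(x, y). f y * g (x + s * y))" for s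
  proof -
    have "integrable (lborel \<Otimes>\<^sub>M lborel) (\<lambda>(y, x). f y * g (x + s * y))"
    proof (rule lborel_pair.Fubini_integrable)
      have "(\<integral>x. norm (f y * g (x + s * y)) \<partial>lborel) = norm (f y) * (\<integral>x. norm (g x) \<partial>lborel)" for y
        using integral_shift[of "\<lambda>x. norm (g x)" "s * y"] by (simp add: norm_mult)
      then show "integrable lborel (\<lambda>y. \<integral>x. norm (case (y, x) of (y, x) \<Rightarrow> f y * g (x + s * y)) \<partial>lborel)"
        using f by simp
      show "AE y in lborel. integrable lborel (\<lambda>x. case (y, x) of (y, x) \<Rightarrow> f y * g (x + s * y))"
        using g by (auto simp: integrable_shift_iff[of g])
    qed measurable
    from lborel_pair.integrable_product_swap[OF this] show ?thesis by simp
  qed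
  show "integrable (lborel \<Otimes>\<^sub>M lborel) (\<lambda>(x, y). f y * g (x + y))" using *[of 1] by simp
  show "integrable (lborel \<Otimes>\<^sub>M lborel) (\<lambda>(x, y). f y * g (x - y))" using *[of "-1"] by simp
qed

lemma corr_measurable [measurable]:
  assumes [measurable]: "k \<in> borel_measurable borel" "F \<in> borel_measurable borel"
  shows "corr k F \<in> borel_measurable borel"
  unfolding corr_def by measurable

lemma conv_measurable [measurable]:
  assumes [measurable]: "k \<in> borel_measurable borel" "F \<in> borel_measurable borel"
  shows "conv k F \<in> borel_measurable borel"
  unfolding conv_def by measurable

text \<open>Young's inequality for L^1 against L^p. Jensen with weight |k| bounds |corr k F|^p
  pointwise by m^(p-1) times the correlation of |k| with |F|^p, and Fubini integrates that majorant.
  It also shows that the defining integral converges for almost every x only, so later operator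
  identities hold almost everywhere.\<close>

lemma Lp_corr:
  assumes p: "1 < p" and k: "integrable lborel k" and F: "Lp p F"
  shows "AE x in lborel. integrable lborel (\<lambda>y. k y * F (x + y))"
    and "Lp p (corr k F)"
    and "Lp_norm p (corr k F) \<le> (\<integral>y. norm (k y) \<partial>lborel) * Lp_norm p F"
proof -
  have [measurable]: "k \<in> borel_measurable borel" "F \<in> borel_measurable borel"
    using k F by (auto simp: Lp_def)
  define m where "m = (\<integral>y. norm (k y) \<partial>lborel)"
  have m0: "0 \<le> m" by (simp add: m_def)
  let ?P = "\<lambda>x y. norm (k y) * norm (F (x + y)) powr p"
  have P: "integrable (lborel \<Otimes>\<^sub>M lborel) (case_prod ?P)"
    using integrable_prod_shift(1)[OF integrable_norm[OF k] Lp_integrable[OF F]] by simp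
  have AE: "AE x in lborel. integrable lborel (?P x)" and iP: "integrable lborel (\<lambda>x. \<integral>y. ?P x y \<partial>lborel)"
    using lborel_pair.AE_integrable_fst[OF P] lborel_pair.integrable_fst[OF P] by auto
  have eq: "(\<integral>x. (\<integral>y. ?P x y \<partial>lborel) \<partial>lborel) = m * (\<integral>x. norm (F x) powr p \<partial>lborel)"
  proof -
    have "(\<integral>x. (\<integral>y. ?P x y \<partial>lborel) \<partial>lborel) = (\<integral>y. (\<integral>x. ?P x y \<partial>lborel) \<partial>lborel)"
      using lborel_pair.Fubini_integral[OF P] by simp
    also have "\<dots> = (\<integral>y. norm (k y) * (\<integral>x. norm (F x) powr p \<partial>lborel) \<partial>lborel)"
      using integral_shift[of "\<lambda>x. norm (F x) powr p"] by simp
    finally show ?thesis by (simp add: m_def)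
  qed
  have *: "integrable lborel (\<lambda>y. k y * F (x + y)) \<and> norm (corr k F x) powr p \<le> m powr (p - 1) * (\<integral>y. ?P x y \<partial>lborel)"
    if x: "integrable lborel (?P x)" for x
  proof -
    note J = Jensen_powr[OF p integrable_norm[OF k] _ _ _ x]
    have i: "integrable lborel (\<lambda>y. norm (k y) * norm (F (x + y)))"
      by (rule J(1)) auto
    have le: "(\<integral>y. norm (k y) * norm (F (x + y)) \<partial>lborel) powr p \<le> m powr (p - 1) * (\<integral>y. ?P x y \<partial>lborel)"
      unfolding m_def by (rule J(2)) auto
    have i': "integrable lborel (\<lambda>y. k y * F (x + y))"
      by (rule Bochner_Integration.integrable_bound[OF i]) (auto simp: norm_mult)
    have "norm (corr k F x) \<le> (\<integral>y. norm (k y * F (x + y)) \<partial>lborel)"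
      unfolding corr_def by (rule integral_norm_bound)
    then have "norm (corr k F x) powr p \<le> (\<integral>y. norm (k y) * norm (F (x + y)) \<partial>lborel) powr p"
      using p by (intro powr_mono2) (auto simp: norm_mult)
    with le i' show ?thesis by simp
  qed
  show "AE x in lborel. integrable lborel (\<lambda>y. k y * F (x + y))"
    using AE by eventually_elim (use * in auto)
  have le: "AE x in lborel. norm (corr k F x) powr p \<le> m powr (p - 1) * (\<integral>y. ?P x y \<partial>lborel)"
    using AE by eventually_elim (use * in auto)
  have i: "integrable lborel (\<lambda>x. norm (corr k F x) powr p)"
  proof (rule Bochner_Integration.integrable_bound)
    show "integrable lborel (\<lambda>x. m powr (p - 1) * (\<integral>y. ?P x y \<partial>lborel))" using iP by simp
    show "AE x in lborel. norm (norm (corr k F x) powr p) \<le> norm (m powr (p - 1) * (\<integral>y. ?P x y \<partial>lborel))"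
      using le by eventually_elim (auto intro: order_trans[OF _ abs_ge_self])
  qed auto
  show "Lp p (corr k F)" using i by (simp add: Lp_def)
  have "(\<integral>x. norm (corr k F x) powr p \<partial>lborel) \<le> (\<integral>x. m powr (p - 1) * (\<integral>y. ?P x y \<partial>lborel) \<partial>lborel)"
    using iP by (intro integral_mono_AE i le) simp
  also have "\<dots> = m powr p * (\<integral>x. norm (F x) powr p \<partial>lborel)"
    using eq m0 p by (simp add: mult.assoc[symmetric] powr_mult_base[of m "p - 1"] mult.commute[of "m powr (p - 1)" m])
  finally have "Lp_norm p (corr k F) \<le> (m powr p * (\<integral>x. norm (F x) powr p \<partial>lborel)) powr (1 / p)"
    unfolding Lp_norm_def using p by (intro powr_mono2) auto
  also have "\<dots> = m * Lp_norm p F" using p m0 by (simp add: Lp_norm_def powr_mult powr_powr)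
  finally show "Lp_norm p (corr k F) \<le> (\<integral>y. norm (k y) \<partial>lborel) * Lp_norm p F" by (simp add: m_def)
qed

section \<open>The algebra of correlation operators\<close>

lemma corr_cong_AE:
  assumes "AE x in lborel. F x = G x"
    and [measurable]: "k \<in> borel_measurable borel" "F \<in> borel_measurable borel" "G \<in> borel_measurable borel"
  shows "corr k F x = corr k G x"
  unfolding corr_def
proof (rule integral_cong_AE)
  have "AE y in lborel. F (x + 1 * y) = G (x + 1 * y)"
    using AE_borel_affine[of 1 "\<lambda>y. F y = G y" x] assms(1) by simp
  then show "AE y in lborel. k y * F (x + y) = k y * G (x + y)" by eventually_elim simp
qed auto

lemma corr_kernel_cong_AE:
  assumes "AE x in lborel. k x = l x"
    and [measurable]: "k \<in> borel_measurable borel" "l \<in> borel_measurable borel" "F \<in> borel_measurable borel"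
  shows "corr k F x = corr l F x"
  unfolding corr_def by (rule integral_cong_AE) (use assms in auto)

lemma corr_lincomb:
  assumes p: "1 < p" and k: "integrable lborel k" and F: "Lp p F" and G: "Lp p G"
  shows "AE x in lborel. corr k (\<lambda>x. a * F x + b * G x) x = a * corr k F x + b * corr k G x"
  using Lp_corr(1)[OF p k F] Lp_corr(1)[OF p k G]
proof eventually_elim
  case (elim x)
  have "corr k (\<lambda>x. a * F x + b * G x) x = (\<integral>y. a * (k y * F (x + y)) + b * (k y * G (x + y)) \<partial>lborel)"
    unfolding corr_def by (simp add: algebra_simps)
  also have "\<dots> = a * corr k F x + b * corr k G x"
    using elim unfolding corr_def by simp
  finally show ?case .
qed

lemma corr_kernel_lincomb:
  assumes p: "1 < p" and k: "integrable lborel k" and l: "integrable lborel l" and F: "Lp p F"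
  shows "AE x in lborel. corr (\<lambda>y. a * k y + b * l y) F x = a * corr k F x + b * corr l F x"
  using Lp_corr(1)[OF p k F] Lp_corr(1)[OF p l F]
proof eventually_elim
  case (elim x)
  have "corr (\<lambda>y. a * k y + b * l y) F x = (\<integral>y. a * (k y * F (x + y)) + b * (l y * F (x + y)) \<partial>lborel)"
    unfolding corr_def by (simp add: algebra_simps)
  also have "\<dots> = a * corr k F x + b * corr l F x"
    using elim unfolding corr_def by simp
  finally show ?case .
qed

lemma conv_integrable:
  assumes f: "integrable lborel f" and g: "integrable lborel g"
  shows "integrable lborel (conv f g)"
    and "AE x in lborel. integrable lborel (\<lambda>y. f y * g (x - y))"
proof -
  note P = integrable_prod_shift(2)[OF f g]
  show "integrable lborel (conv f g)"
    using lborel_pair.integrable_fst[OF P] unfolding conv_def[abs_def] by simp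
  show "AE x in lborel. integrable lborel (\<lambda>y. f y * g (x - y))"
    using lborel_pair.AE_integrable_fst[OF P] by simp
qed

lemma conv_commute: "conv f g x = conv g f x"
  using integral_reflect[of "\<lambda>y. f y * g (x - y)" x] unfolding conv_def by (simp add: mult.commute)

text \<open>Fubini. Absolute integrability at x is supplied by \<open>Lp_corr\<close> for the
  moduli: the convolution of |k| and |l| is integrable, so its correlation with |F| converges for
  almost every x, and these are the x for which the identity is proved.\<close>

lemma corr_corr:
  assumes p: "1 < p" and k: "integrable lborel k" and l: "integrable lborel l" and F: "Lp p F"
  shows "AE x in lborel. corr k (corr l F) x = corr (conv k l) F x"
proof -
  have [measurable]: "k \<in> borel_measurable borel" "l \<in> borel_measurable borel" "F \<in> borel_measurable borel"
    using k l F by (auto simp: Lp_def)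
  let ?c = "conv (\<lambda>x. norm (k x)) (\<lambda>x. norm (l x))"
  have nk: "integrable lborel (\<lambda>x. complex_of_real (norm (k x)))"
    and nl: "integrable lborel (\<lambda>x. complex_of_real (norm (l x)))" using k l by auto
  have nF: "Lp p (\<lambda>x. complex_of_real (norm (F x)))" using F by (auto simp: Lp_def)
  note c = conv_integrable[OF nk nl]
  have c': "AE v in lborel. integrable lborel (\<lambda>y. norm (k y) * norm (l (v - y))) \<and>
      norm (?c v) = (\<integral>y. norm (k y) * norm (l (v - y)) \<partial>lborel)"
    using c(2)
  proof eventually_elim
    case (elim v)
    then have "integrable lborel (\<lambda>y. complex_of_real (norm (k y) * norm (l (v - y))))" by simp
    then have i: "integrable lborel (\<lambda>y. norm (k y) * norm (l (v - y)))"
      by (simp only: complex_of_real_integrable_eq)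
    have "?c v = complex_of_real (\<integral>y. norm (k y) * norm (l (v - y)) \<partial>lborel)"
      unfolding conv_def by (simp flip: of_real_mult)
    then show ?case using i by simp
  qed
  show ?thesis using Lp_corr(1)[OF p c(1) nF]
  proof eventually_elim
    case (elim x)
    then have i: "integrable lborel (\<lambda>v. norm (?c v) * norm (F (x + v)))"
      using integrable_norm[OF elim] by (simp add: norm_mult)
    let ?H = "\<lambda>v y. k y * l (v - y) * F (x + v)"
    have I: "integrable (lborel \<Otimes>\<^sub>M lborel) (case_prod ?H)"
    proof (rule lborel_pair.Fubini_integrable)
      show "integrable lborel (\<lambda>v. \<integral>y. norm (case (v, y) of (v, y) \<Rightarrow> ?H v y) \<partial>lborel)"
      proof (rule integrable_cong_AE_imp[OF i])
        show "AE v in lborel. norm (?c v) * norm (F (x + v)) = (\<integral>y. norm (case (v, y) of (v, y) \<Rightarrow> ?H v y) \<partial>lborel)"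
          using c' by eventually_elim (simp add: norm_mult)
      qed auto
      show "AE v in lborel. integrable lborel (\<lambda>y. case (v, y) of (v, y) \<Rightarrow> ?H v y)"
        using c'
      proof eventually_elim
        case (elim v)
        then have "integrable lborel (\<lambda>y. norm (k y * l (v - y)))" by (simp add: norm_mult)
        then have "integrable lborel (\<lambda>y. k y * l (v - y))"
          by (rule integrable_norm_cancel) measurable
        then show ?case by simp
      qed
    qed measurable
    have "corr k (corr l F) x = (\<integral>y. (\<integral>v. ?H v y \<partial>lborel) \<partial>lborel)"
    proof -
      have "k y * corr l F (x + y) = (\<integral>v. ?H v y \<partial>lborel)" for y
      proof -
        have "corr l F (x + y) = (\<integral>w. l (w - y) * F (x + w) \<partial>lborel)"
          using integral_shift[of "\<lambda>w. l (w - y) * F (x + w)" y] by (simp add: corr_def algebra_simps)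
        then show ?thesis by (simp add: mult.assoc)
      qed
      then show ?thesis by (subst corr_def) simp
    qed
    also have "\<dots> = (\<integral>v. (\<integral>y. ?H v y \<partial>lborel) \<partial>lborel)"
      by (rule lborel_pair.Fubini_integral[OF I])
    also have "\<dots> = corr (conv k l) F x"
      unfolding corr_def conv_def by simp
    finally show ?case .
  qed
qed

lemma corr_commute:
  assumes p: "1 < p" and k: "integrable lborel k" and l: "integrable lborel l" and F: "Lp p F"
  shows "AE x in lborel. corr k (corr l F) x = corr l (corr k F) x"
proof -
  have "conv k l = conv l k" by (rule ext) (rule conv_commute)
  then show ?thesis using corr_corr[OF p k l F] corr_corr[OF p l k F] by auto
qed

text \<open>The sign in the exponent is that of characteristic functions, which lets
  \<open>char\<close> be used for inversion, and it makes \<open>ftrans k\<close> the multiplier of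
  \<open>corr k\<close>.\<close>

definition ftrans :: "(real \<Rightarrow> complex) \<Rightarrow> real \<Rightarrow> complex" where
  "ftrans f \<xi> = (\<integral>y. f y * iexp (\<xi> * y) \<partial>lborel)"

lemma integrable_mult_iexp:
  assumes "integrable lborel f" "g \<in> borel_measurable borel"
  shows "integrable lborel (\<lambda>y. f y * iexp (g y))"
proof (rule Bochner_Integration.integrable_bound[OF assms(1)])
  have "f \<in> borel_measurable borel" using assms(1) by auto
  then show "(\<lambda>y. f y * iexp (g y)) \<in> borel_measurable lborel" using assms(2) by measurable
qed (auto simp: norm_mult)

lemma ftrans_conv:
  assumes f: "integrable lborel f" and g: "integrable lborel g"
  shows "ftrans (conv f g) \<xi> = ftrans f \<xi> * ftrans g \<xi>"
proof -
  have m[measurable]: "f \<in> borel_measurable borel" "g \<in> borel_measurable borel" using f g by auto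
  let ?f = "\<lambda>y. f y * iexp (\<xi> * y)" let ?g = "\<lambda>y. g y * iexp (\<xi> * y)"
  have fi: "integrable lborel ?f" "integrable lborel ?g" 
    using integrable_mult_iexp[OF f, of "\<lambda>y. \<xi> * y"] integrable_mult_iexp[OF g, of "\<lambda>y. \<xi> * y"] by simp_all
  note P = integrable_prod_shift(2)[OF fi]
  have e: "f y * g (x - y) * iexp (\<xi> * x) = ?f y * ?g (x - y)" for x y
    by (simp add: algebra_simps flip: exp_add)
  have "ftrans (conv f g) \<xi> = (\<integral>x. (\<integral>y. ?f y * ?g (x - y) \<partial>lborel) \<partial>lborel)"
    unfolding ftrans_def conv_def e[symmetric] integral_mult_left_zero[symmetric] by simp
  also have "\<dots> = (\<integral>y. (\<integral>x. ?f y * ?g (x - y) \<partial>lborel) \<partial>lborel)"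
    using lborel_pair.Fubini_integral[OF P] by simp
  also have "\<dots> = (\<integral>y. ?f y * (\<integral>x. ?g x \<partial>lborel) \<partial>lborel)"
    using integral_shift[of ?g "- _"] by simp
  finally show ?thesis by (simp add: ftrans_def)
qed

section \<open>Fourier transforms of integrable functions\<close>

lemma has_vector_derivative_if_quotient_tendsto:
  fixes f :: "real \<Rightarrow> 'a::real_normed_vector"
  assumes "((\<lambda>y. (f y - f x) /\<^sub>R (y - x)) \<longlongrightarrow> D) (at x)"
  shows "(f has_vector_derivative D) (at x)"
  unfolding has_vector_derivative_def has_derivative_within
proof (intro conjI)
  show "bounded_linear (\<lambda>h. h *\<^sub>R D)" by (rule bounded_linear_scaleR_left)
  have "((\<lambda>y. norm ((f y - f x) /\<^sub>R (y - x) - D)) \<longlongrightarrow> 0) (at x)"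
    using assms by (simp add: LIM_zero tendsto_norm_zero)
  then have "((\<lambda>y. norm ((1 / norm (y - x)) *\<^sub>R (f y - (f x + (y - x) *\<^sub>R D)))) \<longlongrightarrow> 0) (at x)"
  proof (rule Lim_transform_eventually)
    show "\<forall>\<^sub>F y in at x. norm ((f y - f x) /\<^sub>R (y - x) - D) = norm ((1 / norm (y - x)) *\<^sub>R (f y - (f x + (y - x) *\<^sub>R D)))"
      unfolding eventually_at_filter
    proof (intro always_eventually allI impI)
      fix y assume "y \<noteq> x"
      then have "f y - (f x + (y - x) *\<^sub>R D) = (y - x) *\<^sub>R ((f y - f x) /\<^sub>R (y - x) - D)"
        by (simp add: scaleR_right_diff_distrib[of "y - x" "(f y - f x) /\<^sub>R (y - x)"] del: scaleR_diff_right)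
      then show "norm ((f y - f x) /\<^sub>R (y - x) - D) = norm ((1 / norm (y - x)) *\<^sub>R (f y - (f x + (y - x) *\<^sub>R D)))"
        using \<open>y \<noteq> x\<close> by simp
    qed
  qed
  then show "((\<lambda>y. (1 / norm (y - x)) *\<^sub>R (f y - (f x + (y - x) *\<^sub>R D))) \<longlongrightarrow> 0) (at x)"
    by (rule tendsto_norm_zero_cancel)
qed

lemma has_vector_derivative_quotient_tendsto:
  fixes f :: "real \<Rightarrow> 'a::real_normed_vector"
  assumes "(f has_vector_derivative D) (at x)"
  shows "((\<lambda>y. (f y - f x) /\<^sub>R (y - x)) \<longlongrightarrow> D) (at x)"
proof -
  have "((\<lambda>y. (1 / norm (y - x)) *\<^sub>R (f y - (f x + (y - x) *\<^sub>R D))) \<longlongrightarrow> 0) (at x)"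
    using assms by (simp add: has_vector_derivative_def has_derivative_within)
  then have "((\<lambda>y. norm ((1 / norm (y - x)) *\<^sub>R (f y - (f x + (y - x) *\<^sub>R D)))) \<longlongrightarrow> 0) (at x)"
    by (rule tendsto_norm_zero)
  then have "((\<lambda>y. norm ((f y - f x) /\<^sub>R (y - x) - D)) \<longlongrightarrow> 0) (at x)"
  proof (rule Lim_transform_eventually)
    show "\<forall>\<^sub>F y in at x. norm ((1 / norm (y - x)) *\<^sub>R (f y - (f x + (y - x) *\<^sub>R D))) = norm ((f y - f x) /\<^sub>R (y - x) - D)"
      unfolding eventually_at_filter
    proof (intro always_eventually allI impI)
      fix y assume "y \<noteq> x"
      then have "f y - (f x + (y - x) *\<^sub>R D) = (y - x) *\<^sub>R ((f y - f x) /\<^sub>R (y - x) - D)"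
        by (simp add: scaleR_right_diff_distrib[of "y - x" "(f y - f x) /\<^sub>R (y - x)"] del: scaleR_diff_right)
      then show "norm ((1 / norm (y - x)) *\<^sub>R (f y - (f x + (y - x) *\<^sub>R D))) = norm ((f y - f x) /\<^sub>R (y - x) - D)"
        using \<open>y \<noteq> x\<close> by simp
    qed
  qed
  then show ?thesis by (rule LIM_zero_cancel[OF tendsto_norm_zero_cancel])
qed

text \<open>Dominated convergence for difference quotients. The mean value inequality on the convex
  set \<open>S\<close> bounds every quotient by the majorant \<open>g\<close> of the
  derivatives.\<close>

lemma has_vector_derivative_lebesgue_integral:
  fixes f f' :: "real \<Rightarrow> 'b \<Rightarrow> complex"
  assumes S: "open S" "convex S" "x \<in> S"
    and der: "\<And>s y. s \<in> S \<Longrightarrow> y \<in> space M \<Longrightarrow> ((\<lambda>s. f s y) has_vector_derivative f' s y) (at s)"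
    and f: "\<And>s. s \<in> S \<Longrightarrow> integrable M (f s)"
    and f': "f' x \<in> borel_measurable M"
    and g: "integrable M g" "\<And>s y. s \<in> S \<Longrightarrow> y \<in> space M \<Longrightarrow> norm (f' s y) \<le> g y"
  shows "((\<lambda>s. \<integral>y. f s y \<partial>M) has_vector_derivative (\<integral>y. f' x y \<partial>M)) (at x)"
proof (rule has_vector_derivative_if_quotient_tendsto)
  have nsc: "norm (v /\<^sub>R c) = norm v / \<bar>c\<bar>" for v :: complex and c
    by (simp add: divide_inverse mult.commute)
  have "((\<lambda>s. ((\<integral>y. f s y \<partial>M) - (\<integral>y. f x y \<partial>M)) /\<^sub>R (s - x)) \<longlongrightarrow> (\<integral>y. f' x y \<partial>M)) (at x within S)"
    unfolding tendsto_at_iff_sequentially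
  proof (intro allI impI)
    fix X :: "nat \<Rightarrow> real" assume X: "\<forall>i. X i \<in> S - {x}" "X \<longlonglongrightarrow> x"
    have "(\<lambda>n. \<integral>y. (f (X n) y - f x y) /\<^sub>R (X n - x) \<partial>M) \<longlonglongrightarrow> (\<integral>y. f' x y \<partial>M)"
    proof (rule integral_dominated_convergence[where w = g])
      show "(\<lambda>y. (f (X n) y - f x y) /\<^sub>R (X n - x)) \<in> borel_measurable M" for n
        using f[of "X n"] f[OF S(3)] X by (intro borel_measurable_scaleR borel_measurable_diff) auto
      show "AE y in M. (\<lambda>n. (f (X n) y - f x y) /\<^sub>R (X n - x)) \<longlonglongrightarrow> f' x y"
      proof (rule AE_I2)
        fix y assume y: "y \<in> space M"
        have "((\<lambda>s. (f s y - f x y) /\<^sub>R (s - x)) \<longlongrightarrow> f' x y) (at x within UNIV)"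
          using has_vector_derivative_quotient_tendsto[OF der[OF S(3) y]] by simp
        then show "(\<lambda>n. (f (X n) y - f x y) /\<^sub>R (X n - x)) \<longlonglongrightarrow> f' x y"
          using X unfolding tendsto_at_iff_sequentially by (auto simp: comp_def)
      qed
      show "AE y in M. norm ((f (X n) y - f x y) /\<^sub>R (X n - x)) \<le> g y" for n
      proof (rule AE_I2)
        fix y assume y: "y \<in> space M"
        have "norm (f (X n) y - f x y) \<le> g y * norm (X n - x)"
        proof (rule differentiable_bound[OF S(2), where f' = "\<lambda>s h. h *\<^sub>R f' s y"])
          fix s assume s: "s \<in> S"
          show "((\<lambda>s. f s y) has_derivative (\<lambda>h. h *\<^sub>R f' s y)) (at s within S)"
            using der[OF s y] by (auto simp: has_vector_derivative_def intro: has_derivative_at_withinI)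
          show "onorm (\<lambda>h. h *\<^sub>R f' s y) \<le> g y"
            using g(2)[OF s y] order_trans[OF norm_ge_zero g(2)[OF s y]]
            by (intro onorm_bound) (auto simp: mult.commute[of "g y"] mult_left_mono)
        qed (use X S in auto)
        then show "norm ((f (X n) y - f x y) /\<^sub>R (X n - x)) \<le> g y"
          using spec[OF X(1), of n] nsc[of "X n - x" "f (X n) y - f x y"] by (simp add: pos_divide_le_eq)
      qed
    qed (use g f' in auto)
    moreover have "(\<integral>y. (f (X n) y - f x y) /\<^sub>R (X n - x) \<partial>M) = ((\<integral>y. f (X n) y \<partial>M) - (\<integral>y. f x y \<partial>M)) /\<^sub>R (X n - x)" for n
      using f[of "X n"] f[OF S(3)] X by simp
    ultimately show "((\<lambda>s. ((\<integral>y. f s y \<partial>M) - (\<integral>y. f x y \<partial>M)) /\<^sub>R (s - x)) \<circ> X) \<longlonglongrightarrow> (\<integral>y. f' x y \<partial>M)"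
      unfolding comp_def by (simp only:)
  qed
  then show "((\<lambda>s. ((\<integral>y. f s y \<partial>M) - (\<integral>y. f x y \<partial>M)) /\<^sub>R (s - x)) \<longlongrightarrow> (\<integral>y. f' x y \<partial>M)) (at x)"
    using at_within_open[OF S(3,1)] by simp
qed

lemma norm_ftrans_le: "integrable lborel f \<Longrightarrow> norm (ftrans f \<xi>) \<le> (\<integral>y. norm (f y) \<partial>lborel)"
  unfolding ftrans_def by (rule order_trans[OF integral_norm_bound]) (simp add: norm_mult)

lemma has_vector_derivative_ftrans:
  assumes f: "integrable lborel f" and f': "integrable lborel (\<lambda>y. complex_of_real y * f y)"
  shows "(ftrans f has_vector_derivative ftrans (\<lambda>y. \<i> * (of_real y * f y)) \<xi>) (at \<xi>)"
  unfolding ftrans_def[abs_def]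
proof (rule has_vector_derivative_lebesgue_integral[where S = UNIV])
  have [measurable]: "f \<in> borel_measurable borel" using f by auto
  show "integrable lborel (\<lambda>y. f y * iexp (s * y))" for s
    by (rule integrable_mult_iexp[OF f]) auto
  show "(\<lambda>y. \<i> * (complex_of_real y * f y) * iexp (\<xi> * y)) \<in> borel_measurable lborel" by measurable
  show "integrable lborel (\<lambda>y. norm (complex_of_real y * f y))" using f' by (rule integrable_norm)
  show "norm (\<i> * (complex_of_real y * f y) * iexp (s * y)) \<le> norm (complex_of_real y * f y)" for s y
    by (simp add: norm_mult)
  show "((\<lambda>s. f y * iexp (s * y)) has_vector_derivative \<i> * (complex_of_real y * f y) * iexp (s * y)) (at s)" for s y
  proof -
    have "((\<lambda>s. f y * exp (\<i> * (s * of_real y))) has_field_derivative f y * (exp (\<i> * (of_real s * of_real y)) * (\<i> * of_real y))) (at (of_real s))"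
      by (auto intro!: derivative_eq_intros)
    from has_vector_derivative_real_field[OF this] show ?thesis by (simp add: mult_ac)
  qed
qed auto

text \<open>Integration by parts: the derivative of h(x) exp(i\<xi>x) integrates to 0 because
  \<open>h\<close> vanishes at both ends.\<close>

lemma ftrans_derivative:
  assumes h: "integrable lborel h" and h': "integrable lborel h'"
    and der: "\<And>x. (h has_vector_derivative h' x) (at x)" and cont: "\<And>x. isCont h' x"
    and top: "(h \<longlongrightarrow> 0) at_top" and bot: "(h \<longlongrightarrow> 0) at_bot"
  shows "ftrans h' \<xi> = - \<i> * of_real \<xi> * ftrans h \<xi>"
proof -
  let ?f = "\<lambda>x. h' x * iexp (\<xi> * x) + h x * (\<i> * of_real \<xi> * iexp (\<xi> * x))"
  let ?F = "\<lambda>x. h x * iexp (\<xi> * x)"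
  have ch: "isCont h x" for x using der by (rule has_vector_derivative_continuous)
  have e: "((\<lambda>x. iexp (\<xi> * x)) has_vector_derivative \<i> * of_real \<xi> * iexp (\<xi> * x)) (at x)" for x
  proof -
    have "((\<lambda>s. exp (\<i> * (of_real \<xi> * s))) has_field_derivative (exp (\<i> * (of_real \<xi> * of_real x)) * (\<i> * of_real \<xi>))) (at (of_real x))"
      by (auto intro!: derivative_eq_intros)
    from has_vector_derivative_real_field[OF this] show ?thesis by (simp add: mult_ac)
  qed
  have d: "(?F has_vector_derivative ?f x) (at x)" for x
    using has_vector_derivative_mult[OF der e, of x] by (simp add: add.commute)
  have c: "isCont ?f x" for x
    using cont ch by (intro continuous_intros) auto
  have i1: "integrable lborel (\<lambda>x. h' x * iexp (\<xi> * x))" by (rule integrable_mult_iexp[OF h']) auto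
  have i2: "integrable lborel (\<lambda>x. h x * iexp (\<xi> * x))" by (rule integrable_mult_iexp[OF h]) auto
  have i2': "integrable lborel (\<lambda>x. \<i> * of_real \<xi> * (h x * iexp (\<xi> * x)))" using i2 by (rule integrable_mult_right)
  have i3: "integrable lborel (\<lambda>x. h x * (\<i> * of_real \<xi> * iexp (\<xi> * x)))"
    using i2' by (rule back_subst[of "integrable lborel"]) (simp add: fun_eq_iff)
  have i: "integrable lborel ?f" using i1 i3 by (rule Bochner_Integration.integrable_add)
  have z: "(?F \<longlongrightarrow> 0) G" if "(h \<longlongrightarrow> 0) G" for G
    using tendsto_norm_zero[OF that] by (rule tendsto_norm_zero_cancel[OF back_subst[of "\<lambda>f. (f \<longlongrightarrow> 0) G"]]) (simp add: norm_mult)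
  have "(LBINT x=-\<infinity>..\<infinity>. ?f x) = 0 - 0"
  proof (rule interval_integral_FTC_integrable)
    show "set_integrable lborel (einterval (- \<infinity>) \<infinity>) ?f" using i by (simp add: set_integrable_def)
    show "((?F \<circ> real_of_ereal) \<longlongrightarrow> 0) (at_right (-\<infinity>))"
      using z[OF bot] by (simp add: ereal_tendsto_simps comp_assoc)
    show "((?F \<circ> real_of_ereal) \<longlongrightarrow> 0) (at_left \<infinity>)"
      using z[OF top] by (simp add: ereal_tendsto_simps comp_assoc)
  qed (use d c in auto)
  then have "(\<integral>x. ?f x \<partial>lborel) = 0"
    by (simp add: interval_lebesgue_integral_def set_lebesgue_integral_def)
  then have "ftrans h' \<xi> + (\<integral>x. h x * (\<i> * of_real \<xi> * iexp (\<xi> * x)) \<partial>lborel) = 0"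
    unfolding ftrans_def using i1 i3 by (simp only: Bochner_Integration.integral_add)
  moreover have "(\<integral>x. h x * (\<i> * of_real \<xi> * iexp (\<xi> * x)) \<partial>lborel) = \<i> * of_real \<xi> * ftrans h \<xi>"
    unfolding ftrans_def integral_mult_right_zero[symmetric] by (intro Bochner_Integration.integral_cong) auto
  ultimately show ?thesis by (simp add: eq_neg_iff_add_eq_0)
qed

section \<open>Quadratic decay, uniqueness from interval integrals, Fourier inversion\<close>

lemma integrable_inverse_1_plus_square': "integrable lborel (\<lambda>x::real. inverse (1 + x\<^sup>2))"
  using integrable_inverse_1_plus_square by (simp add: set_integrable_def)

lemma integrable_decay:
  fixes f :: "real \<Rightarrow> complex"
  assumes "f \<in> borel_measurable borel" "\<And>x. norm (f x) \<le> C / (1 + x\<^sup>2)"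
  shows "integrable lborel f"
proof (rule Bochner_Integration.integrable_bound)
  show "integrable lborel (\<lambda>x. C / (1 + x\<^sup>2))"
    unfolding divide_inverse by (rule integrable_mult_right[OF integrable_inverse_1_plus_square'])
  show "AE x in lborel. norm (f x) \<le> norm (C / (1 + x\<^sup>2))"
    using assms(2) by (intro AE_I2) (metis abs_ge_self order_trans real_norm_def)
qed (use assms in auto)

lemma decay_tendsto_0:
  fixes f :: "real \<Rightarrow> complex"
  assumes "\<And>x. norm (f x) \<le> C / (1 + x\<^sup>2)"
  shows "(f \<longlongrightarrow> 0) at_top" "(f \<longlongrightarrow> 0) at_bot"
proof -
  have "((\<lambda>x::real. C / (1 + x\<^sup>2)) \<longlongrightarrow> 0) at_top"
    by (intro tendsto_divide_0[OF tendsto_const] filterlim_at_top_imp_at_infinity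
        filterlim_tendsto_add_at_top[OF tendsto_const] filterlim_pow_at_top filterlim_ident) auto
  moreover have "((\<lambda>x::real. C / (1 + x\<^sup>2)) \<longlongrightarrow> 0) at_bot"
    by (intro tendsto_divide_0[OF tendsto_const] filterlim_at_top_imp_at_infinity
        filterlim_tendsto_add_at_top[OF tendsto_const] filterlim_pow_at_bot_even filterlim_ident) auto
  ultimately show "(f \<longlongrightarrow> 0) at_top" "(f \<longlongrightarrow> 0) at_bot"
    using Lim_null_comparison[OF always_eventually, of f "\<lambda>x. C / (1 + x\<^sup>2)"] assms by blast+
qed

text \<open>The positive and negative parts of \<open>f\<close> are densities of two finite measures
  that agree on all rays (x, \<infinity>). Such measures coincide, and densities are unique almost
  everywhere.\<close>

lemma AE_zero_if_tail_integrals_zero: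
  fixes f :: "real \<Rightarrow> real"
  assumes f: "integrable lborel f" and 0: "\<And>x. (\<integral>y. f y * indicator {x<..} y \<partial>lborel) = 0"
  shows "AE x in lborel. f x = 0"
proof -
  have [measurable]: "f \<in> borel_measurable borel" using f by auto
  let ?p = "\<lambda>x. max 0 (f x)" let ?n = "\<lambda>x. max 0 (- f x)"
  have i: "integrable lborel ?p" "integrable lborel ?n" using f by auto
  have ii: "integrable lborel (\<lambda>y. ?p y * indicator {x<..} y)" "integrable lborel (\<lambda>y. ?n y * indicator {x<..} y)" for x
    using i by (auto intro!: integrable_real_mult_indicator)
  have e: "emeasure (density lborel (\<lambda>y. ennreal (g y))) {x<..} = ennreal (\<integral>y. g y * indicator {x<..} y \<partial>lborel)"
    if [measurable]: "g \<in> borel_measurable borel" and "\<And>y. g y \<ge> 0" "integrable lborel (\<lambda>y. g y * indicator {x<..} y)" for g :: "real \<Rightarrow> real" and x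
  proof -
    have "emeasure (density lborel (\<lambda>y. ennreal (g y))) {x<..} = (\<integral>\<^sup>+y. ennreal (g y * indicator {x<..} y) \<partial>lborel)"
      by (subst emeasure_density) (auto intro!: nn_integral_cong split: split_indicator)
    then show ?thesis using that by (simp add: nn_integral_eq_integral)
  qed
  have "density lborel (\<lambda>x. ennreal (?p x)) = density lborel (\<lambda>x. ennreal (?n x))"
  proof (rule measure_eqI_lessThan)
    fix x
    have "(\<integral>y. ?p y * indicator {x<..} y - ?n y * indicator {x<..} y \<partial>lborel) = (\<integral>y. f y * indicator {x<..} y \<partial>lborel)"
      by (intro Bochner_Integration.integral_cong) (auto split: split_indicator)
    then have "(\<integral>y. ?p y * indicator {x<..} y \<partial>lborel) = (\<integral>y. ?n y * indicator {x<..} y \<partial>lborel)"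
      using ii[of x] 0[of x] by simp
    then show "emeasure (density lborel (\<lambda>x. ennreal (?p x))) {x<..} = emeasure (density lborel (\<lambda>x. ennreal (?n x))) {x<..}"
      using ii[of x] by (subst (1 2) e) auto
    show "emeasure (density lborel (\<lambda>x. ennreal (?p x))) {x<..} < \<infinity>"
      using ii[of x] by (subst e) auto
  qed auto
  then have "AE x in lborel. ennreal (?p x) = ennreal (?n x)"
    by (intro sigma_finite_measure.density_unique[OF lborel.sigma_finite_measure_axioms]) auto
  then show ?thesis by eventually_elim (auto simp: max_def split: if_splits)
qed

lemma AE_zero_if_interval_integrals_zero:
  fixes f :: "real \<Rightarrow> complex"
  assumes f: "\<And>a b. integrable lborel (\<lambda>y. indicator {a<..b} y *\<^sub>R f y)"
    and 0: "\<And>a b. a < b \<Longrightarrow> (\<integral>y. indicator {a<..b} y *\<^sub>R f y \<partial>lborel) = 0"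
  shows "AE x in lborel. f x = 0"
proof -
  have *: "AE x in lborel. x \<in> {- real n<..real n} \<longrightarrow> f x = 0" for n
  proof -
    let ?g = "\<lambda>y. indicator {- real n<..real n} y *\<^sub>R f y"
    have g: "integrable lborel ?g" by (rule f)
    \<comment> \<open>A ray cut down to the window (-n, n] is again a half-open interval, possibly
      empty, so the hypothesis on intervals yields the tail integrals of the localized
      function.\<close>
    have z: "(\<integral>y. indicator {x<..} y *\<^sub>R ?g y \<partial>lborel) = 0" for x
    proof -
      have "(\<integral>y. indicator {x<..} y *\<^sub>R ?g y \<partial>lborel) = (\<integral>y. indicator {max x (- real n)<..real n} y *\<^sub>R f y \<partial>lborel)"
        by (intro Bochner_Integration.integral_cong) (auto split: split_indicator)
      also have "\<dots> = 0"
        using 0[of "max x (- real n)" "real n"]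
        by (cases "max x (- real n) < real n") auto
      finally show ?thesis .
    qed
    have ig: "integrable lborel (\<lambda>y. indicator {x<..} y *\<^sub>R ?g y)" for x
      by (rule integrable_mult_indicator[OF _ g]) auto
    have "AE x in lborel. Re (?g x) = 0"
    proof (rule AE_zero_if_tail_integrals_zero)
      show "integrable lborel (\<lambda>x. Re (?g x))" using g by (rule integrable_Re)
      show "(\<integral>y. Re (?g y) * indicator {x<..} y \<partial>lborel) = 0" for x
        using arg_cong[OF z[of x], of Re] integral_Re[OF ig[of x]] by (simp add: mult_ac)
    qed
    moreover have "AE x in lborel. Im (?g x) = 0"
    proof (rule AE_zero_if_tail_integrals_zero)
      show "integrable lborel (\<lambda>x. Im (?g x))" using g by (rule integrable_Im)
      show "(\<integral>y. Im (?g y) * indicator {x<..} y \<partial>lborel) = 0" for x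
        using arg_cong[OF z[of x], of Im] integral_Im[OF ig[of x]] by (simp add: mult_ac)
    qed
    ultimately show ?thesis
      by eventually_elim (auto simp: complex_eq_iff split: split_indicator_asm)
  qed
  have "AE x in lborel. \<forall>n. x \<in> {- real n<..real n} \<longrightarrow> f x = 0"
    unfolding AE_all_countable using * by blast
  then show ?thesis
  proof eventually_elim
    case (elim x)
    obtain n where "\<bar>x\<bar> < real n" using reals_Archimedean2 by blast
    then have "x \<in> {- real n<..real n}" by auto
    then show ?case using elim by auto
  qed
qed

lemma ftrans_measurable [measurable]:
  assumes [measurable]: "f \<in> borel_measurable borel"
  shows "ftrans f \<in> borel_measurable borel"
  unfolding ftrans_def by measurable

lemma iexp_interval_integral:
  fixes a b t :: real
  assumes "a \<le> b" "t \<noteq> 0"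
  shows "(\<integral>s. indicator {a..b} s *\<^sub>R iexp (- (t * s)) \<partial>lborel) = (iexp (- (t * a)) - iexp (- (t * b))) / (\<i> * t)"
proof -
  have "(\<integral>s. indicator {a..b} s *\<^sub>R iexp (- (t * s)) \<partial>lborel) =
      - iexp (- (t * b)) / (\<i> * t) - (- iexp (- (t * a)) / (\<i> * t))"
  proof (rule integral_FTC_Icc[OF assms(1)])
    fix x
    have "((\<lambda>s. - exp (\<i> * (- (of_real t * s))) / (\<i> * t)) has_field_derivative exp (\<i> * (- (of_real t * of_real x)))) (at (of_real x))"
      using assms(2) by (auto intro!: derivative_eq_intros simp: field_simps)
    from has_vector_derivative_real_field[OF this]
    show "((\<lambda>s. - iexp (- (t * s)) / (\<i> * complex_of_real t)) has_vector_derivative iexp (- (t * x))) (at x within {a..b})"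
      by (auto intro: has_vector_derivative_at_within)
  qed (auto intro!: continuous_intros)
  also have "\<dots> = (iexp (- (t * a)) - iexp (- (t * b))) / (\<i> * t)" by (simp add: diff_divide_distrib)
  finally show ?thesis .
qed

text \<open>Divided by its mass, \<open>r\<close> is a probability density, so Levy's formula
  expresses the mass of (a, b] through the characteristic function. Integrability of the transform
  allows passing to the limit and exchanging integrals, which gives the integral of the candidate
  \<open>G\<close> over the same interval; interval integrals determine a function almost
  everywhere.\<close>

theorem fourier_inversion_nonneg:
  fixes r :: "real \<Rightarrow> real"
  assumes r: "integrable lborel r" "\<And>x. 0 \<le> r x"
    and ft: "integrable lborel (ftrans (\<lambda>x. of_real (r x)))"
  shows "AE x in lborel. complex_of_real (r x) = ftrans (ftrans (\<lambda>x. of_real (r x))) (- x) / (2 * pi)"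
proof -
  have [measurable]: "r \<in> borel_measurable borel" using r by auto
  let ?k = "ftrans (\<lambda>x. of_real (r x))"
  define m where "m = (\<integral>x. r x \<partial>lborel)"
  have m0: "m \<ge> 0" unfolding m_def using r by (intro Bochner_Integration.integral_nonneg) auto
  show ?thesis
  proof (cases "m = 0")
    case True
    then have z: "AE x in lborel. r x = 0"
      using integral_nonneg_eq_0_iff_AE[OF r(1)] r(2) by (simp add: m_def)
    have "?k \<xi> = 0" for \<xi>
    proof -
      have "?k \<xi> = (\<integral>y. 0 \<partial>(lborel :: real measure))"
        unfolding ftrans_def by (rule integral_cong_AE) (use z in auto)
      then show ?thesis by simp
    qed
    then have "ftrans ?k x = 0" for x by (simp add: ftrans_def[of ?k])
    with z show ?thesis by simp
  next
    case False
    with m0 have m: "m > 0" by simp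
    define M where "M = density lborel (\<lambda>x. ennreal (r x / m))"
    have "(\<integral>\<^sup>+x. ennreal (r x / m) \<partial>lborel) = ennreal (\<integral>x. r x / m \<partial>lborel)"
      using r m by (intro nn_integral_eq_integral) auto
    also have "\<dots> = 1" using m by (simp add: m_def)
    finally have e0: "(\<integral>\<^sup>+x. ennreal (r x / m) \<partial>lborel) = 1" .
    have "emeasure M (space M) = (\<integral>\<^sup>+x. ennreal (r x / m) * indicator UNIV x \<partial>lborel)"
      unfolding M_def by (subst emeasure_density) simp_all
    also have "\<dots> = (\<integral>\<^sup>+x. ennreal (r x / m) \<partial>lborel)" by simp
    finally have e1: "emeasure M (space M) = 1" unfolding e0 .
    have sM: "sets M = sets borel" unfolding M_def by simp
    interpret M: real_distribution M
      unfolding real_distribution_def real_distribution_axioms_def by (intro conjI prob_spaceI e1 sM)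
    have char: "char M t = ?k t / m" for t
    proof -
      have "char M t = (\<integral>x. (r x / m) *\<^sub>R iexp (t * x) \<partial>lborel)"
        unfolding char_def M_def using r m by (subst integral_density) auto
      also have "\<dots> = (\<integral>x. (of_real (r x) * iexp (t * x)) / m \<partial>lborel)"
        by (intro Bochner_Integration.integral_cong) (auto simp: scaleR_conv_of_real)
      finally show ?thesis by (simp add: ftrans_def)
    qed
    have ci: "integrable lborel (char M)" using ft unfolding char[abs_def] by simp
    \<comment> \<open>Levy's formula is stated for endpoints without mass.\<close>
    have atom: "measure M {a} = 0" for a
    proof -
      have "emeasure M {a} = (\<integral>\<^sup>+x. ennreal (r x / m) * indicator {a} x \<partial>lborel)"
        unfolding M_def by (subst emeasure_density) auto
      also have "\<dots> = 0"
        by (subst nn_integral_0_iff_AE) (auto intro!: AE_I'[of "{a}"] split: split_indicator_asm)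
      finally show ?thesis by (simp add: measure_def)
    qed
    have mM: "measure M {a<..b} = (\<integral>x. indicator {a<..b} x * r x \<partial>lborel) / m" for a b
    proof -
      have "emeasure M {a<..b} = (\<integral>\<^sup>+x. ennreal (indicator {a<..b} x * r x / m) \<partial>lborel)"
        unfolding M_def by (subst emeasure_density) (auto intro!: nn_integral_cong split: split_indicator)
      also have "\<dots> = ennreal (\<integral>x. indicator {a<..b} x * r x / m \<partial>lborel)"
        using r m integrable_real_mult_indicator[OF _ r(1), of "{a<..b}"]
        by (intro nn_integral_eq_integral) (auto simp: mult.commute)
      finally show ?thesis using r m by (simp add: measure_def)
    qed
    define G where "G x = ftrans ?k (- x) / (2 * pi)" for x
    have [measurable]: "G \<in> borel_measurable borel" unfolding G_def by measurable
    have ri: "integrable lborel (\<lambda>x. indicator {a<..b} x *\<^sub>R complex_of_real (r x))" for a b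
      using r(1) by (intro integrable_mult_indicator) auto
    have "norm (ftrans ?k x) \<le> (\<integral>y. norm (?k y) \<partial>lborel)" for x
      using norm_ftrans_le[OF ft] .
    then have "norm (G x) \<le> (\<integral>y. norm (?k y) \<partial>lborel) / (2 * pi)" for x
      by (simp add: G_def norm_divide divide_right_mono)
    moreover have "emeasure lborel {a<..b} < \<infinity>" for a b :: real by (cases "a \<le> b") auto
    ultimately have Gi: "integrable lborel (\<lambda>x. indicator {a<..b} x *\<^sub>R G x)" for a b
      by (intro integrableI_bounded_set_indicator[where B = "(\<integral>y. norm (?k y) \<partial>lborel) / (2 * pi)"]) auto
    have eq: "(\<integral>x. indicator {a<..b} x *\<^sub>R complex_of_real (r x) \<partial>lborel) = (\<integral>x. indicator {a<..b} x *\<^sub>R G x \<partial>lborel)"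
      if ab: "a < b" for a b
    proof -
      let ?F = "\<lambda>t. (iexp (- (t * a)) - iexp (- (t * b))) / (\<i> * complex_of_real t)"
      have Fb: "norm (?F t) \<le> b - a" if "t \<noteq> 0" for t
        using Levy_Inversion_aux2[of "- b" "- a" t] ab that by simp
      have gi: "integrable lborel (\<lambda>t. ?F t * char M t)"
      proof (rule Bochner_Integration.integrable_bound)
        show "integrable lborel (\<lambda>t. (b - a) *\<^sub>R char M t)" using ci by simp
        have "AE t in lborel. t \<noteq> (0::real)" by (rule AE_lborel_singleton)
        then show "AE t in lborel. norm (?F t * char M t) \<le> norm ((b - a) *\<^sub>R char M t)"
        proof eventually_elim
          case (elim t)
          show ?case
            using mult_right_mono[OF Fb[OF elim] norm_ge_zero[of "char M t"]] ab
            unfolding norm_mult norm_scaleR by simp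
        qed
      qed measurable
      \<comment> \<open>Levy's formula gives a symmetric limit over (-T, T). The factor
        \<open>?F\<close> is bounded by b - a, so the full integrand is integrable and the limit is
        its integral over the line.\<close>
      have "(\<lambda>T. \<integral>t. indicator {- real T<..<real T} t *\<^sub>R (?F t * char M t) \<partial>lborel) \<longlonglongrightarrow> (\<integral>t. ?F t * char M t \<partial>lborel)"
      proof (rule integral_dominated_convergence[where w = "\<lambda>t. norm (?F t * char M t)"])
        show "integrable lborel (\<lambda>t. norm (?F t * char M t))" using gi by (rule integrable_norm)
        show "AE t in lborel. (\<lambda>T. indicator {- real T<..<real T} t *\<^sub>R (?F t * char M t)) \<longlonglongrightarrow> ?F t * char M t"
        proof (rule AE_I2)
          fix t :: real
          obtain n where n: "\<bar>t\<bar> < real n" using reals_Archimedean2 by blast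
          have "\<forall>\<^sub>F T in sequentially. indicator {- real T<..<real T} t *\<^sub>R (?F t * char M t) = ?F t * char M t"
            using eventually_ge_at_top[of n] by eventually_elim (use n in \<open>auto split: split_indicator\<close>)
          then show "(\<lambda>T. indicator {- real T<..<real T} t *\<^sub>R (?F t * char M t)) \<longlonglongrightarrow> ?F t * char M t"
            by (rule tendsto_eventually)
        qed
        show "AE t in lborel. norm (indicator {- real T<..<real T} t *\<^sub>R (?F t * char M t)) \<le> norm (?F t * char M t)" for T
          by (rule AE_I2) (simp split: split_indicator)
      qed measurable
      then have "(\<lambda>T. 1 / (2 * pi) * (\<integral>t. indicator {- real T<..<real T} t *\<^sub>R (?F t * char M t) \<partial>lborel)) \<longlonglongrightarrow> 1 / (2 * pi) * (\<integral>t. ?F t * char M t \<partial>lborel)"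
        by (rule tendsto_mult_left)
      moreover have "(\<lambda>T. 1 / (2 * pi) * (\<integral>t. indicator {- real T<..<real T} t *\<^sub>R (?F t * char M t) \<partial>lborel)) \<longlonglongrightarrow> measure M {a<..b}"
        using M.Levy_Inversion[of a b] ab atom by (simp add: interval_lebesgue_integral_def set_lebesgue_integral_def)
      ultimately have lim: "complex_of_real (measure M {a<..b}) = 1 / (2 * pi) * (\<integral>t. ?F t * char M t \<partial>lborel)"
        by (intro LIMSEQ_unique)
      \<comment> \<open>The factor \<open>?F t\<close> is the integral of exp(-its) over [a, b];
        writing it so produces a double integral whose other iterated form contains
        \<open>G\<close>.\<close>
      let ?H = "\<lambda>t s. indicator {a..b} s *\<^sub>R (char M t * iexp (- (t * s)))"
      have HI: "integrable (lborel \<Otimes>\<^sub>M lborel) (case_prod ?H)"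
      proof (rule lborel_pair.Fubini_integrable)
        have "(\<integral>s. norm (?H t s) \<partial>lborel) = (b - a) * norm (char M t)" for t
        proof -
          have "(\<integral>s. norm (?H t s) \<partial>lborel) = (\<integral>s. norm (char M t) * indicator {a..b} s \<partial>lborel)"
            by (intro Bochner_Integration.integral_cong) (auto simp: norm_mult split: split_indicator)
          then show ?thesis using ab by simp
        qed
        then show "integrable lborel (\<lambda>t. \<integral>s. norm (case (t, s) of (t, s) \<Rightarrow> ?H t s) \<partial>lborel)"
          using ci by simp
        show "AE t in lborel. integrable lborel (\<lambda>s. case (t, s) of (t, s) \<Rightarrow> ?H t s)"
          by (intro AE_I2) (auto simp: norm_mult emeasure_lborel_Icc_eq intro!: integrableI_bounded_set_indicator[where B = "norm (char M _)"])
      qed measurable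
      have "(\<integral>t. ?F t * char M t \<partial>lborel) = (\<integral>t. (\<integral>s. ?H t s \<partial>lborel) \<partial>lborel)"
      proof (rule integral_cong_AE)
        have "AE t in lborel. t \<noteq> (0::real)" by (rule AE_lborel_singleton)
        then show "AE t in lborel. ?F t * char M t = (\<integral>s. ?H t s \<partial>lborel)"
        proof eventually_elim
          case (elim t)
          have "(\<integral>s. ?H t s \<partial>lborel) = char M t * (\<integral>s. indicator {a..b} s *\<^sub>R iexp (- (t * s)) \<partial>lborel)"
            by (simp only: mult_scaleR_right[symmetric] integral_mult_right_zero)
          then show ?case using iexp_interval_integral[of a b t] ab elim by simp
        qed
      qed measurable
      also have "\<dots> = (\<integral>s. (\<integral>t. ?H t s \<partial>lborel) \<partial>lborel)"
        by (rule lborel_pair.Fubini_integral[OF HI, symmetric])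
      also have "\<dots> = (\<integral>s. indicator {a..b} s *\<^sub>R (2 * pi * G s / m) \<partial>lborel)"
      proof (intro Bochner_Integration.integral_cong refl)
        fix s
        have "(\<integral>t. ?H t s \<partial>lborel) = indicator {a..b} s *\<^sub>R (\<integral>t. char M t * iexp (- (t * s)) \<partial>lborel)" by simp
        also have "(\<integral>t. char M t * iexp (- (t * s)) \<partial>lborel) = (\<integral>t. ?k t * iexp (- s * t) / m \<partial>lborel)"
          by (intro Bochner_Integration.integral_cong) (auto simp: char mult.commute)
        also have "\<dots> = 2 * pi * G s / m" by (simp add: G_def ftrans_def[of ?k])
        finally show "(\<integral>t. ?H t s \<partial>lborel) = indicator {a..b} s *\<^sub>R (2 * pi * G s / m)" .
      qed
      also have "\<dots> = (\<integral>s. 2 * pi / m * (indicator {a<..b} s *\<^sub>R G s) \<partial>lborel)"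
      proof (rule integral_cong_AE)
        have "AE s in lborel. s \<noteq> a" by (rule AE_lborel_singleton)
        then show "AE s in lborel. indicator {a..b} s *\<^sub>R (2 * pi * G s / m) = 2 * pi / m * (indicator {a<..b} s *\<^sub>R G s)"
          by eventually_elim (auto split: split_indicator)
      qed measurable
      also have "\<dots> = 2 * pi / m * (\<integral>s. indicator {a<..b} s *\<^sub>R G s \<partial>lborel)"
        by (rule integral_mult_right_zero)
      finally have "complex_of_real (measure M {a<..b}) = (\<integral>s. indicator {a<..b} s *\<^sub>R G s \<partial>lborel) / m"
        using lim by simp
      moreover have "(\<integral>x. indicator {a<..b} x *\<^sub>R complex_of_real (r x) \<partial>lborel) = complex_of_real (\<integral>x. indicator {a<..b} x * r x \<partial>lborel)"
        unfolding integral_complex_of_real[symmetric]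
        by (intro Bochner_Integration.integral_cong) (auto simp: scaleR_conv_of_real)
      ultimately show ?thesis using mM[of a b] m by simp
    qed
    have "AE x in lborel. complex_of_real (r x) - G x = 0"
    proof (rule AE_zero_if_interval_integrals_zero)
      show "integrable lborel (\<lambda>y. indicator {a<..b} y *\<^sub>R (complex_of_real (r y) - G y))" for a b
        using Bochner_Integration.integrable_diff[OF ri Gi, of a b a b] by (simp add: scaleR_diff_right)
      show "(\<integral>y. indicator {a<..b} y *\<^sub>R (complex_of_real (r y) - G y) \<partial>lborel) = 0" if "a < b" for a b
        using eq[OF that] Bochner_Integration.integral_diff[OF ri Gi, of a b a b] by (simp add: scaleR_diff_right)
    qed
    then show ?thesis by (simp add: G_def)
  qed
qed

section \<open>Inversion in the convolution algebra\<close>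

text \<open>Two integrations by parts give that \<xi>^2 times the transform of \<open>h\<close> is
  minus the transform of the second derivative. Both transforms are bounded, so the transform of
  \<open>h\<close> is O(1/(1 + \<xi>^2)).\<close>

lemma integrable_ftrans_of_decaying:
  assumes d: "\<And>x. (h has_vector_derivative h' x) (at x)" "\<And>x. (h' has_vector_derivative h'' x) (at x)"
    and c: "\<And>x. isCont h'' x"
    and b: "\<And>x. norm (h x) \<le> C / (1 + x\<^sup>2)" "\<And>x. norm (h' x) \<le> C / (1 + x\<^sup>2)" "\<And>x. norm (h'' x) \<le> C / (1 + x\<^sup>2)"
  shows "integrable lborel h" "integrable lborel (ftrans h)"
proof -
  have ch: "isCont h x" "isCont h' x" for x
    using d by (auto intro: has_vector_derivative_continuous)
  have m: "f \<in> borel_measurable borel" if "\<And>x. isCont f x" for f :: "real \<Rightarrow> complex"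
    using that by (intro borel_measurable_continuous_onI continuous_at_imp_continuous_on) auto
  have i: "integrable lborel h" "integrable lborel h'" "integrable lborel h''"
    using m[OF ch(1)] m[OF ch(2)] m[OF c] b by (auto intro: integrable_decay)
  show "integrable lborel h" by fact
  have "ftrans h' \<xi> = - \<i> * of_real \<xi> * ftrans h \<xi>" for \<xi>
    by (rule ftrans_derivative[OF i(1,2) d(1) ch(2) decay_tendsto_0[OF b(1)]])
  moreover have "ftrans h'' \<xi> = - \<i> * of_real \<xi> * ftrans h' \<xi>" for \<xi>
    by (rule ftrans_derivative[OF i(2,3) d(2) c decay_tendsto_0[OF b(2)]])
  moreover have "\<i> * a * (\<i> * a * b) = (\<i> * \<i>) * (a * a * b)" for a b :: complex by (simp only: mult_ac)
  ultimately have e: "ftrans h'' \<xi> = - (of_real \<xi>)\<^sup>2 * ftrans h \<xi>" for \<xi>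
    by (simp add: power2_eq_square)
  define A where "A = (\<integral>y. norm (h y) \<partial>lborel) + (\<integral>y. norm (h'' y) \<partial>lborel)"
  show "integrable lborel (ftrans h)"
  proof (rule integrable_decay)
    show "norm (ftrans h \<xi>) \<le> A / (1 + \<xi>\<^sup>2)" for \<xi>
    proof -
      have "norm (ftrans h \<xi>) * (1 + \<xi>\<^sup>2) = norm (ftrans h \<xi>) + norm (ftrans h'' \<xi>)"
        unfolding e by (simp add: norm_mult norm_power algebra_simps)
      also have "\<dots> \<le> A" unfolding A_def by (intro add_mono norm_ftrans_le i)
      finally show ?thesis by (simp add: pos_le_divide_eq add_pos_nonneg)
    qed
    show "ftrans h \<in> borel_measurable borel" using m[OF ch(1)] by measurable
  qed
qed

lemma has_vector_derivative_power_complex: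
  fixes k :: "real \<Rightarrow> complex"
  assumes "(k has_vector_derivative k') (at x)"
  shows "((\<lambda>x. k x ^ n) has_vector_derivative k' * (of_nat n * k x ^ (n - 1))) (at x)"
proof -
  have "((\<lambda>w. w ^ n) has_field_derivative of_nat n * k x ^ (n - 1)) (at (k x))"
    by (auto intro!: derivative_eq_intros)
  from field_vector_diff_chain_at[OF assms this] show ?thesis by (simp add: comp_def)
qed

lemma has_vector_derivative_resolvent_complex:
  fixes k :: "real \<Rightarrow> complex"
  assumes "(k has_vector_derivative k') (at x)" "k x \<noteq> z"
  shows "((\<lambda>x. inverse (z - k x)) has_vector_derivative k' * (inverse (z - k x))\<^sup>2) (at x)"
proof -
  have "((\<lambda>w. inverse (z - w)) has_field_derivative (inverse (z - k x))\<^sup>2) (at (k x))"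
    using assms(2) by (auto intro!: derivative_eq_intros simp: power2_eq_square)
  from field_vector_diff_chain_at[OF assms(1) this] show ?thesis by (simp add: comp_def)
qed

lemma decaying_product:
  fixes g b :: "real \<Rightarrow> complex"
  assumes "\<And>x. norm (g x) \<le> C / (1 + x\<^sup>2)" "bounded (range b)"
  shows "\<exists>D. \<forall>x. norm (g x * b x) \<le> D / (1 + x\<^sup>2)"
proof -
  obtain B where B: "\<And>x. norm (b x) \<le> B" using assms(2) by (auto simp: bounded_iff)
  have "norm (g x * b x) \<le> C * B / (1 + x\<^sup>2)" for x
    using mult_mono[OF assms(1)[of x] B[of x]] order_trans[OF norm_ge_zero assms(1)[of x]] by (simp add: norm_mult)
  then show ?thesis by blast
qed

lemma bounded_range_mult:
  fixes f g :: "'a \<Rightarrow> complex"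
  assumes "bounded (range f)" "bounded (range g)"
  shows "bounded (range (\<lambda>x. f x * g x))"
proof -
  obtain A B where "\<And>x. norm (f x) \<le> A" "\<And>x. norm (g x) \<le> B" using assms by (auto simp: bounded_iff)
  then have "norm (f x * g x) \<le> A * B" for x
    using mult_mono[of "norm (f x)" A "norm (g x)" B] order_trans[OF norm_ge_zero, of "f x" A] by (simp add: norm_mult)
  then show ?thesis by (auto simp: bounded_iff)
qed

lemma bounded_range_add:
  fixes f g :: "'a \<Rightarrow> complex"
  assumes "bounded (range f)" "bounded (range g)"
  shows "bounded (range (\<lambda>x. f x + g x))"
  using bounded_plus_comp[OF assms] .

lemma bounded_range_const: "bounded (range (\<lambda>x. c))"
  by (cases "range (\<lambda>x. c) = {}") (auto simp: image_constant_conv)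

lemma conv_lincomb:
  assumes f: "integrable lborel f" and g: "integrable lborel g" and h: "integrable lborel h"
  shows "AE x in lborel. conv f (\<lambda>y. a * g y + b * h y) x = a * conv f g x + b * conv f h x"
  using conv_integrable(2)[OF f g] conv_integrable(2)[OF f h]
proof eventually_elim
  case (elim x)
  have "conv f (\<lambda>y. a * g y + b * h y) x = (\<integral>y. a * (f y * g (x - y)) + b * (f y * h (x - y)) \<partial>lborel)"
    unfolding conv_def by (simp add: algebra_simps)
  also have "\<dots> = a * conv f g x + b * conv f h x" using elim unfolding conv_def by simp
  finally show ?case .
qed

lemma conv_ftrans:
  assumes k: "integrable lborel k" and h: "integrable lborel h"
  shows "conv k (\<lambda>x. ftrans h (- x)) x = ftrans (\<lambda>\<xi>. h \<xi> * ftrans k \<xi>) (- x)"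
proof -
  have [measurable]: "k \<in> borel_measurable borel" "h \<in> borel_measurable borel" using k h by auto
  let ?H = "\<lambda>y \<xi>. k y * (h \<xi> * iexp (- (x - y) * \<xi>))"
  have I: "integrable (lborel \<Otimes>\<^sub>M lborel) (case_prod ?H)"
  proof (rule lborel_pair.Fubini_integrable)
    have "(\<integral>\<xi>. norm (?H y \<xi>) \<partial>lborel) = norm (k y) * (\<integral>\<xi>. norm (h \<xi>) \<partial>lborel)" for y
      by (simp add: norm_mult)
    then show "integrable lborel (\<lambda>y. \<integral>\<xi>. norm (case (y, \<xi>) of (y, \<xi>) \<Rightarrow> ?H y \<xi>) \<partial>lborel)"
      using k by simp
    show "AE y in lborel. integrable lborel (\<lambda>\<xi>. case (y, \<xi>) of (y, \<xi>) \<Rightarrow> ?H y \<xi>)"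
      unfolding prod.case by (intro AE_I2 integrable_mult_right integrable_mult_iexp[OF h]) auto
  qed measurable
  have "conv k (\<lambda>x. ftrans h (- x)) x = (\<integral>y. (\<integral>\<xi>. ?H y \<xi> \<partial>lborel) \<partial>lborel)"
    unfolding conv_def ftrans_def by simp
  also have "\<dots> = (\<integral>\<xi>. (\<integral>y. ?H y \<xi> \<partial>lborel) \<partial>lborel)"
    by (rule lborel_pair.Fubini_integral[OF I, symmetric])
  also have "\<dots> = (\<integral>\<xi>. (h \<xi> * iexp (- x * \<xi>)) * (\<integral>y. k y * iexp (\<xi> * y) \<partial>lborel) \<partial>lborel)"
    unfolding integral_mult_right_zero[symmetric]
    by (intro Bochner_Integration.integral_cong refl) (simp add: algebra_simps flip: exp_add)
  also have "\<dots> = ftrans (\<lambda>\<xi>. h \<xi> * ftrans k \<xi>) (- x)"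
    unfolding ftrans_def by (intro Bochner_Integration.integral_cong refl) (simp add: mult_ac)
  finally show ?thesis .
qed

text \<open>If \<open>K\<close> solves \<open>zK - k * K = k\<^sup>*\<^sup>(\<^sup>j\<^sup>+\<^sup>1\<^sup>)\<close>, then \<open>(k\<^sup>*\<^sup>j + K)/z\<close> solves the equation for \<open>k\<^sup>*\<^sup>j\<close>, so one can start
  from a convolution power with integrable transform and descend.\<close>

theorem resolvent_kernel_exists:
  fixes k :: "real \<Rightarrow> real" and z :: complex
  assumes k: "integrable lborel k" "\<And>y. 0 \<le> k y"
    and k2: "integrable lborel (\<lambda>y. y\<^sup>2 * k y)"
    and dec: "\<And>\<xi>. norm (ftrans (\<lambda>y. of_real (k y)) \<xi>) ^ M \<le> C / (1 + \<xi>\<^sup>2)"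
    and z: "z \<noteq> 0" and dl: "0 < \<delta>" "\<And>\<xi>. \<delta> \<le> norm (z - ftrans (\<lambda>y. of_real (k y)) \<xi>)"
  obtains r where "integrable lborel r"
    "AE x in lborel. z * r x = of_real (k x) / z + conv (\<lambda>y. of_real (k y)) r x"
proof -
  have [measurable]: "k \<in> borel_measurable borel" using k by auto
  define kc where "kc y = complex_of_real (k y)" for y
  define q where "q = ftrans kc"
  define q1 where "q1 = ftrans (\<lambda>y. \<i> * (of_real y * kc y))"
  define q2 where "q2 = ftrans (\<lambda>y. \<i> * (of_real y * (\<i> * (of_real y * kc y))))"
  have ikc: "integrable lborel kc" using k by (simp add: kc_def[abs_def])
  have [measurable]: "kc \<in> borel_measurable borel" using ikc by auto
  have ik1: "integrable lborel (\<lambda>y. y * k y)"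
  proof (rule Bochner_Integration.integrable_bound)
    show "integrable lborel (\<lambda>y. k y + y\<^sup>2 * k y)" using k(1) k2 by simp
    show "AE y in lborel. norm (y * k y) \<le> norm (k y + y\<^sup>2 * k y)"
    proof (rule AE_I2)
      fix y :: real
      have "\<bar>y\<bar> \<le> 1 + y\<^sup>2"
        using zero_le_power2[of "\<bar>y\<bar> - 1"] by (simp add: power2_diff)
      then have "\<bar>y\<bar> * k y \<le> (1 + y\<^sup>2) * k y" using k(2) by (intro mult_right_mono)
      then show "norm (y * k y) \<le> norm (k y + y\<^sup>2 * k y)" using k(2)[of y] by (simp add: abs_mult algebra_simps)
    qed
  qed auto
  have ikc1: "integrable lborel (\<lambda>y. of_real y * kc y)"
    using ik1 unfolding kc_def of_real_mult[symmetric] by (simp del: of_real_mult)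
  have "integrable lborel (\<lambda>y. complex_of_real (y\<^sup>2 * k y))" using k2 by (simp del: of_real_mult)
  then have "integrable lborel (\<lambda>y. \<i> * complex_of_real (y\<^sup>2 * k y))" by (rule integrable_mult_right)
  then have ikc2: "integrable lborel (\<lambda>y. of_real y * (\<i> * (of_real y * kc y)))"
    by (rule back_subst[of "integrable lborel"]) (simp add: fun_eq_iff kc_def power2_eq_square)
  have ikc1': "integrable lborel (\<lambda>y. \<i> * (of_real y * kc y))" using ikc1 by (rule integrable_mult_right)
  have ikc2': "integrable lborel (\<lambda>y. \<i> * (of_real y * (\<i> * (of_real y * kc y))))" using ikc2 by (rule integrable_mult_right)
  have d1: "(q has_vector_derivative q1 x) (at x)" for x
    unfolding q_def q1_def by (rule has_vector_derivative_ftrans[OF ikc ikc1])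
  have d2: "(q1 has_vector_derivative q2 x) (at x)" for x
    unfolding q1_def q2_def by (rule has_vector_derivative_ftrans[OF ikc1' ikc2])
  have cq: "isCont q x" "isCont q1 x" for x using d1 d2 by (auto intro: has_vector_derivative_continuous)
  have cq2: "isCont q2 x" for x
  proof (unfold continuous_at_sequentially, intro allI impI)
    fix X assume X: "X \<longlonglongrightarrow> x"
    let ?g = "\<lambda>y. \<i> * (of_real y * (\<i> * (of_real y * kc y)))"
    have "(\<lambda>n. \<integral>y. ?g y * iexp (X n * y) \<partial>lborel) \<longlonglongrightarrow> (\<integral>y. ?g y * iexp (x * y) \<partial>lborel)"
    proof (rule integral_dominated_convergence[where w = "\<lambda>y. norm (?g y)"])
      show "integrable lborel (\<lambda>y. norm (?g y))" using ikc2' by (rule integrable_norm)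
      show "AE y in lborel. (\<lambda>n. ?g y * iexp (X n * y)) \<longlonglongrightarrow> ?g y * iexp (x * y)"
        by (intro AE_I2 tendsto_intros X)
      show "AE y in lborel. norm (?g y * iexp (X n * y)) \<le> norm (?g y)" for n by (simp add: norm_mult)
    qed measurable
    then show "(q2 \<circ> X) \<longlonglongrightarrow> q2 x" unfolding q2_def ftrans_def by (simp add: comp_def)
  qed
  have bq: "bounded (range q)" "bounded (range q1)" "bounded (range q2)"
    using norm_ftrans_le[OF ikc] norm_ftrans_le[OF ikc1'] norm_ftrans_le[OF ikc2']
    unfolding q_def q1_def q2_def by (auto simp: bounded_iff)
  have ne: "q x \<noteq> z" for x using dl(1) dl(2)[of x] by (auto simp: q_def kc_def[abs_def])
  define u where "u x = inverse (z - q x)" for x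
  have bu: "bounded (range u)"
  proof -
    have "norm (u x) \<le> inverse \<delta>" for x
      using dl(1) dl(2)[of x] by (simp add: u_def norm_inverse q_def kc_def[abs_def] le_imp_inverse_le)
    then show ?thesis by (auto simp: bounded_iff)
  qed
  have du: "(u has_vector_derivative q1 x * (u x)\<^sup>2) (at x)" for x
    unfolding u_def by (rule has_vector_derivative_resolvent_complex[OF d1 ne])
  have cu: "isCont u x" for x using du by (rule has_vector_derivative_continuous)
  \<comment> \<open>This is the transform-side remainder q^(M+2)/(z - q). Each of two derivatives
    can lower the power of \<open>q\<close> by one, so the exponent M + 2 leaves a factor q^M, the
    power that decays quadratically.\<close>
  define h where "h x = q x ^ (M + 2) * u x" for x
  define h1 where "h1 x = q x ^ (M + 2) * (q1 x * (u x)\<^sup>2) + q1 x * (of_nat (M + 2) * q x ^ (M + 1)) * u x" for x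
  \<comment> \<open>Written in exactly the shape that the sum and product rules produce, so that
    they verify the derivative without rearrangement.\<close>
  define h2 where "h2 x =
      (q x ^ (M + 2) * (q1 x * (u x * (q1 x * (u x)\<^sup>2) + (q1 x * (u x)\<^sup>2) * u x) + q2 x * (u x * u x))
        + (q1 x * (of_nat (M + 2) * q x ^ (M + 1))) * (q1 x * (u x * u x)))
      + ((q1 x * (of_nat (M + 2) * q x ^ (M + 1))) * (q1 x * (u x)\<^sup>2)
        + (q1 x * (of_nat (M + 2) * (q1 x * (of_nat (M + 1) * q x ^ M))) + q2 x * (of_nat (M + 2) * q x ^ (M + 1))) * u x)" for x
  have pw: "((\<lambda>x. q x ^ (M + 2)) has_vector_derivative q1 x * (of_nat (M + 2) * q x ^ (M + 1))) (at x)"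
    "((\<lambda>x. q x ^ (M + 1)) has_vector_derivative q1 x * (of_nat (M + 1) * q x ^ M)) (at x)" for x
    using has_vector_derivative_power_complex[OF d1, of "M + 2" x] has_vector_derivative_power_complex[OF d1, of "M + 1" x] by simp_all
  have dh: "(h has_vector_derivative h1 x) (at x)" for x
    unfolding h_def h1_def by (rule has_vector_derivative_mult[OF pw(1) du])
  have dh1: "(h1 has_vector_derivative h2 x) (at x)" for x
    unfolding h1_def h2_def power2_eq_square[of "u _"]
    by (intro has_vector_derivative_add has_vector_derivative_mult has_vector_derivative_mult_right pw d2 du[unfolded power2_eq_square] d1)
  have ch2: "isCont h2 x" for x
    unfolding h2_def by (intro continuous_intros cq cq2 cu)
  have qM: "norm (q x ^ M) \<le> C / (1 + x\<^sup>2)" for x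
    using dec[of x] by (simp add: norm_power q_def kc_def[abs_def])
  \<comment> \<open>Pulling out q^M leaves sums of products of the bounded functions
    \<open>q\<close>, \<open>q1\<close>, \<open>q2\<close>, \<open>u\<close> and constants, so all
    three functions inherit the quadratic decay.\<close>
  have hM: "h x = q x ^ M * (q x * q x * u x)" for x by (simp add: h_def power_add power2_eq_square)
  have h1M: "h1 x = q x ^ M * (q x * q x * (q1 x * (u x * u x)) + q1 x * (of_nat (M + 2) * q x) * u x)" for x
    by (simp add: h1_def power_add power2_eq_square algebra_simps)
  have h2M: "h2 x = q x ^ M * (((q x * q x) * (q1 x * (u x * (q1 x * (u x * u x)) + (q1 x * (u x * u x)) * u x) + q2 x * (u x * u x))
        + (q1 x * (of_nat (M + 2) * q x)) * (q1 x * (u x * u x)))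
      + ((q1 x * (of_nat (M + 2) * q x)) * (q1 x * (u x * u x))
        + (q1 x * (of_nat (M + 2) * (q1 x * of_nat (M + 1))) + q2 x * (of_nat (M + 2) * q x)) * u x))" for x
    by (simp only: h2_def power_add power2_eq_square power_one_right) (simp add: algebra_simps)
  note bb = bounded_range_mult bounded_range_add bounded_range_const bq bu
  obtain C0 where C0: "\<And>x. norm (h x) \<le> C0 / (1 + x\<^sup>2)"
    unfolding hM using decaying_product[OF qM] by (metis bb(1,4-))
  obtain C1 where C1: "\<And>x. norm (h1 x) \<le> C1 / (1 + x\<^sup>2)"
  proof -
    have "bounded (range (\<lambda>x. q x * q x * (q1 x * (u x * u x)) + q1 x * (of_nat (M + 2) * q x) * u x))"
      by (intro bb)
    from decaying_product[OF qM this] show thesis unfolding h1M[symmetric] using that by blast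
  qed
  obtain C2 where C2: "\<And>x. norm (h2 x) \<le> C2 / (1 + x\<^sup>2)"
  proof -
    have "bounded (range (\<lambda>x. ((q x * q x) * (q1 x * (u x * (q1 x * (u x * u x)) + (q1 x * (u x * u x)) * u x) + q2 x * (u x * u x))
        + (q1 x * (of_nat (M + 2) * q x)) * (q1 x * (u x * u x)))
      + ((q1 x * (of_nat (M + 2) * q x)) * (q1 x * (u x * u x))
        + (q1 x * (of_nat (M + 2) * (q1 x * of_nat (M + 1))) + q2 x * (of_nat (M + 2) * q x)) * u x)))"
      by (intro bb)
    from decaying_product[OF qM this] show thesis unfolding h2M[symmetric] using that by blast
  qed
  define D where "D = max C0 (max C1 C2)"
  have le: "C0 / (1 + x\<^sup>2) \<le> D / (1 + x\<^sup>2)" "C1 / (1 + x\<^sup>2) \<le> D / (1 + x\<^sup>2)" "C2 / (1 + x\<^sup>2) \<le> D / (1 + x\<^sup>2)" for x :: real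
    by (auto intro!: divide_right_mono simp: D_def)
  have ih: "integrable lborel h" and ifh: "integrable lborel (ftrans h)"
    using integrable_ftrans_of_decaying[OF dh dh1 ch2 order_trans[OF C0 le(1)] order_trans[OF C1 le(2)] order_trans[OF C2 le(3)]]
    by auto
  define K where "K x = ftrans h (- x) / (2 * pi)" for x
  have iK: "integrable lborel K"
    using ifh integrable_reflect_iff[of "ftrans h" 0] unfolding K_def by simp
  have [measurable]: "h \<in> borel_measurable borel" using ih by auto
  have [measurable]: "q \<in> borel_measurable borel" unfolding q_def by measurable

  \<comment> \<open>Convolution powers are built as real functions so that their nonnegativity is
    visible, as inversion requires. The indexing starts at \<open>k\<close> itself:
    \<open>p j\<close> has transform q^(j+1).\<close>
  define p where "p = rec_nat k (\<lambda>_ f x. \<integral>y. k y * f (x - y) \<partial>lborel)"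
  have p0: "p 0 = k" and pS: "p (Suc j) = (\<lambda>x. \<integral>y. k y * p j (x - y) \<partial>lborel)" for j
    by (simp_all add: p_def)
  define pc where "pc j x = complex_of_real (p j x)" for j x
  have pcS: "pc (Suc j) = conv kc (pc j)" for j
    unfolding pc_def pS conv_def kc_def of_real_mult[symmetric] integral_complex_of_real ..
  have pp: "integrable lborel (p j) \<and> (\<forall>x. 0 \<le> p j x) \<and> (\<forall>\<xi>. ftrans (pc j) \<xi> = q \<xi> ^ (j + 1))" for j
  proof (induction j)
    case 0
    then show ?case using k by (simp add: p0 pc_def[abs_def] q_def kc_def[abs_def])
  next
    case (Suc j)
    then have i: "integrable lborel (pc j)" by (simp add: pc_def[abs_def])
    have "integrable lborel (pc (Suc j))" unfolding pcS by (rule conv_integrable(1)[OF ikc i])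
    then have "integrable lborel (p (Suc j))" by (simp only: pc_def[abs_def] complex_of_real_integrable_eq)
    moreover have "0 \<le> p (Suc j) x" for x
      unfolding pS using k Suc by (intro Bochner_Integration.integral_nonneg) auto
    moreover have "ftrans (pc (Suc j)) \<xi> = q \<xi> ^ (Suc j + 1)" for \<xi>
      unfolding pcS using ftrans_conv[OF ikc i] Suc by (simp add: q_def)
    ultimately show ?case by blast
  qed
  have ipc: "integrable lborel (pc j)" for j using pp[of j] by (simp add: pc_def[abs_def])

  have base: "AE x in lborel. z * K x - conv kc K x = pc (M + 1) x"
  proof -
    let ?N = "\<lambda>\<xi>. q \<xi> ^ (M + 2)"
    have hq: "integrable lborel (\<lambda>\<xi>. h \<xi> * q \<xi>)"
    proof -
      obtain B where B: "\<And>x. norm (q x) \<le> B" using bq(1) by (auto simp: bounded_iff)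
      show ?thesis
        by (rule Bochner_Integration.integrable_bound[OF integrable_mult_left[OF ih, of "of_real B"]])
           (auto simp: norm_mult intro!: mult_left_mono order_trans[OF B] abs_ge_self)
    qed
    have e: "z * h \<xi> - h \<xi> * q \<xi> = ?N \<xi>" for \<xi>
    proof -
      have "z * h \<xi> - h \<xi> * q \<xi> = ?N \<xi> * (u \<xi> * (z - q \<xi>))" by (simp add: h_def algebra_simps)
      then show ?thesis using ne[of \<xi>] by (simp add: u_def)
    qed
    have iN: "integrable lborel ?N"
      using Bochner_Integration.integrable_diff[OF integrable_mult_right[OF ih, of z] hq] unfolding e .
    have KK: "z * K x - conv kc K x = ftrans ?N (- x) / (2 * pi)" for x
    proof -
      have "conv kc K x = conv kc (\<lambda>x. ftrans h (- x)) x / (2 * pi)"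
        unfolding conv_def K_def by simp
      also have "\<dots> = ftrans (\<lambda>\<xi>. h \<xi> * q \<xi>) (- x) / (2 * pi)"
        using conv_ftrans[OF ikc ih, of x] by (simp add: q_def)
      finally have "z * K x - conv kc K x = (z * ftrans h (- x) - ftrans (\<lambda>\<xi>. h \<xi> * q \<xi>) (- x)) / (2 * pi)"
        by (simp add: K_def diff_divide_distrib)
      also have "z * ftrans h (- x) - ftrans (\<lambda>\<xi>. h \<xi> * q \<xi>) (- x) = ftrans ?N (- x)"
      proof -
        have "ftrans ?N (- x) = (\<integral>y. z * (h y * iexp (- x * y)) - (h y * q y) * iexp (- x * y) \<partial>lborel)"
          unfolding ftrans_def e[symmetric] by (simp add: algebra_simps)
        also have "\<dots> = z * ftrans h (- x) - ftrans (\<lambda>\<xi>. h \<xi> * q \<xi>) (- x)"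
          unfolding ftrans_def
          by (subst Bochner_Integration.integral_diff)
             (intro integrable_mult_right integrable_mult_iexp ih hq, simp, intro integrable_mult_iexp hq, simp, simp)
        finally show ?thesis by simp
      qed
      finally show ?thesis .
    qed
    \<comment> \<open>Since (z - q) h = q^(M+2), the left side of \<open>base\<close> is the inverse
      transform of q^(M+2). Inversion is applied to the nonnegative function
      \<open>p (M + 1)\<close> with that transform.\<close>
    have "ftrans (pc (M + 1)) = ?N" using pp[of "M + 1"] by auto
    then have "AE x in lborel. pc (M + 1) x = ftrans ?N (- x) / (2 * pi)"
      using fourier_inversion_nonneg[of "p (M + 1)"] pp[of "M + 1"] iN by (simp add: pc_def[abs_def])
    then show ?thesis unfolding KK by eventually_elim simp
  qed
  have step: "\<exists>K'. integrable lborel K' \<and> (AE x in lborel. z * K' x - conv kc K' x = pc j x)"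
    if "integrable lborel K" "AE x in lborel. z * K x - conv kc K x = pc (Suc j) x" for j K
  proof (intro exI conjI)
    let ?K = "\<lambda>x. inverse z * pc j x + inverse z * K x"
    show "integrable lborel ?K" using that(1) ipc by simp
    show "AE x in lborel. z * ?K x - conv kc ?K x = pc j x"
      using conv_lincomb[OF ikc ipc[of j] that(1), of "inverse z" "inverse z"] that(2)
    proof eventually_elim
      case (elim x)
      have "z * ?K x = pc j x + K x" using z by (simp add: distrib_left mult.assoc[symmetric])
      moreover have "conv kc ?K x = inverse z * (pc (Suc j) x + conv kc K x)"
        unfolding elim(1) pcS by (simp add: distrib_left)
      moreover have "pc (Suc j) x + conv kc K x = z * K x" using elim(2) by (simp add: algebra_simps)
      ultimately show ?case using z by simp
    qed
  qed
  \<comment> \<open>Downward induction on the power through \<open>i\<close>, from M + 1 to 0, where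
    the right-hand side is the kernel itself.\<close>
  have "\<exists>K. integrable lborel K \<and> (AE x in lborel. z * K x - conv kc K x = pc (M + 1 - i) x)" if "i \<le> M + 1" for i
    using that
  proof (induction i)
    case 0
    then show ?case using iK base by auto
  next
    case (Suc i)
    then obtain K' where "integrable lborel K'" "AE x in lborel. z * K' x - conv kc K' x = pc (M + 1 - i) x" by auto
    moreover have "M + 1 - i = Suc (M + 1 - Suc i)" using Suc.prems by simp
    ultimately show ?case using step[of K' "M + 1 - Suc i"] by metis
  qed
  from this[of "M + 1"] obtain K0 where K0: "integrable lborel K0" "AE x in lborel. z * K0 x - conv kc K0 x = kc x"
    by (auto simp: pc_def p0 kc_def)
  \<comment> \<open>\<open>K0\<close> corresponds to q/(z - q). Dividing by z gives 1/(z - q) - 1/z,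
    the part of the resolvent beyond the multiple of the identity.\<close>
  show thesis
  proof (rule that)
    show "integrable lborel (\<lambda>x. inverse z * K0 x)" using K0(1) by (rule integrable_mult_right)
    show "AE x in lborel. z * (inverse z * K0 x) = of_real (k x) / z + conv (\<lambda>y. of_real (k y)) (\<lambda>x. inverse z * K0 x) x"
      using K0(2)
    proof eventually_elim
      case (elim x)
      have "conv kc (\<lambda>x. inverse z * K0 x) x = inverse z * conv kc K0 x"
        unfolding conv_def by (simp add: mult.left_commute)
      moreover have "kc x / z + inverse z * conv kc K0 x = inverse z * (z * K0 x)"
      proof -
        have e: "z * K0 x = kc x + conv kc K0 x" using elim by (simp add: algebra_simps)
        show ?thesis unfolding e by (simp add: divide_inverse distrib_left mult.commute)
      qed
      ultimately show ?case by (simp add: kc_def[abs_def] mult.left_commute)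
    qed
  qed
qed

section \<open>Logarithmic coordinates and Beta kernels\<close>

text \<open>Substitution on the compact intervals [exp(-n), exp(n)], then monotone convergence on
  both sides.\<close>

lemma nn_integral_exp_substitution:
  fixes f :: "real \<Rightarrow> ennreal"
  assumes [measurable]: "f \<in> borel_measurable borel"
  shows "(\<integral>\<^sup>+t. f t * indicator {0<..} t \<partial>lborel) = (\<integral>\<^sup>+x. ennreal (exp x) * f (exp x) \<partial>lborel)"
proof -
  have ex: "\<exists>n. \<forall>m\<ge>n. \<bar>x\<bar> \<le> real (Suc m)" for x :: real
  proof -
    obtain n where "\<bar>x\<bar> < real n" using reals_Archimedean2 by blast
    then show ?thesis by (intro exI[of _ n]) auto
  qed
  have s: "(\<integral>\<^sup>+t. f t * indicator {exp (- real (Suc n))..exp (real (Suc n))} t \<partial>lborel) =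
      (\<integral>\<^sup>+x. f (exp x) * ennreal (exp x) * indicator {- real (Suc n)..real (Suc n)} x \<partial>lborel)" for n
    by (rule nn_integral_substitution_aux) (auto intro!: derivative_eq_intros continuous_intros)
  have "(\<lambda>n. \<integral>\<^sup>+t. f t * indicator {exp (- real (Suc n))..exp (real (Suc n))} t \<partial>lborel) \<longlonglongrightarrow> (\<integral>\<^sup>+t. f t * indicator {0<..} t \<partial>lborel)"
  proof (rule nn_integral_LIMSEQ)
    show "incseq (\<lambda>n t. f t * indicator {exp (- real (Suc n))..exp (real (Suc n))} t)"
    proof (unfold incseq_def le_fun_def, intro allI impI mult_left_mono)
      fix m n :: nat and t :: real assume "m \<le> n"
      then have "exp (- real (Suc n)) \<le> exp (- real (Suc m))" "exp (real (Suc m)) \<le> exp (real (Suc n))" by simp_all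
      then have "{exp (- real (Suc m))..exp (real (Suc m))} \<subseteq> {exp (- real (Suc n))..exp (real (Suc n))}"
        by (intro atLeastatMost_subset_iff[THEN iffD2] disjI2 conjI)
      then show "indicator {exp (- real (Suc m))..exp (real (Suc m))} t \<le> (indicator {exp (- real (Suc n))..exp (real (Suc n))} t :: ennreal)"
        unfolding indicator_def by (simp only: subset_iff split: if_splits) (simp add: of_bool_def)
    qed simp
    fix t :: real
    show "(\<lambda>n. f t * indicator {exp (- real (Suc n))..exp (real (Suc n))} t) \<longlonglongrightarrow> f t * indicator {0<..} t"
    proof (cases "t > 0")
      case True
      obtain n where n: "\<And>m. m \<ge> n \<Longrightarrow> \<bar>ln t\<bar> \<le> real (Suc m)" using ex by metis
      have "\<forall>\<^sub>F m in sequentially. f t * indicator {exp (- real (Suc m))..exp (real (Suc m))} t = f t * indicator {0<..} t"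
        using eventually_ge_at_top[of n]
      proof eventually_elim
        case (elim m)
        have "- real (Suc m) \<le> ln t" "ln t \<le> real (Suc m)" using n[OF elim] by auto
        then have "t \<in> {exp (- real (Suc m))..exp (real (Suc m))}"
          using True by (metis atLeastAtMost_iff exp_le_cancel_iff exp_ln)
        then show ?case using True by simp
      qed
      then show ?thesis by (rule tendsto_eventually)
    next
      case False
      then have "t \<notin> {exp (- real (Suc n))..exp (real (Suc n))}" for n
        using exp_gt_zero[of "- real (Suc n)"] by (auto simp: not_less dest: order_trans simp del: exp_gt_zero)
      then show ?thesis using False by simp
    qed
  qed measurable
  moreover have "(\<lambda>n. \<integral>\<^sup>+x. f (exp x) * ennreal (exp x) * indicator {- real (Suc n)..real (Suc n)} x \<partial>lborel) \<longlonglongrightarrow> (\<integral>\<^sup>+x. ennreal (exp x) * f (exp x) \<partial>lborel)"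
  proof (rule nn_integral_LIMSEQ)
    show "incseq (\<lambda>n x. f (exp x) * ennreal (exp x) * indicator {- real (Suc n)..real (Suc n)} x)"
      by (auto simp: incseq_def le_fun_def indicator_def)
    fix x :: real
    obtain n where n: "\<And>m. m \<ge> n \<Longrightarrow> \<bar>x\<bar> \<le> real (Suc m)" using ex by metis
    have "\<forall>\<^sub>F m in sequentially. f (exp x) * ennreal (exp x) * indicator {- real (Suc m)..real (Suc m)} x = ennreal (exp x) * f (exp x)"
      using eventually_ge_at_top[of n]
    proof eventually_elim
      case (elim m)
      then have "x \<in> {- real (Suc m)..real (Suc m)}" using n[OF elim] by auto
      then show ?case by (simp add: mult.commute)
    qed
    then show "(\<lambda>n. f (exp x) * ennreal (exp x) * indicator {- real (Suc n)..real (Suc n)} x) \<longlonglongrightarrow> ennreal (exp x) * f (exp x)"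
      by (rule tendsto_eventually)
  qed measurable
  ultimately show ?thesis unfolding s by (rule LIMSEQ_unique)
qed

text \<open>The substitution as an equality of measures, from which Bochner integrals, integrability
  and null sets are all transferred.\<close>

lemma lborel_pos_eq_distr_exp:
  "density lborel (indicator {0::real<..}) = distr (density lborel (\<lambda>x. ennreal (exp x))) borel exp"
proof (rule measure_eqI)
  fix A assume "A \<in> sets (density lborel (indicator {0::real<..}))"
  then have [measurable]: "A \<in> sets borel" by simp
  have "emeasure (density lborel (indicator {0::real<..})) A = (\<integral>\<^sup>+t. indicator A t * indicator {0<..} t \<partial>lborel)"
    by (subst emeasure_density) (auto simp: mult.commute)
  also have "\<dots> = (\<integral>\<^sup>+x. ennreal (exp x) * indicator A (exp x) \<partial>lborel)"
    by (rule nn_integral_exp_substitution) measurable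
  also have "\<dots> = emeasure (distr (density lborel (\<lambda>x. ennreal (exp x))) borel exp) A"
    by (subst emeasure_distr) (auto simp: emeasure_density vimage_def indicator_def intro!: nn_integral_cong)
  finally show "emeasure (density lborel (indicator {0::real<..})) A = emeasure (distr (density lborel (\<lambda>x. ennreal (exp x))) borel exp) A" .
qed auto

lemma
  fixes f :: "real \<Rightarrow> complex"
  assumes [measurable]: "f \<in> borel_measurable borel"
  shows integral_exp_substitution:
      "(\<integral>t. indicator {0<..} t *\<^sub>R f t \<partial>lborel) = (\<integral>x. exp x *\<^sub>R f (exp x) \<partial>lborel)"
    and integrable_exp_substitution:
      "integrable lborel (\<lambda>t. indicator {0<..} t *\<^sub>R f t) \<longleftrightarrow> integrable lborel (\<lambda>x. exp x *\<^sub>R f (exp x))"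
proof -
  have m: "ennreal (indicator {0<..} t) = indicator {0<..} t" for t :: real by (simp split: split_indicator)
  have d: "density lborel (\<lambda>t. ennreal (indicator {0::real<..} t)) = distr (density lborel (\<lambda>x. ennreal (exp x))) borel exp"
    unfolding m using lborel_pos_eq_distr_exp by simp
  have "(\<integral>t. indicator {0<..} t *\<^sub>R f t \<partial>lborel) = (\<integral>t. f t \<partial>(density lborel (\<lambda>t. ennreal (indicator {0::real<..} t))))"
    by (subst integral_density) auto
  also have "\<dots> = (\<integral>x. exp x *\<^sub>R f (exp x) \<partial>lborel)"
    unfolding d by (subst integral_distr, simp, simp, subst integral_density) auto
  finally show "(\<integral>t. indicator {0<..} t *\<^sub>R f t \<partial>lborel) = (\<integral>x. exp x *\<^sub>R f (exp x) \<partial>lborel)" .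
  have "integrable lborel (\<lambda>t. indicator {0<..} t *\<^sub>R f t) \<longleftrightarrow> integrable (density lborel (\<lambda>t. ennreal (indicator {0::real<..} t))) f"
    by (subst integrable_density) auto
  also have "\<dots> \<longleftrightarrow> integrable lborel (\<lambda>x. exp x *\<^sub>R f (exp x))"
    unfolding d by (subst integrable_distr_eq, simp, simp, subst integrable_density) auto
  finally show "integrable lborel (\<lambda>t. indicator {0<..} t *\<^sub>R f t) \<longleftrightarrow> integrable lborel (\<lambda>x. exp x *\<^sub>R f (exp x))" .
qed

lemma AE_exp_iff:
  assumes [measurable]: "Measurable.pred borel (\<lambda>t::real. 0 < t \<longrightarrow> P t)"
  shows "(AE t in lborel. 0 < t \<longrightarrow> P t) \<longleftrightarrow> (AE x in lborel. P (exp x))"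
proof -
  have "(AE t in lborel. 0 < t \<longrightarrow> P t) \<longleftrightarrow> (AE t in density lborel (indicator {0::real<..}). 0 < t \<longrightarrow> P t)"
    by (subst AE_density) (auto simp: indicator_def)
  also have "\<dots> \<longleftrightarrow> (AE x in density lborel (\<lambda>x. ennreal (exp x)). 0 < exp x \<longrightarrow> P (exp x))"
    unfolding lborel_pos_eq_distr_exp by (subst AE_distr_iff) auto
  also have "\<dots> \<longleftrightarrow> (AE x in lborel. P (exp x))"
    by (subst AE_density) auto
  finally show ?thesis .
qed

text \<open>For \<open>y > 0\<close> this is \<open>(1 - exp(-y))\<^sup>a\<^sup>-\<^sup>1 exp(-cy)\<close>: the kernel of the Erdelyi-Kober integral of order \<open>a\<close>
  in logarithmic coordinates. The convolution rule for these kernels is the semigroup law of fractional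
  integration.\<close>

definition ekern :: "real \<Rightarrow> real \<Rightarrow> real \<Rightarrow> real" where
  "ekern a c y = (if 0 < y then (exp y - 1) powr (a - 1) * exp (- ((c + a - 1) * y)) else 0)"

lemma ekern_nonneg [simp]: "0 \<le> ekern a c y"
  by (simp add: ekern_def)

lemma ekern_measurable [measurable]: "ekern a c \<in> borel_measurable borel"
  unfolding ekern_def[abs_def] by measurable

section \<open>Mass and semigroup law of the Beta kernels\<close>

lemma nn_integral_Beta:
  assumes "0 < a" "0 < b"
  shows "(\<integral>\<^sup>+t. ennreal (indicator {0<..<1} t * (t powr (a - 1) * (1 - t) powr (b - 1))) \<partial>lborel) = ennreal (Beta a b)"
proof -
  have "((\<lambda>t. t powr (a - 1) * (1 - t) powr (b - 1)) has_integral Beta a b) {0<..<1}"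
    using has_integral_Beta_real[OF assms] by (simp add: has_integral_Icc_iff_Ioo)
  then have "((\<lambda>t. if t \<in> {0<..<1} then t powr (a - 1) * (1 - t) powr (b - 1) else 0) has_integral Beta a b) UNIV"
    by (simp only: has_integral_restrict_UNIV)
  then have "((\<lambda>t. indicator {0<..<1} t * (t powr (a - 1) * (1 - t) powr (b - 1))) has_integral Beta a b) UNIV"
    by (rule back_subst[of "\<lambda>f. (f has_integral Beta a b) UNIV"]) (auto simp: indicator_def)
  then show ?thesis by (intro nn_integral_has_integral_lborel) auto
qed

text \<open>With v = exp(y) the reflected kernel becomes v^(c-1) (1 - v)^(a-1) on (0, 1), the
  integrand of the Beta function.\<close>

lemma nn_integral_ekern_reflected:
  assumes "0 < a" "0 < c"
  shows "(\<integral>\<^sup>+y. ennreal (ekern a c (- y)) \<partial>lborel) = ennreal (Beta c a)"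
proof -
  let ?f = "\<lambda>v. ennreal (indicator {0<..<1} v * (v powr (c - 1) * (1 - v) powr (a - 1)))"
  have "ennreal (ekern a c (- y)) = ennreal (exp y) * ?f (exp y)" for y
  proof (cases "y < 0")
    case True
    have "exp (- y) - 1 = (1 - exp y) * exp (- y)" by (simp add: left_diff_distrib flip: exp_add)
    then have "(exp (- y) - 1) powr (a - 1) = (1 - exp y) powr (a - 1) * exp (- y * (a - 1))"
      using True by (simp add: powr_mult exp_powr_real)
    moreover have "exp (- y * (a - 1)) * exp ((c + a - 1) * y) = exp y * exp (y * (c - 1))"
      by (simp add: algebra_simps flip: exp_add)
    ultimately have "ekern a c (- y) = exp y * ((exp y) powr (c - 1) * (1 - exp y) powr (a - 1))"
      using True by (simp add: ekern_def exp_powr_real mult_ac)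
    then show ?thesis using True by (simp add: ennreal_mult')
  qed (auto simp: ekern_def)
  then have "(\<integral>\<^sup>+y. ennreal (ekern a c (- y)) \<partial>lborel) = (\<integral>\<^sup>+t. ?f t * indicator {0<..} t \<partial>lborel)"
    by (subst nn_integral_exp_substitution) auto
  also have "\<dots> = (\<integral>\<^sup>+t. ?f t \<partial>lborel)"
    by (intro nn_integral_cong) (auto split: split_indicator)
  also have "\<dots> = ennreal (Beta c a)" by (rule nn_integral_Beta) fact+
  finally show ?thesis .
qed

lemma ekern_integrable:
  assumes "0 < a" "0 < c"
  shows "integrable lborel (ekern a c)" "integrable lborel (\<lambda>y. ekern a c (- y))"
proof -
  show "integrable lborel (\<lambda>y. ekern a c (- y))"
    by (rule integrableI_bounded) (auto simp: nn_integral_ekern_reflected[OF assms])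
  then show "integrable lborel (ekern a c)"
    using integrable_reflect_iff[of "ekern a c" 0] by simp
qed

text \<open>After r = exp(w) the integrand is a constant times (r - 1)^(a-1) (Y - r)^(b-1) on (1,
  Y), and the affine map onto (0, 1) turns this into a Beta integral. The parameter c + a of the
  second kernel is what reduces the remaining exponentials in w to the Jacobian exp(w).\<close>

lemma nn_integral_ekern_conv:
  assumes a: "0 < a" and b: "0 < b"
  shows "(\<integral>\<^sup>+w. ennreal (ekern a c w * ekern b (c + a) (y - w)) \<partial>lborel) = ennreal (Beta a b * ekern (a + b) c y)"
proof (cases "0 < y")
  case False
  then have "ekern a c w * ekern b (c + a) (y - w) = 0" for w by (auto simp: ekern_def)
  moreover have "ekern (a + b) c y = 0" using False by (simp add: ekern_def)
  ultimately show ?thesis by (simp only:) simp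
next
  case True
  define Y where "Y = exp y"
  have Y: "Y > 1" using True by (simp add: Y_def)
  define K where "K = exp (- ((c + a + b - 1) * y))"
  let ?g = "\<lambda>r. ennreal (indicator {1<..<Y} r * (K * ((r - 1) powr (a - 1) * (Y - r) powr (b - 1))))"
  have "ennreal (ekern a c w * ekern b (c + a) (y - w)) = ennreal (exp w) * ?g (exp w)" for w
  proof (cases "0 < w \<and> w < y")
    case True
    have "exp (y - w) - 1 = (Y - exp w) * exp (- w)" by (simp add: Y_def left_diff_distrib flip: exp_add)
    moreover have "exp w < Y" using True by (simp add: Y_def)
    ultimately have e1: "(exp (y - w) - 1) powr (b - 1) = (Y - exp w) powr (b - 1) * exp (- w * (b - 1))"
      by (simp add: powr_mult exp_powr_real)
    have e2: "exp (- ((c + a - 1) * w)) * (exp (- w * (b - 1)) * exp (- ((c + a + b - 1) * (y - w)))) = exp w * K"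
      unfolding K_def by (simp add: algebra_simps flip: exp_add)
    have "ekern a c w * ekern b (c + a) (y - w) =
      (exp w - 1) powr (a - 1) * (Y - exp w) powr (b - 1) *
        (exp (- ((c + a - 1) * w)) * (exp (- w * (b - 1)) * exp (- ((c + a + b - 1) * (y - w)))))"
      using True by (simp add: ekern_def e1 mult_ac)
    also have "\<dots> = exp w * (K * ((exp w - 1) powr (a - 1) * (Y - exp w) powr (b - 1)))"
      unfolding e2 by (simp add: mult_ac)
    finally show ?thesis using True by (simp add: ennreal_mult' Y_def)
  next
    case False
    then have "ekern a c w * ekern b (c + a) (y - w) = 0" by (auto simp: ekern_def)
    moreover have "exp w \<notin> {1<..<Y}" using False by (auto simp: Y_def)
    ultimately show ?thesis by simp
  qed
  then have "(\<integral>\<^sup>+w. ennreal (ekern a c w * ekern b (c + a) (y - w)) \<partial>lborel) = (\<integral>\<^sup>+r. ?g r * indicator {0<..} r \<partial>lborel)"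
    by (subst nn_integral_exp_substitution) auto
  also have "\<dots> = (\<integral>\<^sup>+r. ?g r \<partial>lborel)"
    by (intro nn_integral_cong) (auto split: split_indicator)
  also have "\<dots> = ennreal \<bar>Y - 1\<bar> * (\<integral>\<^sup>+t. ?g (1 + (Y - 1) * t) \<partial>lborel)"
    using Y by (intro nn_integral_real_affine) auto
  also have "(\<integral>\<^sup>+t. ?g (1 + (Y - 1) * t) \<partial>lborel) =
      (\<integral>\<^sup>+t. ennreal (K * (Y - 1) powr (a + b - 2)) * ennreal (indicator {0<..<1} t * (t powr (a - 1) * (1 - t) powr (b - 1))) \<partial>lborel)"
  proof (intro nn_integral_cong)
    fix t :: real
    have l: "(Y - 1) * t < Y - 1 \<longleftrightarrow> t < 1" and r: "0 < (Y - 1) * t \<longleftrightarrow> 0 < t"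
      using Y mult_less_cancel_left_pos[of "Y - 1" t 1] by (auto simp: zero_less_mult_iff)
    have "1 + (Y - 1) * t \<in> {1<..<Y} \<longleftrightarrow> 0 < (Y - 1) * t \<and> (Y - 1) * t < Y - 1"
      unfolding greaterThanLessThan_iff by linarith
    then have "1 + (Y - 1) * t \<in> {1<..<Y} \<longleftrightarrow> t \<in> {0<..<1}"
      unfolding l r by simp
    moreover have "(Y - (1 + (Y - 1) * t)) = (Y - 1) * (1 - t)" by (simp add: algebra_simps)
    moreover have "(Y - 1) powr (a - 1) * (Y - 1) powr (b - 1) = (Y - 1) powr (a + b - 2)"
      by (simp add: algebra_simps flip: powr_add)
    ultimately show "?g (1 + (Y - 1) * t) = ennreal (K * (Y - 1) powr (a + b - 2)) * ennreal (indicator {0<..<1} t * (t powr (a - 1) * (1 - t) powr (b - 1)))"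
      using Y by (auto simp: powr_mult ennreal_mult'[symmetric] K_def mult_ac indicator_def)
  qed
  also have "\<dots> = ennreal (K * (Y - 1) powr (a + b - 2)) * ennreal (Beta a b)"
    by (subst nn_integral_cmult) (auto simp: nn_integral_Beta[OF a b])
  also have "ennreal \<bar>Y - 1\<bar> * \<dots> = ennreal ((Y - 1) * (K * (Y - 1) powr (a + b - 2) * Beta a b))"
    using Y by (simp add: K_def ennreal_mult' mult.assoc)
  also have "(Y - 1) * (K * (Y - 1) powr (a + b - 2) * Beta a b) = Beta a b * (((Y - 1) * (Y - 1) powr (a + b - 2)) * K)"
    by simp
  also have "(Y - 1) * (Y - 1) powr (a + b - 2) = (Y - 1) powr (a + b - 1)"
    using Y by (subst powr_mult_base) (auto simp: algebra_simps)
  also have "Beta a b * ((Y - 1) powr (a + b - 1) * K) = Beta a b * ekern (a + b) c y"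
    using True by (simp add: ekern_def Y_def K_def add.assoc)
  finally show ?thesis .
qed

lemma conv_ekern:
  assumes a: "0 < a" and b: "0 < b"
  shows "conv (\<lambda>y. of_real (ekern a c y)) (\<lambda>y. of_real (ekern b (c + a) y)) x = of_real (Beta a b * ekern (a + b) c x)"
proof -
  have B: "0 \<le> Beta a b" using a b by (simp add: Beta_def Gamma_real_pos less_imp_le)
  have "(\<integral>w. ekern a c w * ekern b (c + a) (x - w) \<partial>lborel) = Beta a b * ekern (a + b) c x"
    using B by (subst integral_eq_nn_integral) (auto simp: nn_integral_ekern_conv[OF a b])
  then show ?thesis unfolding conv_def of_real_mult[symmetric] integral_complex_of_real by simp
qed

abbreviation cekern :: "real \<Rightarrow> real \<Rightarrow> real \<Rightarrow> complex" where
  "cekern a c \<equiv> \<lambda>y. complex_of_real (ekern a c y)"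

lemma cekern_integrable: "0 < a \<Longrightarrow> 0 < c \<Longrightarrow> integrable lborel (cekern a c)"
  using ekern_integrable(1) by simp

lemma corr_cekern_comp:
  assumes p: "1 < p" and a: "0 < a" and b: "0 < b" and c: "0 < c" and F: "Lp p F"
  shows "AE x in lborel. corr (cekern a c) (corr (cekern b (c + a)) F) x = of_real (Beta a b) * corr (cekern (a + b) c) F x"
proof -
  have "conv (cekern a c) (cekern b (c + a)) = (\<lambda>x. of_real (Beta a b) * cekern (a + b) c x)"
    using conv_ekern[OF a b] by (auto simp: fun_eq_iff)
  then have "corr (conv (cekern a c) (cekern b (c + a))) F x = of_real (Beta a b) * corr (cekern (a + b) c) F x" for x
    by (simp add: corr_def mult.assoc)
  then show ?thesis
    using corr_corr[OF p cekern_integrable[OF a c] cekern_integrable[OF b, of "c + a"] F] a c by simp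
qed

section \<open>Injectivity of fractional integration\<close>

lemma AE_exists_in_interval:
  assumes "AE x in lborel. P x" "a < (b::real)"
  shows "\<exists>x. a < x \<and> x < b \<and> P x"
proof (rule ccontr)
  assume "\<not> ?thesis"
  with assms(1) have "AE x in lborel. x \<notin> {a<..<b}" by (auto elim!: eventually_mono)
  then have "{a<..<b} \<in> null_sets lborel" by (subst AE_iff_null_sets) auto
  then have "emeasure lborel {a<..<b} = 0" by auto
  then show False using assms(2) by simp
qed

text \<open>The kernel of order 1 is exp(-cy) on y > 0, so the correlation at x is exp(cx) times the
  tail integral of exp(-cs) F(s) over s > x. If it vanishes for almost every x, it vanishes for
  every x by right continuity; differences of tails give all interval integrals.\<close>

lemma corr_cekern_1_injective:
  assumes p: "1 < p" and c: "0 < c" and F: "Lp p F"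
    and 0: "AE x in lborel. corr (cekern 1 c) F x = 0"
  shows "AE x in lborel. F x = 0"
proof -
  have [measurable]: "F \<in> borel_measurable borel" using F by (auto simp: Lp_def)
  define g where "g s = exp (- (c * s)) *\<^sub>R F s" for s
  have [measurable]: "g \<in> borel_measurable borel" unfolding g_def by measurable
  define G where "G x \<longleftrightarrow> integrable lborel (\<lambda>s. indicator {x<..} s *\<^sub>R g s) \<and> (\<integral>s. indicator {x<..} s *\<^sub>R g s \<partial>lborel) = 0" for x
  have e: "cekern 1 c y * F (x + y) = exp (c * x) *\<^sub>R (indicator {x<..} (y + x) *\<^sub>R g (y + x))" for x y
  proof (cases "0 < y")
    case True
    have "exp (c * x) * exp (- (c * (y + x))) = exp (- (c * y))" by (simp add: algebra_simps flip: exp_add)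
    then show ?thesis using True by (simp add: ekern_def g_def scaleR_conv_of_real add.commute mult.assoc[symmetric] flip: of_real_mult)
  qed (simp add: ekern_def)
  have AE: "AE x in lborel. G x"
    using 0 Lp_corr(1)[OF p cekern_integrable[OF _ c] F, of 1, simplified]
  proof eventually_elim
    case (elim x)
    from elim(2) have "integrable lborel (\<lambda>y. exp (c * x) *\<^sub>R (indicator {x<..} (y + x) *\<^sub>R g (y + x)))"
      unfolding e .
    then have "integrable lborel (\<lambda>y. exp (- (c * x)) *\<^sub>R (exp (c * x) *\<^sub>R (indicator {x<..} (y + x) *\<^sub>R g (y + x))))"
      by (rule integrable_scaleR_right)
    then have i: "integrable lborel (\<lambda>y. indicator {x<..} (y + x) *\<^sub>R g (y + x))"
      unfolding scaleR_scaleR[of "exp (- (c * x))" "exp (c * x)"] exp_add[symmetric] by simp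
    from elim(1) have "(\<integral>y. exp (c * x) *\<^sub>R (indicator {x<..} (y + x) *\<^sub>R g (y + x)) \<partial>lborel) = 0"
      unfolding corr_def e .
    then have "(\<integral>y. indicator {x<..} (y + x) *\<^sub>R g (y + x) \<partial>lborel) = 0"
      unfolding integral_scaleR_right by simp
    with i show ?case
      unfolding G_def
      using integrable_shift_iff[of "\<lambda>s. indicator {x<..} s *\<^sub>R g s" x] integral_shift[of "\<lambda>s. indicator {x<..} s *\<^sub>R g s" x]
      by simp
  qed
  have all: "G x" for x
  proof -
    \<comment> \<open>Good points are dense: one to the left of x provides the integrable majorant,
      and a sequence decreasing to x from the right carries the value 0 over.\<close>
    obtain x0 where x0: "x0 < x" "G x0" using AE_exists_in_interval[OF AE, of "x - 1" x] by auto
    have "\<exists>y. x < y \<and> y < x + 1 / real (Suc n) \<and> G y" for n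
      by (rule AE_exists_in_interval[OF AE]) simp
    then obtain X where X: "\<And>n. x < X n" "\<And>n. X n < x + 1 / real (Suc n)" "\<And>n. G (X n)" by metis
    have Xl: "X \<longlonglongrightarrow> x"
    proof (rule tendsto_sandwich[OF _ _ tendsto_const])
      show "(\<lambda>n. x + 1 / real (Suc n)) \<longlonglongrightarrow> x"
        using LIMSEQ_inverse_real_of_nat_add[of x]
        by (simp add: inverse_eq_divide)
    qed (use X in \<open>auto intro!: always_eventually less_imp_le\<close>)
    have i0: "integrable lborel (\<lambda>s. norm (indicator {x0<..} s *\<^sub>R g s))"
      using x0(2) by (auto simp: G_def simp del: norm_scaleR)
    have i: "integrable lborel (\<lambda>s. indicator {x<..} s *\<^sub>R g s)"
      by (rule Bochner_Integration.integrable_bound[OF i0]) (use x0 in \<open>auto split: split_indicator\<close>)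
    have "(\<lambda>n. \<integral>s. indicator {X n<..} s *\<^sub>R g s \<partial>lborel) \<longlonglongrightarrow> (\<integral>s. indicator {x<..} s *\<^sub>R g s \<partial>lborel)"
    proof (rule integral_dominated_convergence[OF _ _ i0])
      show "AE s in lborel. (\<lambda>n. indicator {X n<..} s *\<^sub>R g s) \<longlonglongrightarrow> indicator {x<..} s *\<^sub>R g s"
      proof (rule AE_I2)
        fix s
        have "\<forall>\<^sub>F n in sequentially. indicator {X n<..} s *\<^sub>R g s = indicator {x<..} s *\<^sub>R g s"
        proof (cases "x < s")
          case True
          show ?thesis using order_tendstoD(2)[OF Xl True] by eventually_elim (use True in simp)
        next
          case False
          then have "\<not> X n < s" for n using X(1)[of n] by simp
          then show ?thesis using False by simp
        qed
        then show "(\<lambda>n. indicator {X n<..} s *\<^sub>R g s) \<longlonglongrightarrow> indicator {x<..} s *\<^sub>R g s" by (rule tendsto_eventually)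
      qed
      show "AE s in lborel. norm (indicator {X n<..} s *\<^sub>R g s) \<le> norm (indicator {x0<..} s *\<^sub>R g s)" for n
        using X(1)[of n] x0(1) by (auto split: split_indicator)
    qed measurable
    moreover have "(\<integral>s. indicator {X n<..} s *\<^sub>R g s \<partial>lborel) = 0" for n using X(3) by (simp add: G_def)
    ultimately have "(\<integral>s. indicator {x<..} s *\<^sub>R g s \<partial>lborel) = 0" by (simp add: LIMSEQ_const_iff)
    with i show ?thesis by (simp add: G_def)
  qed
  have "AE x in lborel. g x = 0"
  proof (rule AE_zero_if_interval_integrals_zero)
    fix a b :: real
    have ia: "integrable lborel (\<lambda>s. indicator {a<..} s *\<^sub>R g s)" using all[of a] by (simp add: G_def)
    show "integrable lborel (\<lambda>y. indicator {a<..b} y *\<^sub>R g y)"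
      by (rule Bochner_Integration.integrable_bound[OF integrable_norm[OF ia]]) (auto split: split_indicator)
    assume ab: "a < b"
    have "(\<integral>y. indicator {a<..b} y *\<^sub>R g y \<partial>lborel) = (\<integral>y. indicator {a<..} y *\<^sub>R g y - indicator {b<..} y *\<^sub>R g y \<partial>lborel)"
      using ab by (intro Bochner_Integration.integral_cong) (auto split: split_indicator)
    also have "\<dots> = 0" using all[of a] all[of b] by (simp add: G_def)
    finally show "(\<integral>y. indicator {a<..b} y *\<^sub>R g y \<partial>lborel) = 0" .
  qed
  then show ?thesis by (simp add: g_def)
qed

lemma corr_zero_AE:
  assumes "AE x in lborel. F x = 0" "k \<in> borel_measurable borel" "F \<in> borel_measurable borel"
  shows "corr k F x = 0"
  using corr_cong_AE[of F "\<lambda>_. 0" k x] assms by (simp add: corr_def)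

text \<open>The semigroup law reduces every order to order 1. For a < 1 a further kernel of order 1
  - a completes a to 1, commutes past, and meets a null function. For a > 1 the operator factors
  through order 1 followed by order a - 1; the latter is injective by induction and the former by
  the base case.\<close>

theorem corr_cekern_injective:
  assumes p: "1 < p" and a: "0 < a" and c: "0 < c" and F: "Lp p F"
    and 0: "AE x in lborel. corr (cekern a c) F x = 0"
  shows "AE x in lborel. F x = 0"
proof -
  have B: "Beta u v \<noteq> 0" if "0 < u" "0 < v" for u v :: real
    using that Gamma_real_pos[of u] Gamma_real_pos[of v] Gamma_real_pos[of "u + v"]
    by (simp add: Beta_def less_imp_neq[THEN not_sym])
  have "\<forall>a c F. 0 < a \<longrightarrow> a \<le> real n + 1 \<longrightarrow> 0 < c \<longrightarrow> Lp p F \<longrightarrow> (AE x in lborel. corr (cekern a c) F x = 0) \<longrightarrow> (AE x in lborel. F x = 0)" for n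
  proof (induction n)
    case 0
    show ?case
    proof (intro allI impI)
      fix a c F assume a: "0 < a" "a \<le> real 0 + 1" and c: "0 < (c::real)" and F: "Lp p F"
        and 0: "AE x in lborel. corr (cekern a c) F x = 0"
      have [measurable]: "F \<in> borel_measurable borel" using F by (auto simp: Lp_def)
      show "AE x in lborel. F x = 0"
      proof (cases "a = 1")
        case True
        then show ?thesis using corr_cekern_1_injective[OF p c F] 0 by simp
      next
        case False
        with a have a1: "0 < 1 - a" by simp
        have "AE x in lborel. corr (cekern a c) (corr (cekern (1 - a) (c + a)) F) x = of_real (Beta a (1 - a)) * corr (cekern 1 c) F x"
          using corr_cekern_comp[OF p a(1) a1 c F] by simp
        moreover have "AE x in lborel. corr (cekern a c) (corr (cekern (1 - a) (c + a)) F) x = corr (cekern (1 - a) (c + a)) (corr (cekern a c) F) x"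
          using a c a1 by (intro corr_commute[OF p] cekern_integrable F) auto
        moreover have "corr (cekern (1 - a) (c + a)) (corr (cekern a c) F) x = 0" for x
          by (rule corr_zero_AE[OF 0]) measurable
        ultimately have "AE x in lborel. corr (cekern 1 c) F x = 0"
          using B[OF a(1) a1] by (auto elim: eventually_elim2)
        then show ?thesis by (rule corr_cekern_1_injective[OF p c F])
      qed
    qed
  next
    case (Suc n)
    show ?case
    proof (intro allI impI)
      fix a c F assume a: "0 < a" "a \<le> real (Suc n) + 1" and c: "0 < (c::real)" and F: "Lp p F"
        and 0: "AE x in lborel. corr (cekern a c) F x = 0"
      show "AE x in lborel. F x = 0"
      proof (cases "a \<le> real n + 1")
        case True
        then show ?thesis using Suc.IH a c F 0 by blast
      next
        case False
        then have a1: "0 < a - 1" "a - 1 \<le> real n + 1" using a by auto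
        let ?F = "corr (cekern 1 (c + (a - 1))) F"
        have LF: "Lp p ?F" using a1 c by (intro Lp_corr(2)[OF p] cekern_integrable F) auto
        have "AE x in lborel. corr (cekern (a - 1) c) ?F x = of_real (Beta (a - 1) 1) * corr (cekern a c) F x"
          using corr_cekern_comp[OF p a1(1) zero_less_one c F] by simp
        with 0 have "AE x in lborel. corr (cekern (a - 1) c) ?F x = 0" by eventually_elim simp
        then have "AE x in lborel. ?F x = 0" using Suc.IH a1 c LF by blast
        then show ?thesis using a1 c by (intro corr_cekern_1_injective[OF p _ F, of "c + (a - 1)"]) auto
      qed
    qed
  qed
  moreover obtain n where "a \<le> real n" using real_arch_simple by blast
  ultimately show ?thesis using a c F 0 by (metis add_increasing2 zero_le_one)
qed

text \<open>With s = exp(x + y) the Weyl integrand scales by powers of exp(x). Weighting the input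
  by t^(c+g) and the output by t^c absorbs these powers and leaves a translation-invariant
  kernel.\<close>

lemma corr_cekern_eq_weyl:
  assumes [measurable]: "F \<in> borel_measurable borel"
  shows "corr (cekern g c) (\<lambda>u. of_real (exp ((c + g) * u)) * F (exp u)) x =
    of_real (exp (c * x)) * (\<integral>s. indicator {exp x<..} s *\<^sub>R (of_real ((s - exp x) powr (g - 1)) * F s) \<partial>lborel)"
proof -
  let ?h = "\<lambda>s. indicator {exp x<..} s *\<^sub>R (of_real ((s - exp x) powr (g - 1)) * F s)"
  have e: "cekern g c y * (of_real (exp ((c + g) * (x + y))) * F (exp (x + y))) = of_real (exp (c * x)) * (exp (y + x) *\<^sub>R ?h (exp (y + x)))" for y
  proof (cases "0 < y")
    case True
    have "exp (y + x) - exp x = exp x * (exp y - 1)" by (simp add: algebra_simps exp_add)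
    then have "(exp (y + x) - exp x) powr (g - 1) = exp (x * (g - 1)) * (exp y - 1) powr (g - 1)"
      using True by (simp add: powr_mult exp_powr_real)
    moreover have "exp (c * x) * (exp (y + x) * exp (x * (g - 1))) = exp (- ((c + g - 1) * y)) * exp ((c + g) * (x + y))"
      by (simp add: algebra_simps flip: exp_add)
    ultimately have "exp (c * x) * (exp (y + x) * (exp (y + x) - exp x) powr (g - 1)) = ekern g c y * exp ((c + g) * (x + y))"
      using True by (simp add: ekern_def mult_ac)
    then have "ekern g c y * exp ((c + g) * (x + y)) = exp (c * x) * (exp (y + x) * (exp (y + x) - exp x) powr (g - 1))" by simp
    then have "complex_of_real (ekern g c y * exp ((c + g) * (x + y))) * F (exp (x + y)) = complex_of_real (exp (c * x) * (exp (y + x) * (exp (y + x) - exp x) powr (g - 1))) * F (exp (x + y))"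
      by (rule arg_cong)
    then show ?thesis using True by (simp add: scaleR_conv_of_real mult.assoc add.commute)
  qed (simp add: ekern_def)
  have "(\<integral>s. ?h s \<partial>lborel) = (\<integral>s. indicator {0<..} s *\<^sub>R ?h s \<partial>lborel)"
    using exp_gt_zero[of x] by (intro Bochner_Integration.integral_cong) (auto split: split_indicator simp del: exp_gt_zero)
  also have "\<dots> = (\<integral>u. exp u *\<^sub>R ?h (exp u) \<partial>lborel)"
    by (rule integral_exp_substitution) measurable
  also have "\<dots> = (\<integral>y. exp (y + x) *\<^sub>R ?h (exp (y + x)) \<partial>lborel)"
    using integral_shift[of "\<lambda>u. exp u *\<^sub>R ?h (exp u)" x] by simp
  finally have "of_real (exp (c * x)) * (\<integral>s. ?h s \<partial>lborel) = (\<integral>y. of_real (exp (c * x)) * (exp (y + x) *\<^sub>R ?h (exp (y + x))) \<partial>lborel)"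
    by (simp only: integral_mult_right_zero)
  also have "\<dots> = corr (cekern g c) (\<lambda>u. of_real (exp ((c + g) * u)) * F (exp u)) x"
    unfolding corr_def e ..
  finally show ?thesis by simp
qed

text \<open>After u = j(s - t) this is the Gamma integral: exponentials are eigenfunctions of Weyl
  integration. It serves twice, for the transform of the kernels and for the Weyl derivatives of the
  dense family.\<close>

lemma integral_Gamma_shift:
  assumes g: "0 < g" and j: "0 < j"
  shows "(\<integral>s. indicator {t<..} s *\<^sub>R (of_real ((s - t) powr (g - 1)) * of_real (exp (- (j * s)))) \<partial>lborel)
      = complex_of_real (Gamma g * j powr (- g) * exp (- (j * t)))"
proof -
  let ?f = "\<lambda>u. indicator {0<..} u * (u powr (g - 1) / exp u)"
  have "((\<lambda>u. u powr (g - 1) / exp u) has_integral Gamma g) {0..}" using Gamma_integral_real[OF g] .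
  then have "((\<lambda>u. u powr (g - 1) / exp u) has_integral Gamma g) {0<..}"
    by (subst (asm) has_integral_spike_set_eq[where T = "{0<..}"])
       (rule negligible_subset[of "{0::real}"]; auto)+
  then have "((\<lambda>u. if u \<in> {0<..} then u powr (g - 1) / exp u else 0) has_integral Gamma g) UNIV"
    by (simp only: has_integral_restrict_UNIV)
  then have "(?f has_integral Gamma g) UNIV"
    by (rule back_subst[of "\<lambda>f. (f has_integral Gamma g) UNIV"]) (auto simp: indicator_def)
  then have "(\<integral>\<^sup>+u. ennreal (?f u) \<partial>lborel) = ennreal (Gamma g)"
    by (intro nn_integral_has_integral_lborel) auto
  then have G: "(\<integral>u. ?f u \<partial>lborel) = Gamma g"
    using Gamma_real_pos[OF g] by (subst integral_eq_nn_integral) (auto simp: less_imp_le)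
  let ?h = "\<lambda>s. indicator {t<..} s * ((s - t) powr (g - 1) * exp (- (j * s)))"
  have e: "?h (t + inverse j * u) = j powr (1 - g) * exp (- (j * t)) * ?f u" for u
  proof (cases "0 < u")
    case True
    have "exp (- (j * (t + inverse j * u))) = exp (- (j * t)) / exp u"
      using j by (simp add: distrib_left mult.assoc[symmetric] flip: exp_diff)
    moreover have "(inverse j * u) powr (g - 1) = j powr (1 - g) * u powr (g - 1)"
      using True j by (simp add: powr_def ln_mult ln_inverse algebra_simps flip: exp_add)
    ultimately show ?thesis using True j by simp
  qed (use j in \<open>simp add: zero_less_mult_iff\<close>)
  have "(\<integral>s. ?h s \<partial>lborel) = \<bar>inverse j\<bar> *\<^sub>R (\<integral>u. ?h (t + inverse j * u) \<partial>lborel)"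
    using j by (intro lborel_integral_real_affine) auto
  also have "\<dots> = inverse j * (j powr (1 - g) * exp (- (j * t)) * Gamma g)"
    unfolding e integral_mult_right_zero G using j by simp
  also have "\<dots> = Gamma g * j powr (- g) * exp (- (j * t))"
  proof -
    have "j powr (1 - g) = j * j powr (- g)" using j by (simp add: powr_diff powr_minus divide_inverse)
    then show ?thesis using j by simp
  qed
  finally have "complex_of_real (\<integral>s. ?h s \<partial>lborel) = complex_of_real (Gamma g * j powr (- g) * exp (- (j * t)))" by (rule arg_cong)
  then show ?thesis
    unfolding integral_complex_of_real[symmetric] by (simp add: scaleR_conv_of_real)
qed

lemma Gamma_exp_integral:
  assumes s: "0 < Re s"
  shows "integrable lborel (\<lambda>x. exp (s * of_real x) * of_real (exp (- exp x)))"
    and "(\<integral>x. exp (s * of_real x) * of_real (exp (- exp x)) \<partial>lborel) = Gamma s"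
proof -
  let ?f = "\<lambda>t. complex_of_real t powr (s - 1) / of_real (exp t)"
  \<comment> \<open>The same integrand on the positive reals, written with the real logarithm so
    that it is a Borel function and the integral over \<open>lebesgue\<close> can be replaced by one
    over \<open>lborel\<close>.\<close>
  define f where "f t = (if t > 0 then exp ((s - 1) * of_real (ln t)) / of_real (exp t) else 0)" for t
  have [measurable]: "f \<in> borel_measurable borel" unfolding f_def[abs_def] by measurable
  have eq: "indicator {0<..} t *\<^sub>R ?f t = indicator {0<..} t *\<^sub>R f t" for t
    by (auto simp: f_def powr_def Ln_of_real split: split_indicator)
  have 1: "integrable lebesgue (\<lambda>t. indicator {0<..} t *\<^sub>R f t)"
    using absolutely_integrable_Gamma_integral'[OF s] unfolding set_integrable_def eq .
  then have i: "integrable lborel (\<lambda>t. indicator {0<..} t *\<^sub>R f t)"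
    by (subst (asm) integrable_completion) auto
  have "(\<integral>t. indicator {0<..} t *\<^sub>R f t \<partial>lborel) = (\<integral>t. indicator {0<..} t *\<^sub>R f t \<partial>lebesgue)"
    by (rule integral_completion[symmetric]) measurable
  also have "\<dots> = (LINT t:{0<..}|lebesgue. ?f t)" unfolding set_lebesgue_integral_def eq ..
  also have "\<dots> = integral {0<..} ?f"
    by (rule set_lebesgue_integral_eq_integral(2)[OF absolutely_integrable_Gamma_integral'[OF s]])
  also have "\<dots> = Gamma s" using Gamma_integral_complex'[OF s] by (rule integral_unique)
  finally have v: "(\<integral>t. indicator {0<..} t *\<^sub>R f t \<partial>lborel) = Gamma s" .
  have e: "exp x *\<^sub>R f (exp x) = exp (s * of_real x) * of_real (exp (- exp x))" for x
  proof -
    have "complex_of_real (exp x) = exp (of_real x)" by (simp add: exp_of_real)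
    moreover have "exp (of_real x) * exp ((s - 1) * of_real x) = exp (s * of_real x)"
      by (simp add: algebra_simps flip: exp_add)
    moreover have "inverse (complex_of_real (exp (exp x))) = of_real (exp (- exp x))"
      by (simp add: exp_minus)
    ultimately show ?thesis
      by (simp add: f_def scaleR_conv_of_real divide_inverse mult.assoc[symmetric])
  qed
  show "integrable lborel (\<lambda>x. exp (s * of_real x) * of_real (exp (- exp x)))"
    using i integrable_exp_substitution[of f] unfolding e by simp
  show "(\<integral>x. exp (s * of_real x) * of_real (exp (- exp x)) \<partial>lborel) = Gamma s"
    using v integral_exp_substitution[of f] unfolding e by simp
qed

text \<open>The transform is read off from a single test function. For G s x = exp(sx - exp x) the
  transform is Gamma(s + i\<xi>), and convolution with the reflected kernel takes
  \<open>G (c + b)\<close> to Gamma(b) times \<open>G c\<close>. Multiplicativity of transforms then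
  gives the quotient of Gamma values, whose denominator has no zero.\<close>

theorem ftrans_ekern_reflected:
  assumes b: "0 < b" and c: "0 < c"
  shows "ftrans (\<lambda>y. cekern b c (- y)) \<xi> = Beta (of_real b) (of_real c + \<i> * of_real \<xi>)"
proof -
  define G where "G s x = complex_of_real (exp (s * x)) * of_real (exp (- exp x))" for s x :: real
  have Gi: "integrable lborel (G s)" if "0 < s" for s
    using Gamma_exp_integral(1)[of "of_real s"] that unfolding G_def[abs_def] by (simp add: exp_of_real flip: of_real_mult)
  have Gf: "ftrans (G s) \<xi> = Gamma (of_real s + \<i> * of_real \<xi>)" if "0 < s" for s
  proof -
    have "G s x * iexp (\<xi> * x) = exp ((of_real s + \<i> * of_real \<xi>) * of_real x) * of_real (exp (- exp x))" for x
    proof -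
      have "complex_of_real (exp (s * x)) * iexp (\<xi> * x) = exp ((of_real s + \<i> * of_real \<xi>) * of_real x)"
        by (simp add: exp_of_real[symmetric] algebra_simps flip: exp_add)
      then show ?thesis by (simp add: G_def mult_ac)
    qed
    then show ?thesis using Gamma_exp_integral(2)[of "of_real s + \<i> * of_real \<xi>"] that by (simp add: ftrans_def)
  qed
  have ki: "integrable lborel (\<lambda>y. cekern b c (- y))" using ekern_integrable(2)[OF b c] by simp
  have "conv (\<lambda>y. cekern b c (- y)) (G (c + b)) x = of_real (Gamma b) * G c x" for x
  proof -
    have "conv (\<lambda>y. cekern b c (- y)) (G (c + b)) x = corr (cekern b c) (G (c + b)) x"
      unfolding conv_def corr_def
      using integral_reflect[of "\<lambda>y. cekern b c y * G (c + b) (x + y)" 0] by simp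
    also have "\<dots> = of_real (exp (c * x)) * (\<integral>s. indicator {exp x<..} s *\<^sub>R (of_real ((s - exp x) powr (b - 1)) * of_real (exp (- (1 * s)))) \<partial>lborel)"
      unfolding G_def using corr_cekern_eq_weyl[of "\<lambda>s. of_real (exp (- s))" b c x] by simp
    also have "\<dots> = of_real (Gamma b) * G c x"
      unfolding integral_Gamma_shift[OF b zero_less_one] by (simp add: G_def)
    finally show ?thesis .
  qed
  then have cv: "conv (\<lambda>y. cekern b c (- y)) (G (c + b)) = (\<lambda>x. of_real (Gamma b) * G c x)" by (rule ext)
  have "ftrans (\<lambda>y. cekern b c (- y)) \<xi> * ftrans (G (c + b)) \<xi> = ftrans (\<lambda>x. of_real (Gamma b) * G c x) \<xi>"
    using ftrans_conv[OF ki Gi[of "c + b"], of \<xi>] b c unfolding cv by simp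
  also have "\<dots> = of_real (Gamma b) * ftrans (G c) \<xi>" unfolding ftrans_def by (simp add: mult.assoc)
  finally have "ftrans (\<lambda>y. cekern b c (- y)) \<xi> * Gamma (of_real (c + b) + \<i> * of_real \<xi>) = Gamma (of_real b) * Gamma (of_real c + \<i> * of_real \<xi>)"
    using b c by (simp add: Gf Gamma_complex_of_real)
  moreover have "Gamma (of_real (c + b) + \<i> * of_real \<xi>) \<noteq> 0"
  proof -
    have "of_real (c + b) + \<i> * of_real \<xi> \<notin> \<int>\<^sub>\<le>\<^sub>0"
    proof
      assume "of_real (c + b) + \<i> * of_real \<xi> \<in> \<int>\<^sub>\<le>\<^sub>0"
      then obtain n :: int where n: "of_real (c + b) + \<i> * of_real \<xi> = complex_of_int n" "n \<le> 0"
        by (elim nonpos_Ints_cases)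
      have "c + b = real_of_int n" using arg_cong[OF n(1), of Re] by simp
      then show False using b c n(2) by simp
    qed
    then show ?thesis by (simp add: Gamma_eq_zero_iff)
  qed
  ultimately show ?thesis by (simp add: Beta_def field_simps)
qed

section \<open>Decay and approximate eigenvectors\<close>

text \<open>Shifting by half a period changes the sign of the oscillating factor, so the transform of a
  decreasing function is controlled by its mass on a half period.\<close>

lemma norm_ftrans_decreasing_le:
  fixes f :: "real \<Rightarrow> real"
  assumes f: "integrable lborel f" "\<And>y. 0 \<le> f y" "\<And>y. y \<le> 0 \<Longrightarrow> f y = 0"
    and dec: "\<And>x y. 0 < x \<Longrightarrow> x \<le> y \<Longrightarrow> f y \<le> f x" and \<xi>: "\<xi> \<noteq> 0"
  shows "norm (ftrans (\<lambda>y. of_real (f y)) \<xi>) \<le> (\<integral>y. indicator {..pi / \<bar>\<xi>\<bar>} y * f y \<partial>lborel)"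
proof -
  define \<eta> where "\<eta> = pi / \<bar>\<xi>\<bar>"
  have \<eta>: "\<eta> > 0" using \<xi> by (simp add: \<eta>_def)
  let ?fc = "\<lambda>y. complex_of_real (f y)"
  have fc: "integrable lborel ?fc" using f(1) by simp
  have fs: "integrable lborel (\<lambda>y. f (y - \<eta>))" using f(1) integrable_shift_iff[of f "- \<eta>"] by simp
  have fcs: "integrable lborel (\<lambda>y. ?fc (y - \<eta>))" using fs by simp
  have half: "iexp (- (\<xi> * \<eta>)) = -1"
  proof (cases "\<xi> > 0")
    case True
    then have "\<xi> * \<eta> = pi" by (simp add: \<eta>_def)
    then show ?thesis using exp_pi_i' by (simp add: exp_minus del: of_real_mult)
  next
    case False
    then have "\<xi> * \<eta> = - pi" using \<xi> by (simp add: \<eta>_def)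
    then show ?thesis using exp_pi_i' by (simp add: mult.commute del: of_real_mult)
  qed
  have "ftrans ?fc \<xi> = (\<integral>y. ?fc (y - \<eta>) * iexp (\<xi> * (y - \<eta>)) \<partial>lborel)"
    using integral_shift[of "\<lambda>y. ?fc y * iexp (\<xi> * y)" "- \<eta>"] by (simp add: ftrans_def)
  also have "\<dots> = (\<integral>y. - (?fc (y - \<eta>) * iexp (\<xi> * y)) \<partial>lborel)"
  proof (intro Bochner_Integration.integral_cong refl)
    fix y
    have "iexp (\<xi> * (y - \<eta>)) = iexp (\<xi> * y) * iexp (- (\<xi> * \<eta>))" by (simp add: algebra_simps flip: exp_add)
    then show "?fc (y - \<eta>) * iexp (\<xi> * (y - \<eta>)) = - (?fc (y - \<eta>) * iexp (\<xi> * y))" unfolding half by simp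
  qed
  also have "\<dots> = - (\<integral>y. ?fc (y - \<eta>) * iexp (\<xi> * y) \<partial>lborel)" by simp
  finally have "2 * ftrans ?fc \<xi> = (\<integral>y. ?fc y * iexp (\<xi> * y) \<partial>lborel) - (\<integral>y. ?fc (y - \<eta>) * iexp (\<xi> * y) \<partial>lborel)"
    by (simp add: ftrans_def)
  also have "\<dots> = (\<integral>y. ?fc y * iexp (\<xi> * y) - ?fc (y - \<eta>) * iexp (\<xi> * y) \<partial>lborel)"
    by (intro Bochner_Integration.integral_diff[symmetric] integrable_mult_iexp fc fcs) auto
  finally have "2 * norm (ftrans ?fc \<xi>) = norm (\<integral>y. ?fc y * iexp (\<xi> * y) - ?fc (y - \<eta>) * iexp (\<xi> * y) \<partial>lborel)"
    by (metis norm_mult norm_numeral)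
  also have "\<dots> \<le> (\<integral>y. norm (?fc y * iexp (\<xi> * y) - ?fc (y - \<eta>) * iexp (\<xi> * y)) \<partial>lborel)"
    by (rule integral_norm_bound)
  \<comment> \<open>For y <= \<eta> the shifted function vanishes, and for y > \<eta> the difference
    has a sign by monotonicity. Hence the modulus is f(y - \<eta>) - f(y), which integrates to 0,
    corrected by 2 f on y <= \<eta>.\<close>
  also have "\<dots> = (\<integral>y. (f (y - \<eta>) - f y) + 2 * (indicator {..\<eta>} y * f y) \<partial>lborel)"
  proof (intro Bochner_Integration.integral_cong refl)
    fix y
    have "norm (?fc y * iexp (\<xi> * y) - ?fc (y - \<eta>) * iexp (\<xi> * y)) = \<bar>f y - f (y - \<eta>)\<bar>"
      unfolding left_diff_distrib[symmetric] norm_mult by (simp flip: of_real_diff)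
    also have "\<dots> = (f (y - \<eta>) - f y) + 2 * (indicator {..\<eta>} y * f y)"
      using f(2)[of y] f(3)[of "y - \<eta>"] dec[of "y - \<eta>" y] \<eta> by (cases "y \<le> \<eta>") auto
    finally show "norm (?fc y * iexp (\<xi> * y) - ?fc (y - \<eta>) * iexp (\<xi> * y)) = (f (y - \<eta>) - f y) + 2 * (indicator {..\<eta>} y * f y)" .
  qed
  also have "\<dots> = (\<integral>y. f (y - \<eta>) - f y \<partial>lborel) + 2 * (\<integral>y. indicator {..\<eta>} y * f y \<partial>lborel)"
    using f(1) fs integrable_real_mult_indicator[OF _ f(1), of "{..\<eta>}"]
    by (subst Bochner_Integration.integral_add) (auto simp: mult.commute)
  also have "(\<integral>y. f (y - \<eta>) - f y \<partial>lborel) = 0"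
    using fs f(1) integral_shift[of f "- \<eta>"] by simp
  finally show ?thesis by (simp add: \<eta>_def)
qed

section \<open>Power decay of the transforms and moments of the kernels\<close>

lemma ekern_alt: "0 < y \<Longrightarrow> ekern a c y = (1 - exp (- y)) powr (a - 1) * exp (- (c * y))"
proof -
  assume y: "0 < y"
  have "exp y - 1 = exp y * (1 - exp (- y))" by (simp add: right_diff_distrib flip: exp_add)
  then have "(exp y - 1) powr (a - 1) = exp (y * (a - 1)) * (1 - exp (- y)) powr (a - 1)"
    using y by (simp add: powr_mult exp_powr_real)
  moreover have "exp (y * (a - 1)) * exp (- ((c + a - 1) * y)) = exp (- (c * y))"
    by (simp add: algebra_simps flip: exp_add)
  ultimately show ?thesis using y by (simp add: ekern_def mult_ac)
qed

lemma ekern_decreasing: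
  assumes "a \<le> 1" "0 < c" "0 < x" "x \<le> y"
  shows "ekern a c y \<le> ekern a c x"
proof -
  have "(1 - exp (- y)) powr (a - 1) \<le> (1 - exp (- x)) powr (a - 1)"
    using assms by (intro powr_mono2') auto
  moreover have "exp (- (c * y)) \<le> exp (- (c * x))" using assms by simp
  ultimately show ?thesis using assms by (auto simp: ekern_alt intro!: mult_mono)
qed

text \<open>The inequality 1 - exp(-y) >= y exp(-y) compares the kernel with y^(a-1). The bound
  \<eta> <= pi is the half period for |\<xi>| >= 1 and produces the constant exp(pi).\<close>

lemma ekern_small_mass:
  assumes "0 < a" "a \<le> 1" "0 < c" "0 < \<eta>" "\<eta> \<le> pi"
  shows "(\<integral>y. indicator {..\<eta>} y * ekern a c y \<partial>lborel) \<le> exp pi / a * \<eta> powr a"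
proof -
  have le: "ekern a c y \<le> exp pi * y powr (a - 1)" if "0 < y" "y \<le> \<eta>" for y
  proof -
    have "y * exp (- y) \<le> 1 - exp (- y)"
    proof -
      have "1 + y \<le> exp y" by (rule exp_ge_add_one_self)
      then have "exp (- y) * (1 + y) \<le> exp (- y) * exp y" by (intro mult_left_mono) auto
      then show ?thesis by (simp add: algebra_simps flip: exp_add)
    qed
    then have "(1 - exp (- y)) powr (a - 1) \<le> (y * exp (- y)) powr (a - 1)"
      using assms that by (intro powr_mono2') auto
    also have "\<dots> = y powr (a - 1) * exp (y * (1 - a))"
      using that by (simp add: powr_mult exp_powr_real algebra_simps)
    also have "\<dots> \<le> y powr (a - 1) * exp pi"
    proof (intro mult_left_mono)
      have "y * (1 - a) \<le> y * 1" using assms that by (intro mult_left_mono) auto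
      also have "\<dots> \<le> pi" using assms that by simp
      finally show "exp (y * (1 - a)) \<le> exp pi" by simp
    qed auto
    finally have 1: "(1 - exp (- y)) powr (a - 1) \<le> y powr (a - 1) * exp pi" .
    have "(1 - exp (- y)) powr (a - 1) * exp (- (c * y)) \<le> y powr (a - 1) * exp pi * 1"
      using assms that by (intro mult_mono 1) auto
    then show ?thesis using that by (simp add: ekern_alt mult.commute)
  qed
  have h: "((\<lambda>y. y powr (a - 1)) has_integral (\<eta> powr a / a)) {0..\<eta>}"
    using has_integral_powr_from_0[of "a - 1" \<eta>] assms by simp
  let ?g = "\<lambda>y. indicator {0..\<eta>} y * y powr (a - 1)"
  have "((\<lambda>y. if y \<in> {0..\<eta>} then y powr (a - 1) else 0) has_integral (\<eta> powr a / a)) UNIV"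
    using h by (simp only: has_integral_restrict_UNIV)
  then have "(?g has_integral (\<eta> powr a / a)) UNIV"
    by (rule back_subst[of "\<lambda>f. (f has_integral (\<eta> powr a / a)) UNIV"]) (auto simp: indicator_def)
  then have nn: "(\<integral>\<^sup>+y. ennreal (?g y) \<partial>lborel) = ennreal (\<eta> powr a / a)"
    by (intro nn_integral_has_integral_lborel) auto
  have gi: "integrable lborel ?g"
    by (rule integrableI_bounded) (auto simp: nn)
  have gv: "(\<integral>y. ?g y \<partial>lborel) = \<eta> powr a / a"
    using assms by (subst integral_eq_nn_integral) (auto simp: nn)
  have "(\<integral>y. indicator {..\<eta>} y * ekern a c y \<partial>lborel) \<le> (\<integral>y. exp pi * ?g y \<partial>lborel)"
  proof (rule integral_mono)
    show "integrable lborel (\<lambda>y. indicator {..\<eta>} y * ekern a c y)"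
      using integrable_real_mult_indicator[OF _ ekern_integrable(1)[OF assms(1,3)], of "{..\<eta>}"] by (simp add: mult.commute)
    show "integrable lborel (\<lambda>y. exp pi * ?g y)" using gi by simp
    fix y :: real
    show "indicator {..\<eta>} y * ekern a c y \<le> exp pi * ?g y"
      using le[of y] by (cases "0 < y \<and> y \<le> \<eta>") (auto simp: ekern_def split: split_indicator)
  qed
  then show ?thesis using gv by simp
qed

text \<open>For a <= 1 the kernel is decreasing on the positive axis, and its mass on a half period
  is O(|\<xi>|^(-a)). For a > 1 monotonicity fails near 0; the semigroup law then splits off a
  factor of order 1, whose transform is O(1/|\<xi>|), while the other factor has a bounded
  transform.\<close>

lemma ftrans_ekern_decay:
  assumes a: "0 < a" and c: "0 < c"
  obtains M :: nat and C :: real where "\<And>\<xi>. norm (ftrans (\<lambda>y. cekern a c (- y)) \<xi>) ^ M \<le> C / (1 + \<xi>\<^sup>2)"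
proof -
  have refl: "ftrans (\<lambda>y. cekern a c (- y)) \<xi> = ftrans (cekern a c) (- \<xi>)" for a c \<xi>
    unfolding ftrans_def using integral_reflect[of "\<lambda>y. cekern a c y * iexp (- \<xi> * y)" 0] by simp
  have small: "norm (ftrans (cekern a c) \<xi>) \<le> (exp pi / a * pi powr a) * \<bar>\<xi>\<bar> powr (- a)"
    if "0 < a" "a \<le> 1" "0 < c" "1 \<le> \<bar>\<xi>\<bar>" for a c \<xi>
  proof -
    have "norm (ftrans (cekern a c) \<xi>) \<le> (\<integral>y. indicator {..pi / \<bar>\<xi>\<bar>} y * ekern a c y \<partial>lborel)"
      using that by (intro norm_ftrans_decreasing_le ekern_integrable ekern_decreasing) (auto simp: ekern_def)
    also have "\<dots> \<le> exp pi / a * (pi / \<bar>\<xi>\<bar>) powr a"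
      using that by (intro ekern_small_mass) (auto simp: field_simps)
    also have "\<dots> = (exp pi / a * pi powr a) * \<bar>\<xi>\<bar> powr (- a)"
      by (simp add: powr_divide powr_minus_divide)
    finally show ?thesis .
  qed
  have "\<exists>b D. 0 < b \<and> 0 \<le> D \<and> (\<forall>\<xi>. 1 \<le> \<bar>\<xi>\<bar> \<longrightarrow> norm (ftrans (cekern a c) \<xi>) \<le> D * \<bar>\<xi>\<bar> powr (- b))"
  proof (cases "a \<le> 1")
    case True
    then show ?thesis using small[OF a True c] a by (intro exI[of _ a] exI[of _ "exp pi / a * pi powr a"]) auto
  next
    case False
    then have a1: "0 < a - 1" by simp
    define B where "B = Beta 1 (a - 1)"
    have B: "B > 0" using a1 Gamma_real_pos[of 1] Gamma_real_pos[of "a - 1"] Gamma_real_pos[of a] a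
      by (simp add: B_def Beta_def)
    define m where "m = (\<integral>y. norm (cekern (a - 1) (c + 1) y) \<partial>lborel)"
    have cv: "conv (cekern 1 c) (cekern (a - 1) (c + 1)) = (\<lambda>x. of_real B * cekern a c x)"
      using conv_ekern[OF zero_less_one a1, of c] by (auto simp: fun_eq_iff B_def)
    have "norm (ftrans (cekern a c) \<xi>) \<le> (exp pi / 1 * pi powr 1) * m / B * \<bar>\<xi>\<bar> powr (- 1)" if "1 \<le> \<bar>\<xi>\<bar>" for \<xi>
    proof -
      have "of_real B * ftrans (cekern a c) \<xi> = ftrans (\<lambda>x. of_real B * cekern a c x) \<xi>"
        unfolding ftrans_def by (simp add: mult.assoc)
      also have "\<dots> = ftrans (cekern 1 c) \<xi> * ftrans (cekern (a - 1) (c + 1)) \<xi>"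
        unfolding cv[symmetric] using a1 c by (intro ftrans_conv cekern_integrable) auto
      finally have "B * norm (ftrans (cekern a c) \<xi>) = norm (ftrans (cekern 1 c) \<xi>) * norm (ftrans (cekern (a - 1) (c + 1)) \<xi>)"
        using B by (metis abs_of_pos norm_mult norm_of_real)
      also have "\<dots> \<le> ((exp pi / 1 * pi powr 1) * \<bar>\<xi>\<bar> powr (- 1)) * m"
        unfolding m_def using that c a1 by (intro mult_mono small norm_ftrans_le cekern_integrable) auto
      finally have "norm (ftrans (cekern a c) \<xi>) * B \<le> ((exp pi / 1 * pi powr 1) * \<bar>\<xi>\<bar> powr (- 1)) * m"
        by (simp only: mult.commute[of B])
      then have "norm (ftrans (cekern a c) \<xi>) \<le> ((exp pi / 1 * pi powr 1) * \<bar>\<xi>\<bar> powr (- 1)) * m / B"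
        using B by (simp only: pos_le_divide_eq)
      then show ?thesis by (simp only: divide_inverse mult_ac)
    qed
    moreover have "0 \<le> (exp pi / 1 * pi powr 1) * m / B" using B by (simp add: m_def)
    ultimately show ?thesis by (intro exI[of _ 1] exI[of _ "(exp pi / 1 * pi powr 1) * m / B"]) auto
  qed
  then obtain b D where b: "0 < b" "0 \<le> D" and D: "\<And>\<xi>. 1 \<le> \<bar>\<xi>\<bar> \<Longrightarrow> norm (ftrans (cekern a c) \<xi>) \<le> D * \<bar>\<xi>\<bar> powr (- b)"
    by blast
  \<comment> \<open>Chosen so that bM > 2, whence the M-th power decays at least like \<xi>^(-2).
    Small \<xi> are covered by the trivial bound with the L^1 norm \<open>m\<close>.\<close>
  obtain M :: nat where M: "2 / b < real M" using reals_Archimedean2 by blast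
  define m where "m = (\<integral>y. norm (cekern a c y) \<partial>lborel)"
  have m0: "0 \<le> m" by (simp add: m_def)
  have "norm (ftrans (cekern a c) \<xi>) ^ M \<le> 2 * (m ^ M + D ^ M) / (1 + \<xi>\<^sup>2)" for \<xi>
  proof (cases "1 \<le> \<bar>\<xi>\<bar>")
    case True
    have "norm (ftrans (cekern a c) \<xi>) ^ M \<le> (D * \<bar>\<xi>\<bar> powr (- b)) ^ M"
      using D[OF True] by (intro power_mono) auto
    also have "\<dots> = D ^ M * \<bar>\<xi>\<bar> powr (- (b * real M))"
      using True by (simp add: power_mult_distrib powr_realpow[symmetric] powr_powr del: powr_realpow)
    also have "\<dots> \<le> D ^ M * \<bar>\<xi>\<bar> powr (- 2)"
      using True M b by (intro mult_left_mono powr_mono) (auto simp: field_simps)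
    also have "\<bar>\<xi>\<bar> powr (- 2) = 1 / \<xi>\<^sup>2" using True by (auto simp: powr_minus powr_numeral divide_inverse)
    also have "D ^ M * (1 / \<xi>\<^sup>2) \<le> (m ^ M + D ^ M) * (2 / (1 + \<xi>\<^sup>2))"
    proof (intro mult_mono)
      have "1 \<le> \<xi>\<^sup>2" using True by (metis one_power2 power2_abs power_mono zero_le_one)
      then have "2 / (2 * \<xi>\<^sup>2) \<le> 2 / (1 + \<xi>\<^sup>2)"
        by (intro divide_left_mono) (auto intro!: mult_pos_pos add_pos_nonneg)
      then show "1 / \<xi>\<^sup>2 \<le> 2 / (1 + \<xi>\<^sup>2)" by simp
    qed (use m0 b in auto)
    finally show ?thesis by (simp add: algebra_simps)
  next
    case False
    then have "\<xi>\<^sup>2 < 1" by (simp add: abs_square_less_1)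
    then have "1 \<le> 2 / (1 + \<xi>\<^sup>2)" by (simp add: field_simps add_pos_nonneg)
    moreover have "norm (ftrans (cekern a c) \<xi>) ^ M \<le> m ^ M"
      unfolding m_def by (intro power_mono norm_ftrans_le cekern_integrable a c) auto
    ultimately have "norm (ftrans (cekern a c) \<xi>) ^ M * 1 \<le> (m ^ M + D ^ M) * (2 / (1 + \<xi>\<^sup>2))"
      using m0 b by (intro mult_mono) (auto intro: add_increasing2)
    then show ?thesis by (simp add: algebra_simps)
  qed
  from this[of "- \<xi>" for \<xi>] show thesis
    by (intro that[of M "2 * (m ^ M + D ^ M)"]) (simp add: refl)
qed

text \<open>Half of the exponential decay pays for y^2: with u = c|y|/2 one has u^2/2 <= exp(u),
  that is y^2 <= (8/c^2) exp(u), and the kernel with c/2 in place of c remains.\<close>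

lemma ekern_square_moment:
  assumes a: "0 < a" and c: "0 < c"
  shows "integrable lborel (\<lambda>y. y\<^sup>2 * ekern a c (- y))"
proof (rule Bochner_Integration.integrable_bound)
  show "integrable lborel (\<lambda>y. 8 / c\<^sup>2 * ekern a (c / 2) (- y))"
    using ekern_integrable(2)[of a "c / 2"] a c by simp
  show "AE y in lborel. norm (y\<^sup>2 * ekern a c (- y)) \<le> norm (8 / c\<^sup>2 * ekern a (c / 2) (- y))"
  proof (rule AE_I2)
    fix y :: real
    show "norm (y\<^sup>2 * ekern a c (- y)) \<le> norm (8 / c\<^sup>2 * ekern a (c / 2) (- y))"
    proof (cases "y < 0")
      case True
      define u where "u = - (c * y) / 2"
      have u: "0 \<le> u" using True c by (simp add: u_def mult_nonneg_nonpos)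
      have "u\<^sup>2 / 2 \<le> exp u" using exp_lower_Taylor_quadratic[OF u] u by simp
      moreover have "u\<^sup>2 = c\<^sup>2 * y\<^sup>2 / 4" by (simp add: u_def power_mult_distrib power_divide)
      ultimately have y2: "y\<^sup>2 \<le> 8 / c\<^sup>2 * exp u" using c by (simp add: field_simps)
      have e: "exp (c * y) * exp u = exp (c / 2 * y)" by (simp add: u_def flip: exp_add)
      have "y\<^sup>2 * ekern a c (- y) = (1 - exp y) powr (a - 1) * exp (c * y) * y\<^sup>2"
        using True by (simp add: ekern_alt)
      also have "\<dots> \<le> (1 - exp y) powr (a - 1) * exp (c * y) * (8 / c\<^sup>2 * exp u)"
        by (intro mult_left_mono y2) auto
      also have "\<dots> = 8 / c\<^sup>2 * ((1 - exp y) powr (a - 1) * (exp (c * y) * exp u))" by simp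
      also have "\<dots> = 8 / c\<^sup>2 * ekern a (c / 2) (- y)" unfolding e using True by (simp add: ekern_alt)
      finally show ?thesis by simp
    qed (simp add: ekern_def)
  qed
qed measurable

lemma ekern_exponential_moment:
  assumes a: "0 < a" and c: "0 < c"
  shows "integrable lborel (\<lambda>y. exp (c / 2 * \<bar>y\<bar>) * ekern a c (- y))"
proof -
  have "exp (c / 2 * \<bar>y\<bar>) * ekern a c (- y) = ekern a (c / 2) (- y)" for y
  proof (cases "y < 0")
    case True
    have "exp (c / 2 * \<bar>y\<bar>) * exp (c * y) = exp (c / 2 * y)" using True by (simp flip: exp_add)
    then show ?thesis using True by (simp add: ekern_alt mult.left_commute)
  qed (simp add: ekern_def)
  then show ?thesis using ekern_integrable(2)[of a "c / 2"] a c by simp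
qed

section \<open>Approximate eigenvectors\<close>

lemma integrable_exp_abs:
  assumes "0 < (d::real)"
  shows "integrable lborel (\<lambda>x. exp (- (d * \<bar>x\<bar>)))"
proof -
  have "integrable lborel (\<lambda>x. complex_of_real (exp (- (d * \<bar>x\<bar>))))"
  proof (rule integrable_decay)
    show "norm (complex_of_real (exp (- (d * \<bar>x\<bar>)))) \<le> (1 + 2 / d\<^sup>2) / (1 + x\<^sup>2)" for x
    proof -
      define u where "u = d * \<bar>x\<bar>"
      have u: "0 \<le> u" using assms by (simp add: u_def)
      have "1 + u\<^sup>2 / 2 \<le> exp u" using exp_lower_Taylor_quadratic[OF u] u by simp
      then have "(1 + 2 / d\<^sup>2) * (1 + u\<^sup>2 / 2) \<le> (1 + 2 / d\<^sup>2) * exp u" by (intro mult_left_mono) auto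
      moreover have "1 + x\<^sup>2 \<le> (1 + 2 / d\<^sup>2) * (1 + u\<^sup>2 / 2)"
        using assms by (simp add: u_def power_mult_distrib field_simps)
      ultimately have "1 + x\<^sup>2 \<le> (1 + 2 / d\<^sup>2) * exp u" by linarith
      then have "exp (- u) * (1 + x\<^sup>2) \<le> exp (- u) * ((1 + 2 / d\<^sup>2) * exp u)" by (intro mult_left_mono) auto
      also have "\<dots> = 1 + 2 / d\<^sup>2" by (simp add: exp_minus)
      finally show ?thesis by (simp add: u_def pos_le_divide_eq add_pos_nonneg)
    qed
  qed measurable
  then show ?thesis by (simp only: complex_of_real_integrable_eq)
qed

lemma Lp_exp_abs:
  assumes p: "1 < p" and D: "0 < D"
  shows "Lp p (\<lambda>x. complex_of_real (exp (- (D * \<bar>x\<bar>))))"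
  unfolding Lp_def
proof
  show "integrable lborel (\<lambda>x. norm (complex_of_real (exp (- (D * \<bar>x\<bar>)))) powr p)"
  proof (rule Bochner_Integration.integrable_bound[OF integrable_exp_abs[OF D]])
    have "exp (- (D * \<bar>x\<bar>)) powr p \<le> exp (- (D * \<bar>x\<bar>)) powr 1" for x
      using D p by (intro powr_mono') auto
    then show "AE x in lborel. norm (norm (complex_of_real (exp (- (D * \<bar>x\<bar>)))) powr p) \<le> norm (exp (- (D * \<bar>x\<bar>)))"
      by simp
  qed measurable
qed measurable

text \<open>The envelope E(x) = exp(-D|x|) changes by at most a factor exp(D|y|) in either direction
  under a shift by y. The error is therefore bounded pointwise by E(x) times the integral of k(y)
  (exp(D|y|) - 1), which tends to 0 with D by the exponential moment. A pointwise bound by a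
  multiple of |F| gives the norm bound directly.\<close>

lemma approximate_eigenvector:
  fixes k :: "real \<Rightarrow> real"
  assumes p: "1 < p" and k: "integrable lborel k" "\<And>y. 0 \<le> k y"
    and d: "0 < d" and kd: "integrable lborel (\<lambda>y. exp (d * \<bar>y\<bar>) * k y)" and e: "0 < \<epsilon>"
  obtains F where "Lp p F" "0 < Lp_norm p F"
    "Lp_norm p (\<lambda>x. ftrans (\<lambda>y. of_real (k y)) \<xi> * F x - corr (\<lambda>y. of_real (k y)) F x) \<le> \<epsilon> * Lp_norm p F"
proof -
  have [measurable]: "k \<in> borel_measurable borel" using k by auto
  define dl where "dl n = d / real (Suc n)" for n
  have dl: "0 < dl n" "dl n \<le> d" for n using d by (auto simp: dl_def field_simps)
  have lim: "(\<lambda>n. \<integral>y. k y * (exp (dl n * \<bar>y\<bar>) - 1) \<partial>lborel) \<longlonglongrightarrow> (\<integral>y. k y * (exp (0 * \<bar>y\<bar>) - 1) \<partial>lborel)"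
  proof (rule integral_dominated_convergence[OF _ _ kd])
    have "dl \<longlonglongrightarrow> 0"
      unfolding dl_def using LIMSEQ_inverse_real_of_nat tendsto_mult_right_zero[of "\<lambda>n. inverse (real (Suc n))" sequentially d]
      by (simp add: divide_inverse)
    then show "AE y in lborel. (\<lambda>n. k y * (exp (dl n * \<bar>y\<bar>) - 1)) \<longlonglongrightarrow> k y * (exp (0 * \<bar>y\<bar>) - 1)"
      by (intro AE_I2 tendsto_intros)
    show "AE y in lborel. norm (k y * (exp (dl n * \<bar>y\<bar>) - 1)) \<le> exp (d * \<bar>y\<bar>) * k y" for n
    proof (rule AE_I2)
      fix y :: real
      have "1 \<le> exp (dl n * \<bar>y\<bar>)" using dl[of n] by simp
      moreover have "exp (dl n * \<bar>y\<bar>) \<le> exp (d * \<bar>y\<bar>)" using dl[of n] by (simp add: mult_right_mono)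
      ultimately have "\<bar>exp (dl n * \<bar>y\<bar>) - 1\<bar> \<le> exp (d * \<bar>y\<bar>)" by linarith
      then have "k y * \<bar>exp (dl n * \<bar>y\<bar>) - 1\<bar> \<le> k y * exp (d * \<bar>y\<bar>)" using k(2) by (rule mult_left_mono)
      then show "norm (k y * (exp (dl n * \<bar>y\<bar>) - 1)) \<le> exp (d * \<bar>y\<bar>) * k y" using k(2)[of y] by (simp add: abs_mult mult.commute)
    qed
  qed measurable
  have "\<forall>\<^sub>F n in sequentially. (\<integral>y. k y * (exp (dl n * \<bar>y\<bar>) - 1) \<partial>lborel) < \<epsilon>"
    using lim e by (intro order_tendstoD(2)) auto
  then obtain n where n: "(\<integral>y. k y * (exp (dl n * \<bar>y\<bar>) - 1) \<partial>lborel) < \<epsilon>"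
    by (auto dest: eventually_happens)
  define D where "D = dl n"
  have D: "0 < D" "D \<le> d" using dl by (auto simp: D_def)
  have ikD: "integrable lborel (\<lambda>y. k y * (exp (D * \<bar>y\<bar>) - 1))"
  proof (rule Bochner_Integration.integrable_bound[OF kd])
    show "AE y in lborel. norm (k y * (exp (D * \<bar>y\<bar>) - 1)) \<le> norm (exp (d * \<bar>y\<bar>) * k y)"
    proof (rule AE_I2)
      fix y :: real
      have "1 \<le> exp (D * \<bar>y\<bar>)" using D by simp
      moreover have "exp (D * \<bar>y\<bar>) \<le> exp (d * \<bar>y\<bar>)" using D by (simp add: mult_right_mono)
      ultimately have "\<bar>exp (D * \<bar>y\<bar>) - 1\<bar> \<le> exp (d * \<bar>y\<bar>)" by linarith
      then have "k y * \<bar>exp (D * \<bar>y\<bar>) - 1\<bar> \<le> k y * exp (d * \<bar>y\<bar>)" using k(2) by (rule mult_left_mono)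
      then show "norm (k y * (exp (D * \<bar>y\<bar>) - 1)) \<le> norm (exp (d * \<bar>y\<bar>) * k y)" using k(2)[of y] by (simp add: abs_mult mult.commute)
    qed
  qed measurable
  define E where "E x = exp (- (D * \<bar>x\<bar>))" for x
  have E: "0 < E x" "E x \<le> 1" for x using D by (auto simp: E_def)
  define F where "F x = of_real (E x) * iexp (\<xi> * x)" for x
  have [measurable]: "E \<in> borel_measurable borel" unfolding E_def by measurable
  have [measurable]: "F \<in> borel_measurable borel" unfolding F_def by measurable
  have nF: "norm (F x) = E x" for x using E[of x] by (simp add: F_def norm_mult)
  have LF: "Lp p F"
    by (rule Lp_bound(1)[OF Lp_exp_abs[OF p D(1)] p, of _ 1]) (auto simp: nF E_def)
  have F0: "0 < Lp_norm p F"
  proof (rule ccontr)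
    assume "\<not> 0 < Lp_norm p F"
    then have "AE x in lborel. F x = 0" using Lp_norm_eq_0_iff[OF LF p] Lp_norm_nonneg[of p F] by linarith
    then have "AE x::real in lborel. False" using E by (auto simp: nF[symmetric] elim!: eventually_mono)
    then show False using AE_exists_in_interval[of "\<lambda>_. False" 0 1] by auto
  qed
  let ?kc = "\<lambda>y. complex_of_real (k y)"
  have kc: "integrable lborel ?kc" using k by simp
  have ptw: "norm (ftrans ?kc \<xi> * F x - corr ?kc F x) \<le> \<epsilon> * norm (F x)" for x
  proof -
    have i1: "integrable lborel (\<lambda>y. ?kc y * iexp (\<xi> * y) * F x)"
      by (intro integrable_mult_left integrable_mult_iexp kc) auto
    have i2: "integrable lborel (\<lambda>y. ?kc y * F (x + y))"
      by (rule Bochner_Integration.integrable_bound[OF kc]) (auto simp: norm_mult nF E intro!: mult_left_le)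
    have "ftrans ?kc \<xi> * F x - corr ?kc F x = (\<integral>y. ?kc y * iexp (\<xi> * y) * F x - ?kc y * F (x + y) \<partial>lborel)"
      unfolding ftrans_def corr_def integral_mult_left_zero[symmetric]
      by (rule Bochner_Integration.integral_diff[symmetric, OF i1 i2])
    also have "norm \<dots> \<le> (\<integral>y. norm (?kc y * iexp (\<xi> * y) * F x - ?kc y * F (x + y)) \<partial>lborel)"
      by (rule integral_norm_bound)
    also have "\<dots> \<le> (\<integral>y. k y * (exp (D * \<bar>y\<bar>) - 1) * E x \<partial>lborel)"
    proof (rule integral_mono)
      show "integrable lborel (\<lambda>y. norm (?kc y * iexp (\<xi> * y) * F x - ?kc y * F (x + y)))"
        by (intro integrable_norm Bochner_Integration.integrable_diff i1 i2)
      show "integrable lborel (\<lambda>y. k y * (exp (D * \<bar>y\<bar>) - 1) * E x)" using ikD by (rule integrable_mult_left)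
      fix y
      have "?kc y * iexp (\<xi> * y) * F x - ?kc y * F (x + y) = of_real (k y * (E x - E (x + y))) * iexp (\<xi> * (x + y))"
        by (simp add: F_def algebra_simps exp_add)
      then have 1: "norm (?kc y * iexp (\<xi> * y) * F x - ?kc y * F (x + y)) = k y * \<bar>E x - E (x + y)\<bar>"
        using k(2)[of y] by (simp only: norm_mult norm_of_real norm_exp_i_times) (simp add: abs_mult)
      have up: "E (x + y) \<le> E x * exp (D * \<bar>y\<bar>)"
      proof -
        have "D * (\<bar>x\<bar> - \<bar>y\<bar>) \<le> D * \<bar>x + y\<bar>" using D by (intro mult_left_mono) auto
        then show ?thesis by (simp add: E_def algebra_simps flip: exp_add)
      qed
      have lo: "E x \<le> E (x + y) * exp (D * \<bar>y\<bar>)"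
      proof -
        have "D * (\<bar>x + y\<bar> - \<bar>y\<bar>) \<le> D * \<bar>x\<bar>" using D by (intro mult_left_mono) auto
        then show ?thesis by (simp add: E_def algebra_simps flip: exp_add)
      qed
      have g1: "1 \<le> exp (D * \<bar>y\<bar>)" using D by simp
      have "E x - E (x + y) \<le> (exp (D * \<bar>y\<bar>) - 1) * E x"
      proof (cases "E (x + y) \<le> E x")
        case True
        then have "E (x + y) * (exp (D * \<bar>y\<bar>) - 1) \<le> E x * (exp (D * \<bar>y\<bar>) - 1)" using g1 by (intro mult_right_mono) auto
        then show ?thesis using lo by (simp add: algebra_simps)
      next
        case False
        then have "E x - E (x + y) \<le> 0" by simp
        also have "0 \<le> (exp (D * \<bar>y\<bar>) - 1) * E x" using g1 E[of x] by simp
        finally show ?thesis .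
      qed
      then have "\<bar>E x - E (x + y)\<bar> \<le> (exp (D * \<bar>y\<bar>) - 1) * E x" using up by (simp add: algebra_simps abs_le_iff)
      then have "k y * \<bar>E x - E (x + y)\<bar> \<le> k y * ((exp (D * \<bar>y\<bar>) - 1) * E x)" using k(2) by (rule mult_left_mono)
      then show "norm (?kc y * iexp (\<xi> * y) * F x - ?kc y * F (x + y)) \<le> k y * (exp (D * \<bar>y\<bar>) - 1) * E x"
        unfolding 1 by (simp only: mult.assoc)
    qed
    also have "\<dots> = (\<integral>y. k y * (exp (D * \<bar>y\<bar>) - 1) \<partial>lborel) * E x" by simp
    also have "\<dots> \<le> \<epsilon> * norm (F x)" using n E[of x] by (auto simp: nF D_def intro!: mult_right_mono)
    finally show ?thesis .
  qed
  have "Lp_norm p (\<lambda>x. ftrans ?kc \<xi> * F x - corr ?kc F x) \<le> \<epsilon> * Lp_norm p F"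
    by (rule Lp_bound(2)[OF LF p]) (use e ptw in auto)
  with LF F0 show thesis by (rule that)
qed

section \<open>The generalized Cesaro operator\<close>

text \<open>\<open>psi p\<close> carries \<open>L\<^sup>p(0,\<infinity>)\<close> isometrically onto \<open>L\<^sup>p(\<real>)\<close>.\<close>

definition psi :: "real \<Rightarrow> (real \<Rightarrow> complex) \<Rightarrow> real \<Rightarrow> complex" where
  "psi p f x = of_real (exp (x / p)) * f (exp x)"

lemma psi_measurable:
  assumes "set_borel_measurable lborel {0<..} f"
  shows "psi p f \<in> borel_measurable borel"
proof -
  have [measurable]: "(\<lambda>t. indicator {0<..} t *\<^sub>R f t) \<in> borel_measurable borel"
    using assms by (simp add: set_borel_measurable_def)
  have "psi p f = (\<lambda>x. of_real (exp (x / p)) * ((\<lambda>t. indicator {0<..} t *\<^sub>R f t) (exp x)))"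
    by (auto simp: psi_def fun_eq_iff)
  also have "\<dots> \<in> borel_measurable borel"
    by (intro borel_measurable_times measurable_compose[OF borel_measurable_exp]) measurable
  finally show ?thesis .
qed

lemma set_borel_measurable_if_psi:
  assumes [measurable]: "psi p f \<in> borel_measurable borel"
  shows "set_borel_measurable lborel {0<..} f"
proof -
  have e: "(\<lambda>t. indicator {0<..} t *\<^sub>R f t) = (\<lambda>t. indicator {0<..} t *\<^sub>R (of_real (exp (- (ln t / p))) * psi p f (ln t)))"
    by (auto simp: fun_eq_iff psi_def exp_minus split: split_indicator)
  show ?thesis unfolding set_borel_measurable_def e by measurable
qed

lemma lp_pow_eq_nn_integral_psi:
  assumes "set_borel_measurable lborel {0<..} f" and p: "1 < p"
  shows "lp_pow p f = (\<integral>\<^sup>+x. ennreal (norm (psi p f x) powr p) \<partial>lborel)"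
proof -
  define g where "g t = indicator {0<..} t *\<^sub>R f t" for t
  have [measurable]: "g \<in> borel_measurable borel"
    using assms(1) by (simp add: set_borel_measurable_def g_def[abs_def])
  have "lp_pow p f = (\<integral>\<^sup>+t. ennreal (norm (g t) powr p) * indicator {0<..} t \<partial>lborel)"
    unfolding lp_pow_def by (intro nn_integral_cong) (auto simp: g_def split: split_indicator)
  also have "\<dots> = (\<integral>\<^sup>+x. ennreal (exp x) * ennreal (norm (g (exp x)) powr p) \<partial>lborel)"
    by (rule nn_integral_exp_substitution) measurable
  also have "\<dots> = (\<integral>\<^sup>+x. ennreal (norm (psi p f x) powr p) \<partial>lborel)"
  proof (intro nn_integral_cong)
    fix x
    have "exp (x / p) powr p = exp x" using p by (simp add: exp_powr_real)
    then show "ennreal (exp x) * ennreal (norm (g (exp x)) powr p) = ennreal (norm (psi p f x) powr p)"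
      by (simp add: psi_def g_def norm_mult powr_mult ennreal_mult')
  qed
  finally show ?thesis .
qed

lemma in_Lp_iff:
  assumes p: "1 < p"
  shows "in_Lp p f \<longleftrightarrow> Lp p (psi p f)"
proof
  assume "in_Lp p f"
  then have m: "set_borel_measurable lborel {0<..} f" and "lp_pow p f < \<infinity>" by (auto simp: in_Lp_def)
  then have "(\<integral>\<^sup>+x. ennreal (norm (psi p f x) powr p) \<partial>lborel) < \<infinity>"
    by (simp add: lp_pow_eq_nn_integral_psi[OF m p])
  then show "Lp p (psi p f)"
    using psi_measurable[OF m, of p] by (auto simp: Lp_def intro!: integrableI_bounded)
next
  assume L: "Lp p (psi p f)"
  then have m: "set_borel_measurable lborel {0<..} f" by (intro set_borel_measurable_if_psi[of p]) (auto simp: Lp_def)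
  have "(\<integral>\<^sup>+x. ennreal (norm (psi p f x) powr p) \<partial>lborel) < \<infinity>"
    using L by (simp add: Lp_def nn_integral_eq_integral)
  then show "in_Lp p f" using m by (simp add: in_Lp_def lp_pow_eq_nn_integral_psi[OF m p])
qed

lemma lp_pow_eq:
  assumes L: "Lp p (psi p f)" and p: "1 < p"
  shows "lp_pow p f = ennreal (Lp_norm p (psi p f) powr p)"
proof -
  have m: "set_borel_measurable lborel {0<..} f" using L by (intro set_borel_measurable_if_psi[of p]) (auto simp: Lp_def)
  show ?thesis
    unfolding lp_pow_eq_nn_integral_psi[OF m p] Lp_norm_powr[OF p]
    using L by (intro nn_integral_eq_integral) (auto simp: Lp_def)
qed

lemma ae_eq_iff:
  assumes "set_borel_measurable lborel {0<..} f" "set_borel_measurable lborel {0<..} g"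
  shows "ae_eq f g \<longleftrightarrow> (AE x in lborel. psi p f x = psi p g x)"
proof -
  have [measurable]: "(\<lambda>t. indicator {0<..} t *\<^sub>R f t) \<in> borel_measurable borel" "(\<lambda>t. indicator {0<..} t *\<^sub>R g t) \<in> borel_measurable borel"
    using assms by (auto simp: set_borel_measurable_def)
  have "Measurable.pred borel (\<lambda>t. indicator {0<..} t *\<^sub>R f t = indicator {0<..} t *\<^sub>R g t)" by measurable
  also have "(\<lambda>t. indicator {0<..} t *\<^sub>R f t = indicator {0<..} t *\<^sub>R g t) = (\<lambda>t. 0 < t \<longrightarrow> f t = g t)"
    by (auto simp: fun_eq_iff split: split_indicator)
  finally have "ae_eq f g \<longleftrightarrow> (AE x in lborel. f (exp x) = g (exp x))"
    unfolding ae_eq_def by (rule AE_exp_iff)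
  also have "\<dots> \<longleftrightarrow> (AE x in lborel. psi p f x = psi p g x)" by (simp add: psi_def)
  finally show ?thesis .
qed

lemma psi_ln: "psi p (\<lambda>t. of_real (exp (- (ln t / p))) * F (ln t)) = F"
  by (auto simp: psi_def fun_eq_iff mult.assoc[symmetric] exp_minus)

text \<open>The reflection reflects that the Cesaro mean integrates over s < t. With s = exp(x + y),
  the rate 1 - 1/p combines the Jacobian exp(y) with the weight exp(-y/p) coming from
  \<open>psi\<close>.\<close>

definition cesaro_kernel :: "real \<Rightarrow> real \<Rightarrow> real \<Rightarrow> real" where
  "cesaro_kernel \<beta> p y = \<beta> * ekern \<beta> (1 - 1 / p) (- y)"

lemma cesaro_kernel_nonneg: "0 < \<beta> \<Longrightarrow> 0 \<le> cesaro_kernel \<beta> p y"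
  by (simp add: cesaro_kernel_def)

lemma cesaro_kernel_integrable: "0 < \<beta> \<Longrightarrow> 1 < p \<Longrightarrow> integrable lborel (cesaro_kernel \<beta> p)"
  unfolding cesaro_kernel_def[abs_def] using ekern_integrable(2)[of \<beta> "1 - 1 / p"] by simp

lemma psi_cesaro:
  assumes f: "set_borel_measurable lborel {0<..} f" and p: "1 < p"
  shows "psi p (cesaro \<beta> f) x = corr (\<lambda>y. of_real (cesaro_kernel \<beta> p y)) (psi p f) x"
proof -
  define g where "g t = indicator {0<..} t *\<^sub>R f t" for t
  have [measurable]: "g \<in> borel_measurable borel"
    using f by (simp add: set_borel_measurable_def g_def[abs_def])
  let ?h = "\<lambda>s. indicator {..<exp x} s *\<^sub>R (of_real ((exp x - s) powr (\<beta> - 1)) * g s)"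
  have "(LINT s:{0<..<exp x}|lborel. of_real ((exp x - s) powr (\<beta> - 1)) * f s) = (\<integral>s. indicator {0<..} s *\<^sub>R ?h s \<partial>lborel)"
    unfolding set_lebesgue_integral_def
    by (intro Bochner_Integration.integral_cong) (auto simp: g_def split: split_indicator)
  also have "\<dots> = (\<integral>u. exp u *\<^sub>R ?h (exp u) \<partial>lborel)"
    by (rule integral_exp_substitution) measurable
  also have "\<dots> = (\<integral>y. exp (y + x) *\<^sub>R ?h (exp (y + x)) \<partial>lborel)"
    using integral_shift[of "\<lambda>u. exp u *\<^sub>R ?h (exp u)" x] by simp
  finally have "psi p (cesaro \<beta> f) x = (\<integral>y. of_real (exp (x / p) * (\<beta> / exp x powr \<beta>)) * (exp (y + x) *\<^sub>R ?h (exp (y + x))) \<partial>lborel)"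
    unfolding psi_def cesaro_def by (simp only: integral_mult_right_zero of_real_mult mult.assoc)
  also have "\<dots> = corr (\<lambda>y. of_real (cesaro_kernel \<beta> p y)) (psi p f) x"
    unfolding corr_def
  proof (intro Bochner_Integration.integral_cong refl)
    fix y
    show "of_real (exp (x / p) * (\<beta> / exp x powr \<beta>)) * (exp (y + x) *\<^sub>R ?h (exp (y + x))) = of_real (cesaro_kernel \<beta> p y) * psi p f (x + y)"
    proof (cases "y < 0")
      case True
      have "exp x - exp (y + x) = exp x * (1 - exp y)" by (simp add: algebra_simps exp_add)
      then have 1: "(exp x - exp (y + x)) powr (\<beta> - 1) = exp (x * (\<beta> - 1)) * (1 - exp y) powr (\<beta> - 1)"
        using True by (simp add: powr_mult exp_powr_real)
      have 2: "\<beta> / exp x powr \<beta> = \<beta> * exp (- (x * \<beta>))" by (simp add: exp_powr_real exp_minus divide_inverse)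
      have 3: "exp (x / p) * (exp (- (x * \<beta>)) * (exp (y + x) * exp (x * (\<beta> - 1)))) = exp ((1 - 1 / p) * y) * exp ((x + y) / p)"
        using p by (simp add: field_simps flip: exp_add)
      have "exp (x / p) * (\<beta> / exp x powr \<beta>) * (exp (y + x) * (exp x - exp (y + x)) powr (\<beta> - 1))
          = \<beta> * (1 - exp y) powr (\<beta> - 1) * (exp (x / p) * (exp (- (x * \<beta>)) * (exp (y + x) * exp (x * (\<beta> - 1)))))"
        unfolding 1 2 by simp
      also have "\<dots> = cesaro_kernel \<beta> p y * exp ((x + y) / p)"
        unfolding 3 using True by (simp add: cesaro_kernel_def ekern_alt)
      finally have "complex_of_real (exp (x / p) * (\<beta> / exp x powr \<beta>) * (exp (y + x) * (exp x - exp (y + x)) powr (\<beta> - 1))) * f (exp (x + y))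
          = complex_of_real (cesaro_kernel \<beta> p y * exp ((x + y) / p)) * f (exp (x + y))" by (rule arg_cong)
      then show ?thesis using True by (simp add: g_def psi_def scaleR_conv_of_real mult.assoc add.commute)
    qed (simp add: cesaro_kernel_def ekern_def)
  qed
  finally show ?thesis .
qed

lemma ftrans_cesaro_kernel:
  assumes "0 < \<beta>" "1 < p"
  shows "ftrans (\<lambda>y. of_real (cesaro_kernel \<beta> p y)) \<xi> = of_real \<beta> * Beta (of_real \<beta>) (of_real (1 - 1 / p) + \<i> * of_real \<xi>)"
proof -
  have "ftrans (\<lambda>y. of_real (cesaro_kernel \<beta> p y)) \<xi> = of_real \<beta> * ftrans (\<lambda>y. cekern \<beta> (1 - 1 / p) (- y)) \<xi>"
    unfolding ftrans_def cesaro_kernel_def by (simp add: mult.assoc)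
  then show ?thesis using ftrans_ekern_reflected[of \<beta> "1 - 1 / p" \<xi>] assms by simp
qed

lemma cesaro_resolvent_kernel:
  assumes \<beta>: "0 < \<beta>" and p: "1 < p"
    and z: "z \<notin> closure (range (ftrans (\<lambda>y. of_real (cesaro_kernel \<beta> p y))))"
  obtains r where "z \<noteq> 0" "integrable lborel r"
    "AE x in lborel. z * r x = of_real (cesaro_kernel \<beta> p x) / z + conv (\<lambda>y. of_real (cesaro_kernel \<beta> p y)) r x"
proof -
  let ?q = "ftrans (\<lambda>y. of_real (cesaro_kernel \<beta> p y))"
  have c: "0 < 1 - 1 / p" using p by simp
  have q: "?q \<xi> = of_real \<beta> * ftrans (\<lambda>y. cekern \<beta> (1 - 1 / p) (- y)) \<xi>" for \<xi>
    unfolding ftrans_def cesaro_kernel_def by (simp add: mult.assoc)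
  obtain M C where MC: "\<And>\<xi>. norm (ftrans (\<lambda>y. cekern \<beta> (1 - 1 / p) (- y)) \<xi>) ^ M \<le> C / (1 + \<xi>\<^sup>2)"
    using ftrans_ekern_decay[OF \<beta> c] by blast
  have dec: "norm (?q \<xi>) ^ M \<le> \<beta> ^ M * C / (1 + \<xi>\<^sup>2)" for \<xi>
    using mult_left_mono[OF MC[of \<xi>], of "\<beta> ^ M"] \<beta> unfolding q by (simp add: norm_mult power_mult_distrib)
  have "\<exists>d>0. ball z d \<inter> range ?q = {}"
    using z by (auto simp: closure_approachable dist_commute disjoint_iff)
  then obtain d where d: "0 < d" "ball z d \<inter> range ?q = {}" by blast
  have dl: "d \<le> norm (z - ?q \<xi>)" for \<xi>
  proof (rule ccontr)
    assume "\<not> ?thesis"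
    then have "?q \<xi> \<in> ball z d" by (simp add: dist_norm)
    then show False using d(2) by blast
  qed
  \<comment> \<open>The transform tends to 0 at infinity, so 0 lies in the closure of its range.
    Concretely, z = 0 would bound (1 + \<xi>^2) d^M for all \<xi>, and the choice \<xi>^2 =
    |\<beta>^M C / d^M| violates this.\<close>
  have z0: "z \<noteq> 0"
  proof
    assume "z = 0"
    then have "d ^ M \<le> norm (?q \<xi>) ^ M" for \<xi> using dl[of \<xi>] d(1) by (intro power_mono) auto
    then have b: "d ^ M \<le> \<beta> ^ M * C / (1 + \<xi>\<^sup>2)" for \<xi> using dec order_trans by blast
    have "(1 + \<xi>\<^sup>2) * d ^ M \<le> \<beta> ^ M * C" for \<xi> :: real
      using b[of \<xi>] by (simp add: pos_le_divide_eq add_pos_nonneg mult.commute)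
    from this[of "sqrt (\<bar>\<beta> ^ M * C / d ^ M\<bar>)"]
    have "(1 + \<bar>\<beta> ^ M * C / d ^ M\<bar>) * d ^ M \<le> \<beta> ^ M * C" by simp
    moreover have "(1 + \<bar>\<beta> ^ M * C / d ^ M\<bar>) * d ^ M \<ge> d ^ M + \<beta> ^ M * C"
    proof -
      have "\<beta> ^ M * C / d ^ M * d ^ M \<le> \<bar>\<beta> ^ M * C / d ^ M\<bar> * d ^ M" using d(1) by (intro mult_right_mono abs_ge_self) simp
      then show ?thesis using d(1) by (simp add: distrib_right)
    qed
    ultimately show False using d(1) zero_less_power[of d M] by linarith
  qed
  have sq: "integrable lborel (\<lambda>y. y\<^sup>2 * cesaro_kernel \<beta> p y)"
    using integrable_mult_right[OF ekern_square_moment[OF \<beta> c], of \<beta>]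
    by (simp add: cesaro_kernel_def mult.left_commute)
  obtain r where "integrable lborel r"
    "AE x in lborel. z * r x = of_real (cesaro_kernel \<beta> p x) / z + conv (\<lambda>y. of_real (cesaro_kernel \<beta> p y)) r x"
    by (rule resolvent_kernel_exists[OF cesaro_kernel_integrable[OF \<beta> p] cesaro_kernel_nonneg[OF \<beta>] sq dec z0 d(1) dl])
  with z0 show thesis by (rule that)
qed

lemma cesaro_approximate_eigenvector:
  assumes \<beta>: "0 < \<beta>" and p: "1 < p"
    and z: "z \<in> closure (range (ftrans (\<lambda>y. of_real (cesaro_kernel \<beta> p y))))" and e: "0 < \<epsilon>"
  obtains F where "Lp p F" "0 < Lp_norm p F"
    "Lp_norm p (\<lambda>x. z * F x - corr (\<lambda>y. of_real (cesaro_kernel \<beta> p y)) F x) \<le> \<epsilon> * Lp_norm p F"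
proof -
  let ?k = "\<lambda>y. complex_of_real (cesaro_kernel \<beta> p y)"
  have c: "0 < 1 - 1 / p" using p by simp
  have ki: "integrable lborel ?k" using cesaro_kernel_integrable[OF \<beta> p] by simp
  \<comment> \<open>Half of the tolerance moves from z to a point on the curve, the other half goes
    to the approximate eigenvector for that point.\<close>
  obtain \<xi> where \<xi>: "norm (z - ftrans ?k \<xi>) < \<epsilon> / 2"
    using z e by (auto simp: closure_approachable dist_norm norm_minus_commute dest!: spec[of _ "\<epsilon> / 2"])
  have ke: "integrable lborel (\<lambda>y. exp ((1 - 1 / p) / 2 * \<bar>y\<bar>) * cesaro_kernel \<beta> p y)"
    using integrable_mult_right[OF ekern_exponential_moment[OF \<beta> c], of \<beta>]
    by (simp add: cesaro_kernel_def mult.left_commute)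
  obtain F where F: "Lp p F" "0 < Lp_norm p F" "Lp_norm p (\<lambda>x. ftrans ?k \<xi> * F x - corr ?k F x) \<le> \<epsilon> / 2 * Lp_norm p F"
    by (rule approximate_eigenvector[OF p cesaro_kernel_integrable[OF \<beta> p] cesaro_kernel_nonneg[OF \<beta>] _ ke, of "\<epsilon> / 2" \<xi>])
       (use c e in auto)
  have L1: "Lp p (\<lambda>x. (z - ftrans ?k \<xi>) * F x)" by (rule Lp_scale(1)[OF F(1) p])
  have L2: "Lp p (\<lambda>x. ftrans ?k \<xi> * F x - corr ?k F x)"
    by (intro Lp_diff(1)[OF _ _ p] Lp_scale(1)[OF _ p] Lp_corr(2)[OF p ki] F)
  have "Lp_norm p (\<lambda>x. z * F x - corr ?k F x) = Lp_norm p (\<lambda>x. (z - ftrans ?k \<xi>) * F x + (ftrans ?k \<xi> * F x - corr ?k F x))"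
    by (simp add: algebra_simps)
  also have "\<dots> \<le> Lp_norm p (\<lambda>x. (z - ftrans ?k \<xi>) * F x) + Lp_norm p (\<lambda>x. ftrans ?k \<xi> * F x - corr ?k F x)"
    by (rule Lp_add(2)[OF L1 L2 p])
  also have "\<dots> \<le> \<epsilon> / 2 * Lp_norm p F + \<epsilon> / 2 * Lp_norm p F"
    unfolding Lp_scale(2)[OF F(1) p] using \<xi> F by (intro add_mono mult_right_mono) auto
  finally show thesis using F(1,2) that by (simp add: algebra_simps)
qed

section \<open>Weyl fractional derivatives of Schwartz functions\<close>

text \<open>Keeps the whole family of derivatives explicit, with \<open>D 0\<close> the function
  itself, so that all orders can be used together without reference to one-sided derivatives at
  0.\<close>

definition schwartz_derivs :: "(nat \<Rightarrow> real \<Rightarrow> complex) \<Rightarrow> bool" where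
  "schwartz_derivs D \<longleftrightarrow>
      (\<forall>k t. t \<ge> 0 \<longrightarrow> (D k has_vector_derivative D (Suc k) t) (at t within {0..})) \<and>
      (\<forall>k m. \<exists>C. \<forall>t\<ge>0. t ^ m * norm (D k t) \<le> C)"

lemma schwartz_plus_iff: "f \<in> schwartz_plus \<longleftrightarrow> (\<exists>D. D 0 = f \<and> schwartz_derivs D)"
  by (simp add: schwartz_plus_def schwartz_derivs_def)

lemma schwartz_derivs_diff:
  assumes "schwartz_derivs D" "schwartz_derivs E"
  shows "schwartz_derivs (\<lambda>k t. D k t - E k t)"
  unfolding schwartz_derivs_def
proof (intro conjI allI impI)
  fix k :: nat and t :: real assume "t \<ge> 0"
  then show "((\<lambda>t. D k t - E k t) has_vector_derivative D (Suc k) t - E (Suc k) t) (at t within {0..})"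
    using assms by (intro has_vector_derivative_diff) (auto simp: schwartz_derivs_def)
next
  fix k m
  obtain A B where A: "\<And>t. t \<ge> 0 \<Longrightarrow> t ^ m * norm (D k t) \<le> A" and B: "\<And>t. t \<ge> 0 \<Longrightarrow> t ^ m * norm (E k t) \<le> B"
    using assms unfolding schwartz_derivs_def by metis
  have "t ^ m * norm (D k t - E k t) \<le> A + B" if t: "t \<ge> 0" for t
  proof -
    have "t ^ m * norm (D k t - E k t) \<le> t ^ m * (norm (D k t) + norm (E k t))"
      using t by (intro mult_left_mono norm_triangle_ineq4) auto
    also have "\<dots> \<le> A + B" using A[OF t] B[OF t] by (simp add: distrib_left)
    finally show ?thesis .
  qed
  then show "\<exists>C. \<forall>t\<ge>0. t ^ m * norm (D k t - E k t) \<le> C" by blast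
qed

lemma schwartz_plus_diff: "f \<in> schwartz_plus \<Longrightarrow> g \<in> schwartz_plus \<Longrightarrow> (\<lambda>t. f t - g t) \<in> schwartz_plus"
  unfolding schwartz_plus_iff using schwartz_derivs_diff by fastforce

context
  fixes D :: "nat \<Rightarrow> real \<Rightarrow> complex"
  assumes D: "schwartz_derivs D"
begin

lemma schwartz_derivs_deriv: "0 < t \<Longrightarrow> (D k has_vector_derivative D (Suc k) t) (at t)"
proof -
  assume t: "0 < t"
  have "(D k has_vector_derivative D (Suc k) t) (at t within {0..})" using D t by (auto simp: schwartz_derivs_def)
  moreover have "at t within {0..} = at t" using t by (intro at_within_interior) auto
  ultimately show ?thesis by simp
qed

lemma schwartz_derivs_isCont: "0 < t \<Longrightarrow> isCont (D k) t"
  using schwartz_derivs_deriv by (rule has_vector_derivative_continuous)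

lemma schwartz_derivs_measurable: "set_borel_measurable lborel {0<..} (D k)"
proof -
  have "continuous_on {0<..} (D k)"
    by (intro continuous_at_imp_continuous_on) (auto intro: schwartz_derivs_isCont)
  then show ?thesis
    unfolding set_borel_measurable_def by (simp add: borel_measurable_continuous_on_indicator)
qed

lemma schwartz_derivs_decay:
  obtains C where "0 \<le> C" "\<And>t. t \<ge> 0 \<Longrightarrow> norm (D k t) * (1 + t ^ m) \<le> C"
proof -
  obtain A B where A: "\<And>t. t \<ge> 0 \<Longrightarrow> t ^ 0 * norm (D k t) \<le> A" and B: "\<And>t. t \<ge> 0 \<Longrightarrow> t ^ m * norm (D k t) \<le> B"
    using D unfolding schwartz_derivs_def by metis
  have *: "norm (D k t) * (1 + t ^ m) \<le> A + B" if "t \<ge> 0" for t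
    using A[OF that] B[OF that] by (simp add: algebra_simps)
  have "0 \<le> A + B" using order_trans[OF _ *[of 0]] by auto
  then show thesis using * by (rule that)
qed

text \<open>The bound at t is expressed through any smaller s. Applied at t + s it gives a majorant
  in s that is uniform in t, as dominated differentiation requires.\<close>

lemma schwartz_derivs_square_decay:
  obtains C where "0 \<le> C" "\<And>t s. 0 \<le> s \<Longrightarrow> s \<le> t \<Longrightarrow> norm (D k t) \<le> C / (1 + s\<^sup>2)"
proof -
  obtain C where C: "0 \<le> C" "\<And>t. t \<ge> 0 \<Longrightarrow> norm (D k t) * (1 + t ^ 2) \<le> C"
    using schwartz_derivs_decay by blast
  have "norm (D k t) \<le> C / (1 + s\<^sup>2)" if "0 \<le> s" "s \<le> t" for t s
  proof -
    have "norm (D k t) * (1 + s\<^sup>2) \<le> norm (D k t) * (1 + t\<^sup>2)"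
      using that by (intro mult_left_mono add_left_mono power_mono) auto
    also have "\<dots> \<le> C" using C that by simp
    finally show ?thesis by (simp add: pos_le_divide_eq add_pos_nonneg)
  qed
  with C(1) show thesis by (rule that)
qed

lemma schwartz_derivs_integral:
  assumes t: "0 < t"
  shows "(\<integral>s. indicator {t<..} s *\<^sub>R D (Suc k) s \<partial>lborel) = - D k t"
proof -
  obtain C where C: "0 \<le> C" "\<And>t s. 0 \<le> s \<Longrightarrow> s \<le> t \<Longrightarrow> norm (D (Suc k) t) \<le> C / (1 + s\<^sup>2)"
    using schwartz_derivs_square_decay by blast
  obtain C' where C': "0 \<le> C'" "\<And>t s. 0 \<le> s \<Longrightarrow> s \<le> t \<Longrightarrow> norm (D k t) \<le> C' / (1 + s\<^sup>2)"
    using schwartz_derivs_square_decay by blast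
  have m: "(\<lambda>s. indicator {t<..} s *\<^sub>R D (Suc k) s) \<in> borel_measurable borel"
  proof -
    have "continuous_on {t<..} (D (Suc k))"
      using t by (intro continuous_at_imp_continuous_on) (auto intro: schwartz_derivs_isCont)
    then show ?thesis by (simp add: borel_measurable_continuous_on_indicator)
  qed
  have i: "integrable lborel (\<lambda>s. indicator {t<..} s *\<^sub>R D (Suc k) s)"
    by (rule integrable_decay[OF m, of C]) (use C t in \<open>auto split: split_indicator\<close>)
  have "(LBINT s=ereal t..\<infinity>. D (Suc k) s) = 0 - D k t"
  proof (rule interval_integral_FTC_integrable)
    show "(D k has_vector_derivative D (Suc k) s) (at s)" if "ereal t < ereal s" for s
      using that t by (intro schwartz_derivs_deriv) auto
    show "isCont (D (Suc k)) s" if "ereal t < ereal s" for s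
      using that t by (intro schwartz_derivs_isCont) auto
    show "set_integrable lborel (einterval (ereal t) \<infinity>) (D (Suc k))"
      using i by (simp add: set_integrable_def)
    have "(D k \<longlongrightarrow> D k t) (at_right t)"
      using schwartz_derivs_isCont[OF t] by (simp add: continuous_at_imp_continuous_at_within continuous_within[symmetric])
    then show "((D k \<circ> real_of_ereal) \<longlongrightarrow> D k t) (at_right (ereal t))"
      by (simp add: ereal_tendsto_simps)
    have "(D k \<longlongrightarrow> 0) at_top"
    proof (rule Lim_null_comparison)
      show "\<forall>\<^sub>F s in at_top. norm (D k s) \<le> C' / (1 + s\<^sup>2)"
        using eventually_ge_at_top[of 0] by eventually_elim (use C' in auto)
      have "((\<lambda>s. complex_of_real (C' / (1 + s\<^sup>2))) \<longlongrightarrow> of_real 0) at_top"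
        using decay_tendsto_0(1)[of "\<lambda>s. complex_of_real (C' / (1 + s\<^sup>2))" C'] C'(1) unfolding norm_of_real by simp
      then show "((\<lambda>s. C' / (1 + s\<^sup>2)) \<longlongrightarrow> 0) at_top" by (simp only: tendsto_of_real_iff)
    qed
    then show "((D k \<circ> real_of_ereal) \<longlongrightarrow> 0) (at_left \<infinity>)"
      by (simp add: ereal_tendsto_simps)
  qed simp
  then show ?thesis by (simp add: interval_lebesgue_integral_def set_lebesgue_integral_def)
qed

end

text \<open>Moves t from the singular weight into the argument of \<open>f\<close>, so that
  differentiation in t acts on \<open>f\<close> alone.\<close>

lemma weyl_int_shift:
  "weyl_int g f t = of_real (1 / Gamma g) * (\<integral>s. indicator {0<..} s *\<^sub>R (of_real (s powr (g - 1)) * f (t + s)) \<partial>lborel)"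
proof -
  have "(\<integral>s. indicator {t<..} s *\<^sub>R (of_real ((s - t) powr (g - 1)) * f s) \<partial>lborel) =
      (\<integral>s. indicator {t<..} (s + t) *\<^sub>R (of_real ((s + t - t) powr (g - 1)) * f (s + t)) \<partial>lborel)"
    using integral_shift[of "\<lambda>s. indicator {t<..} s *\<^sub>R (of_real ((s - t) powr (g - 1)) * f s)" t] by simp
  also have "\<dots> = (\<integral>s. indicator {0<..} s *\<^sub>R (of_real (s powr (g - 1)) * f (t + s)) \<partial>lborel)"
    by (intro Bochner_Integration.integral_cong) (auto simp: add.commute split: split_indicator)
  finally show ?thesis by (simp add: weyl_int_def set_lebesgue_integral_def)
qed

lemma weyl_int_eq_corr:
  assumes "set_borel_measurable lborel {0<..} F"
  shows "of_real (exp (c * x)) * weyl_int g F (exp x) =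
    of_real (1 / Gamma g) * corr (cekern g c) (\<lambda>u. of_real (exp ((c + g) * u)) * F (exp u)) x"
proof -
  let ?F = "\<lambda>t. indicator {0<..} t *\<^sub>R F t"
  have "?F \<in> borel_measurable borel" using assms by (simp add: set_borel_measurable_def)
  from corr_cekern_eq_weyl[OF this, of g c x]
  have "corr (cekern g c) (\<lambda>u. of_real (exp ((c + g) * u)) * F (exp u)) x =
    of_real (exp (c * x)) * (\<integral>s. indicator {exp x<..} s *\<^sub>R (of_real ((s - exp x) powr (g - 1)) * ?F s) \<partial>lborel)"
    by simp
  also have "(\<integral>s. indicator {exp x<..} s *\<^sub>R (of_real ((s - exp x) powr (g - 1)) * ?F s) \<partial>lborel) =
      (\<integral>s. indicator {exp x<..} s *\<^sub>R (of_real ((s - exp x) powr (g - 1)) * F s) \<partial>lborel)"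
    using exp_gt_zero[of x] by (intro Bochner_Integration.integral_cong) (auto split: split_indicator simp del: exp_gt_zero)
  finally show ?thesis by (simp add: weyl_int_def set_lebesgue_integral_def)
qed

lemma weyl_weight_integrable:
  assumes "0 < g" "g \<le> 1"
  shows "integrable lborel (\<lambda>s::real. indicator {0<..} s * (s powr (g - 1) * (C / (1 + s\<^sup>2))))"
proof -
  have h: "((\<lambda>y. y powr (g - 1)) has_integral (1 / g)) {0..1}"
    using has_integral_powr_from_0[of "g - 1" 1] assms by simp
  let ?g = "\<lambda>y::real. indicator {0..1} y * y powr (g - 1)"
  have "((\<lambda>y. if y \<in> {0..1} then y powr (g - 1) else 0) has_integral (1 / g)) UNIV"
    using h by (simp only: has_integral_restrict_UNIV)
  then have "(?g has_integral (1 / g)) UNIV"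
    by (rule back_subst[of "\<lambda>f. (f has_integral (1 / g)) UNIV"]) (auto simp: indicator_def)
  then have nn: "(\<integral>\<^sup>+y. ennreal (?g y) \<partial>lborel) = ennreal (1 / g)"
    by (intro nn_integral_has_integral_lborel) auto
  have gi: "integrable lborel ?g"
    by (rule integrableI_bounded) (auto simp: nn)
  have i1: "integrable lborel (\<lambda>s::real. indicator {0<..} s * (s powr (g - 1) * (inverse (1 + s\<^sup>2))))"
  proof (rule Bochner_Integration.integrable_bound)
    show "integrable lborel (\<lambda>s. ?g s + inverse (1 + s\<^sup>2))" using gi integrable_inverse_1_plus_square' by auto
    show "AE s in lborel. norm (indicator {0<..} s * (s powr (g - 1) * (inverse (1 + s\<^sup>2)))) \<le> norm (?g s + inverse (1 + s\<^sup>2))"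
    proof (rule AE_I2)
      fix s :: real
      have i: "0 \<le> inverse (1 + s\<^sup>2)" "inverse (1 + s\<^sup>2) \<le> 1" by (auto simp: inverse_le_1_iff add_nonneg_nonneg)
      have "indicator {0<..} s * (s powr (g - 1) * (inverse (1 + s\<^sup>2))) \<le> ?g s + inverse (1 + s\<^sup>2)"
      proof (cases "s \<le> 1")
        case True
        have "s powr (g - 1) * inverse (1 + s\<^sup>2) \<le> s powr (g - 1)" using i by (intro mult_left_le) auto
        then show ?thesis using True i by (auto split: split_indicator simp del: mult_le_cancel_left1 intro!: add_increasing2 mult_left_le)
      next
        case False
        then have "s powr (g - 1) \<le> 1" using powr_mono[of "g - 1" 0 s] assms by simp
        then have "s powr (g - 1) * inverse (1 + s\<^sup>2) \<le> inverse (1 + s\<^sup>2)" using i by (intro mult_left_le_one_le) auto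
        then show ?thesis using False i by (auto split: split_indicator)
      qed
      then show "norm (indicator {0<..} s * (s powr (g - 1) * (inverse (1 + s\<^sup>2)))) \<le> norm (?g s + inverse (1 + s\<^sup>2))"
        using i by (simp add: abs_mult)
    qed
  qed measurable
  show ?thesis using integrable_mult_right[OF i1, of C] by (simp add: divide_inverse mult_ac)
qed

lemma weyl_int_has_vector_derivative:
  assumes D: "schwartz_derivs D" and g: "0 < g" "g \<le> 1" and t: "0 < t"
  shows "(weyl_int g (D k) has_vector_derivative weyl_int g (D (Suc k)) t) (at t)"
proof -
  let ?f = "\<lambda>k t s. indicator {0<..} s *\<^sub>R (complex_of_real (s powr (g - 1)) * D k (t + s))"
  have m: "?f k t \<in> borel_measurable lborel" if "0 < t" for k t
  proof -
    define e where "e s = indicator {0<..} s *\<^sub>R D k s" for s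
    have [measurable]: "e \<in> borel_measurable borel"
      using schwartz_derivs_measurable[OF D, of k] by (simp add: set_borel_measurable_def e_def[abs_def])
    have "?f k t = (\<lambda>s. indicator {0<..} s *\<^sub>R (complex_of_real (s powr (g - 1)) * e (t + s)))"
      using that by (auto simp: fun_eq_iff e_def split: split_indicator)
    also have "\<dots> \<in> borel_measurable lborel" by measurable
    finally show ?thesis .
  qed
  have b: "\<exists>C. \<forall>t>0. \<forall>s. norm (?f k t s) \<le> indicator {0<..} s * (s powr (g - 1) * (C / (1 + s\<^sup>2)))" for k
  proof -
    obtain C where C: "0 \<le> C" "\<And>t s. 0 \<le> s \<Longrightarrow> s \<le> t \<Longrightarrow> norm (D k t) \<le> C / (1 + s\<^sup>2)"
      using schwartz_derivs_square_decay[OF D] by blast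
    have "norm (?f k t s) \<le> indicator {0<..} s * (s powr (g - 1) * (C / (1 + s\<^sup>2)))" if "t > 0" for t s
      using mult_left_mono[OF C(2)[of s "t + s"], of "s powr (g - 1)"] that by (auto simp: norm_mult split: split_indicator)
    then show ?thesis by blast
  qed
  have i: "integrable lborel (?f k t)" if t: "0 < t" for k t
  proof -
    obtain C where C: "\<And>s. norm (?f k t s) \<le> indicator {0<..} s * (s powr (g - 1) * (C / (1 + s\<^sup>2)))"
      using b[of k] t by blast
    show ?thesis
      by (rule Bochner_Integration.integrable_bound[OF weyl_weight_integrable[OF g, of C] m[OF t]])
         (rule AE_I2, rule order_trans[OF C], simp only: real_norm_def abs_ge_self)
  qed
  obtain C where C: "\<And>t s. 0 < t \<Longrightarrow> norm (?f (Suc k) t s) \<le> indicator {0<..} s * (s powr (g - 1) * (C / (1 + s\<^sup>2)))"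
    using b[of "Suc k"] by blast
  have "((\<lambda>t. \<integral>s. ?f k t s \<partial>lborel) has_vector_derivative (\<integral>s. ?f (Suc k) t s \<partial>lborel)) (at t)"
  proof (rule has_vector_derivative_lebesgue_integral[where S = "{0<..}" and g = "\<lambda>s. indicator {0<..} s * (s powr (g - 1) * (C / (1 + s\<^sup>2)))"])
    fix u s :: real assume u: "u \<in> {0<..}"
    show "((\<lambda>t. ?f k t s) has_vector_derivative ?f (Suc k) u s) (at u)"
    proof (cases "0 < s")
      case True
      have "((\<lambda>t. D k (t + s)) has_vector_derivative D (Suc k) (u + s)) (at u)"
      proof -
        have 1: "((\<lambda>t. t + s) has_vector_derivative 1) (at u)" by (auto intro!: derivative_eq_intros)
        have 2: "(D k has_vector_derivative D (Suc k) (u + s)) (at (u + s))"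
          using u True by (intro schwartz_derivs_deriv[OF D]) auto
        show ?thesis using vector_diff_chain_at[OF 1 2] by (simp add: comp_def)
      qed
      then show ?thesis using True by (auto intro!: derivative_eq_intros)
    qed simp
    show "norm (?f (Suc k) u s) \<le> indicator {0<..} s * (s powr (g - 1) * (C / (1 + s\<^sup>2)))" using C u by auto
  qed (use t i m weyl_weight_integrable[OF g] in auto)
  then have "((\<lambda>t. of_real (1 / Gamma g) * (\<integral>s. ?f k t s \<partial>lborel)) has_vector_derivative of_real (1 / Gamma g) * (\<integral>s. ?f (Suc k) t s \<partial>lborel)) (at t)"
    by (rule has_vector_derivative_mult_right)
  then show ?thesis unfolding weyl_int_shift[symmetric] .
qed

lemma iterated_derivative_weyl_int:
  assumes D: "schwartz_derivs D" and g: "0 < g" "g \<le> 1" and t: "0 < t"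
  shows "((\<lambda>g x. vector_derivative g (at x)) ^^ k) (weyl_int g (D 0)) t = weyl_int g (D k) t"
  using t
proof (induction k arbitrary: t)
  case (Suc k)
  have "(((\<lambda>g x. vector_derivative g (at x)) ^^ k) (weyl_int g (D 0)) has_vector_derivative weyl_int g (D (Suc k)) t) (at t)"
    by (rule has_vector_derivative_transform_within_open[OF weyl_int_has_vector_derivative[OF D g Suc.prems], of "{0<..}"])
       (use Suc in auto)
  then show ?case by (simp add: vector_derivative_at)
qed simp

text \<open>Differentiation under the integral sign moves the n derivatives of the definition onto
  the function. The remaining order n - a lies in (0, 1] and equals 1 at integers, so the weight is
  integrable at 0 and does not grow at infinity.\<close>

lemma weyl_der_schwartz:
  assumes D: "schwartz_derivs D" and a: "0 \<le> a" and t: "0 < t" and n: "n = nat \<lfloor>a\<rfloor> + 1"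
  shows "weyl_der a (D 0) t = weyl_int (real n - a) (\<lambda>s. (-1) ^ n * D n s) t"
proof -
  have g: "0 < real n - a" "real n - a \<le> 1" using a unfolding n by linarith+
  have "weyl_der a (D 0) t = (-1) ^ n * weyl_int (real n - a) (D n) t"
    unfolding weyl_der_def Let_def n[symmetric] by (simp add: iterated_derivative_weyl_int[OF D g t])
  also have "\<dots> = weyl_int (real n - a) (\<lambda>s. (-1) ^ n * D n s) t"
    unfolding weyl_int_shift by (simp add: mult.left_commute[of _ "(-1) ^ n"] flip: integral_mult_right_zero mult_scaleR_right)
  finally show ?thesis .
qed

text \<open>In logarithmic coordinates, \<open>hmap p D n\<close> is \<open>(-1)\<^sup>n t\<^sup>n f\<^sup>(\<^sup>n\<^sup>)\<close>, the map \<open>umap\<close> is the isometry defining the norm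
  of the completed space, and \<open>vmap\<close> is its inverse.\<close>

definition hmap :: "real \<Rightarrow> (nat \<Rightarrow> real \<Rightarrow> complex) \<Rightarrow> nat \<Rightarrow> real \<Rightarrow> complex" where
  "hmap p D n u = of_real (exp ((1 / p + real n) * u)) * ((-1) ^ n * D n (exp u))"

definition umap :: "real \<Rightarrow> real \<Rightarrow> (real \<Rightarrow> complex) \<Rightarrow> real \<Rightarrow> complex" where
  "umap a p f = psi p (\<lambda>t. of_real (t powr a / Gamma (a + 1)) * weyl_der a f t)"

definition vmap :: "real \<Rightarrow> real \<Rightarrow> (real \<Rightarrow> complex) \<Rightarrow> real \<Rightarrow> complex" where
  "vmap a p F = (if a = 0 then F else corr (\<lambda>y. of_real a * cekern a (1 / p) y) F)"

lemma hmap_0: "hmap p D 0 = psi p (D 0)"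
  by (simp add: hmap_def psi_def fun_eq_iff)

lemma set_borel_measurable_mult_const:
  fixes f :: "real \<Rightarrow> complex"
  assumes "set_borel_measurable lborel A f"
  shows "set_borel_measurable lborel A (\<lambda>s. c * f s)"
proof -
  have "(\<lambda>x. c * (indicator A x *\<^sub>R f x)) \<in> borel_measurable lborel"
    using assms unfolding set_borel_measurable_def by measurable
  then show ?thesis unfolding set_borel_measurable_def by simp
qed

lemma umap_eq_corr:
  assumes D: "schwartz_derivs D" and a: "0 \<le> a" and n: "n = nat \<lfloor>a\<rfloor> + 1"
  shows "umap a p (D 0) x = of_real (1 / (Gamma (a + 1) * Gamma (real n - a))) * corr (cekern (real n - a) (1 / p + a)) (hmap p D n) x"
proof -
  let ?F = "\<lambda>s. (-1) ^ n * D n s"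
  have m: "set_borel_measurable lborel {0<..} ?F"
    by (rule set_borel_measurable_mult_const[OF schwartz_derivs_measurable[OF D]])
  have h: "(\<lambda>u. of_real (exp ((1 / p + a + (real n - a)) * u)) * ?F (exp u)) = hmap p D n"
    by (simp add: hmap_def fun_eq_iff)
  have e: "exp (x / p) * exp x powr a = exp ((1 / p + a) * x)"
    by (simp add: exp_powr_real algebra_simps flip: exp_add)
  have "umap a p (D 0) x = of_real (1 / Gamma (a + 1)) * (of_real (exp (x / p) * exp x powr a) * weyl_der a (D 0) (exp x))"
    by (simp add: umap_def psi_def)
  also have "weyl_der a (D 0) (exp x) = weyl_int (real n - a) ?F (exp x)"
    by (rule weyl_der_schwartz[OF D a _ n]) simp
  also have "of_real (exp (x / p) * exp x powr a) * weyl_int (real n - a) ?F (exp x) =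
      of_real (1 / Gamma (real n - a)) * corr (cekern (real n - a) (1 / p + a)) (hmap p D n) x"
    unfolding e weyl_int_eq_corr[OF m, of "1 / p + a" x "real n - a"] h ..
  finally show ?thesis by simp
qed

text \<open>The fundamental theorem of calculus from infinity, read as a Weyl integral of order 1.
  The weight t^k inside \<open>hmap\<close> shifts the kernel parameter to 1/p + k, as the semigroup
  law demands.\<close>

lemma hmap_step:
  assumes D: "schwartz_derivs D"
  shows "hmap p D k x = corr (cekern 1 (1 / p + real k)) (hmap p D (Suc k)) x"
proof -
  let ?F = "\<lambda>s. (-1) ^ Suc k * D (Suc k) s"
  have m: "set_borel_measurable lborel {0<..} ?F"
    by (rule set_borel_measurable_mult_const[OF schwartz_derivs_measurable[OF D]])
  have h: "(\<lambda>u. of_real (exp ((1 / p + real k + 1) * u)) * ?F (exp u)) = hmap p D (Suc k)"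
    by (simp add: hmap_def fun_eq_iff add.assoc)
  have "weyl_int 1 ?F (exp x) = (\<integral>s. indicator {exp x<..} s *\<^sub>R (of_real ((s - exp x) powr (1 - 1)) * ?F s) \<partial>lborel)"
    by (simp add: weyl_int_def set_lebesgue_integral_def)
  also have "\<dots> = (\<integral>s. (-1) ^ Suc k * (indicator {exp x<..} s *\<^sub>R D (Suc k) s) \<partial>lborel)"
    by (intro Bochner_Integration.integral_cong) (auto split: split_indicator)
  also have "\<dots> = (-1) ^ Suc k * (\<integral>s. indicator {exp x<..} s *\<^sub>R D (Suc k) s \<partial>lborel)"
    by (rule integral_mult_right_zero)
  also have "\<dots> = (-1) ^ k * D k (exp x)" using schwartz_derivs_integral[OF D, of "exp x" k] by simp
  finally have "of_real (exp ((1 / p + real k) * x)) * weyl_int 1 ?F (exp x) = hmap p D k x"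
    by (simp add: hmap_def)
  then show ?thesis using weyl_int_eq_corr[OF m, of "1 / p + real k" x 1] unfolding h by simp
qed

lemma hmap_Lp:
  assumes D: "schwartz_derivs D" and p: "1 < p"
  shows "Lp p (hmap p D n)"
proof -
  \<comment> \<open>At the left end the weight exp(u/p) supplies decay at rate 1/p. At the right end
    \<open>D n\<close> decays like t^(-n-1), one power more than the weight t^n removes, leaving the
    rate 1 - 1/p.\<close>
  define d where "d = min (1 / p) (1 - 1 / p)"
  have d: "0 < d" "d \<le> 1 / p" "d \<le> 1 - 1 / p" using p by (auto simp: d_def)
  obtain C where C: "0 \<le> C" "\<And>t. t \<ge> 0 \<Longrightarrow> norm (D n t) * (1 + t ^ (n + 1)) \<le> C"
    using schwartz_derivs_decay[OF D] by blast
  have m: "hmap p D n \<in> borel_measurable borel"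
  proof -
    have e: "hmap p D n = (\<lambda>u. of_real (exp (real n * u)) * psi p (\<lambda>s. (-1) ^ n * D n s) u)"
      by (auto simp: hmap_def psi_def fun_eq_iff distrib_right exp_add)
    have [measurable]: "psi p (\<lambda>s. (-1) ^ n * D n s) \<in> borel_measurable borel"
      by (rule psi_measurable[OF set_borel_measurable_mult_const[OF schwartz_derivs_measurable[OF D]]])
    show ?thesis unfolding e by measurable
  qed
  have b: "norm (hmap p D n u) \<le> C * exp (- (d * \<bar>u\<bar>))" for u
  proof -
    have nh: "norm (hmap p D n u) = exp ((1 / p + real n) * u) * norm (D n (exp u))"
      by (simp add: hmap_def norm_mult norm_power)
    have C1: "norm (D n (exp u)) + norm (D n (exp u)) * exp u ^ (n + 1) \<le> C"
      using C(2)[of "exp u"] by (simp add: distrib_left)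
    show ?thesis
    proof (cases "u \<le> 0")
      case True
      have "norm (D n (exp u)) \<le> C" using C1 by (smt (verit) mult_nonneg_nonneg norm_ge_zero zero_le_power exp_ge_zero)
      moreover have "exp ((1 / p + real n) * u) \<le> exp (- (d * \<bar>u\<bar>))"
      proof -
        have "(1 / p + real n) * u \<le> d * u" using True d by (intro mult_right_mono_neg) auto
        then show ?thesis using True by simp
      qed
      ultimately show ?thesis unfolding nh using C by (subst mult.commute) (intro mult_mono, auto)
    next
      case False
      have e: "exp u ^ (n + 1) = exp ((real n + 1) * u)" by (simp add: exp_of_nat_mult[symmetric] algebra_simps flip: exp_add)
      have "norm (D n (exp u)) * exp u ^ (n + 1) \<le> C" using C1 by (smt (verit) norm_ge_zero)
      then have 1: "norm (D n (exp u)) * exp ((real n + 1) * u) \<le> C" unfolding e .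
      have "exp ((1 / p + real n) * u) * norm (D n (exp u)) = (norm (D n (exp u)) * exp ((real n + 1) * u)) * exp ((1 / p - 1) * u)"
        by (simp add: algebra_simps flip: exp_add)
      also have "\<dots> \<le> C * exp (- (d * \<bar>u\<bar>))"
      proof (intro mult_mono 1)
        have "(1 / p - 1) * u \<le> (- d) * u" using False d by (intro mult_right_mono) auto
        then show "exp ((1 / p - 1) * u) \<le> exp (- (d * \<bar>u\<bar>))" using False by simp
      qed (use C in auto)
      finally show ?thesis unfolding nh .
    qed
  qed
  show ?thesis
    by (rule Lp_bound(1)[OF Lp_exp_abs[OF p d(1)] p m C(1)]) (use b in auto)
qed

text \<open>Taylor's formula with base point at infinity, in logarithmic coordinates: iterating
  \<open>hmap_step\<close> adds one order at a time, and the Beta factors accumulate to the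
  reciprocal of Gamma.\<close>

lemma psi_eq_corr_hmap:
  assumes D: "schwartz_derivs D" and p: "1 < p"
  shows "AE x in lborel. psi p (D 0) x = of_real (1 / Gamma (real (Suc n))) * corr (cekern (real (Suc n)) (1 / p)) (hmap p D (Suc n)) x"
proof (induction n)
  case 0
  then show ?case using hmap_step[OF D, of p 0] by (simp add: hmap_0)
next
  case (Suc n)
  have L: "Lp p (hmap p D (Suc (Suc n)))" by (rule hmap_Lp[OF D p])
  have h: "hmap p D (Suc n) = corr (cekern 1 (1 / p + real (Suc n))) (hmap p D (Suc (Suc n)))"
    using hmap_step[OF D] by (auto simp: fun_eq_iff)
  have p0: "0 < 1 / p" using p by simp
  have "AE x in lborel. corr (cekern (real (Suc n)) (1 / p)) (hmap p D (Suc n)) x =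
      of_real (Beta (real (Suc n)) 1) * corr (cekern (real (Suc n) + 1) (1 / p)) (hmap p D (Suc (Suc n))) x"
    unfolding h by (rule corr_cekern_comp[OF p _ _ p0 L]) auto
  with Suc.IH show ?case
  proof eventually_elim
    case (elim x)
    have G: "Gamma (real (Suc n)) \<noteq> 0" using Gamma_real_pos[of "real (Suc n)"] by (simp del: of_nat_Suc add: less_imp_neq[THEN not_sym])
    have "of_real (1 / Gamma (real (Suc n))) * complex_of_real (Beta (real (Suc n)) 1) = of_real (1 / Gamma (real (Suc n) + 1))"
      using G unfolding of_real_mult[symmetric] Beta_def by simp
    then show ?case unfolding elim(1) elim(2) mult.assoc[symmetric] by (simp add: add.commute)
  qed
qed

lemma vmap_kernel_integrable:
  assumes "0 \<le> a" "a \<noteq> 0" "1 < p"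
  shows "integrable lborel (\<lambda>y. complex_of_real a * cekern a (1 / p) y)"
  using assms by (intro integrable_mult_right cekern_integrable) auto

text \<open>\<open>umap\<close> is a kernel of order n - a applied to \<open>hmap p D n\<close>, and
  \<open>vmap\<close> adds order a; together they have order n, which recovers f by Taylor's
  formula. The factor a in \<open>vmap\<close> is Gamma(a+1)/Gamma(a), and a B(a, n-a) / (Gamma(a+1)
  Gamma(n-a)) = 1/Gamma(n). The case a = 0 is separate because a kernel of order 0 would be a point
  mass.\<close>

lemma umap_Lp:
  assumes f: "f \<in> schwartz_plus" and a: "0 \<le> a" and p: "1 < p"
  shows "Lp p (umap a p f)" "AE x in lborel. vmap a p (umap a p f) x = psi p f x"
proof -
  obtain D where D: "D 0 = f" "schwartz_derivs D" using f by (auto simp: schwartz_plus_iff)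
  define n where "n = nat \<lfloor>a\<rfloor> + 1"
  have g: "0 < real n - a" "real n - a \<le> 1" using a unfolding n_def by linarith+
  have c: "0 < 1 / p + a" "0 < 1 / p" using a p by (auto simp: add_pos_nonneg)
  have L: "Lp p (hmap p D n)" by (rule hmap_Lp[OF D(2) p])
  let ?k = "complex_of_real (1 / (Gamma (a + 1) * Gamma (real n - a)))"
  have u: "umap a p f = (\<lambda>x. ?k * corr (cekern (real n - a) (1 / p + a)) (hmap p D n) x)"
    using umap_eq_corr[OF D(2) a n_def] D(1) by (auto simp: fun_eq_iff)
  have Lc: "Lp p (corr (cekern (real n - a) (1 / p + a)) (hmap p D n))"
    by (intro Lp_corr(2)[OF p] cekern_integrable g c L)
  show "Lp p (umap a p f)" unfolding u by (rule Lp_scale(1)[OF Lc p])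
  have n: "n = Suc (n - 1)" by (simp add: n_def)
  have ps: "AE x in lborel. psi p f x = of_real (1 / Gamma (real n)) * corr (cekern (real n) (1 / p)) (hmap p D n) x"
    using psi_eq_corr_hmap[OF D(2) p, of "n - 1"] D(1) n by simp
  show "AE x in lborel. vmap a p (umap a p f) x = psi p f x"
  proof (cases "a = 0")
    case True
    then have "n = 1" by (simp add: n_def)
    then have "umap a p f x = of_real (1 / Gamma (real n)) * corr (cekern (real n) (1 / p)) (hmap p D n) x" for x
      unfolding u using True by simp
    note e = this
    have v: "vmap a p (umap a p f) = umap a p f" using True by (simp add: vmap_def)
    show ?thesis unfolding v e using ps by eventually_elim simp
  next
    case False
    with a have a0: "0 < a" by simp
    have "AE x in lborel. corr (cekern a (1 / p)) (corr (cekern (real n - a) (1 / p + a)) (hmap p D n)) x =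
        of_real (Beta a (real n - a)) * corr (cekern (a + (real n - a)) (1 / p)) (hmap p D n) x"
      by (rule corr_cekern_comp[OF p a0 g(1) c(2) L])
    with ps show ?thesis
    proof eventually_elim
      case (elim x)
      have "vmap a p (umap a p f) x = of_real a * ?k * corr (cekern a (1 / p)) (corr (cekern (real n - a) (1 / p + a)) (hmap p D n)) x"
        using False unfolding vmap_def u corr_def[of "\<lambda>y. complex_of_real a * cekern a (1 / p) y"] corr_def[of "cekern a (1 / p)"]
        by (simp only: if_False mult.assoc mult.left_commute[of "complex_of_real (ekern _ _ _)"] integral_mult_right_zero)
      also have "\<dots> = (of_real a * ?k * of_real (Beta a (real n - a))) * corr (cekern (real n) (1 / p)) (hmap p D n) x"
        unfolding elim(2) by simp
      also have "of_real a * ?k * of_real (Beta a (real n - a)) = complex_of_real (1 / Gamma (real n))"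
      proof -
        have "Gamma (a + 1) = a * Gamma a" using a0 by (intro Gamma_plus1) (auto elim!: nonpos_Ints_cases)
        moreover have "Gamma a \<noteq> 0" "Gamma (real n - a) \<noteq> 0" using Gamma_real_pos[OF a0] Gamma_real_pos[OF g(1)] by auto
        ultimately have "a * (1 / (Gamma (a + 1) * Gamma (real n - a))) * Beta a (real n - a) = 1 / Gamma (real n)"
          using a0 by (simp add: Beta_def)
        then show ?thesis unfolding of_real_mult[symmetric] by (rule arg_cong)
      qed
      also have "complex_of_real (1 / Gamma (real n)) * corr (cekern (real n) (1 / p)) (hmap p D n) x = psi p f x"
        using elim(1) by simp
      finally show ?case .
    qed
  qed
qed

lemma umap_diff:
  assumes f: "f \<in> schwartz_plus" and g: "g \<in> schwartz_plus" and a: "0 \<le> a" and p: "1 < p"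
  shows "AE x in lborel. umap a p (\<lambda>t. f t - g t) x = umap a p f x - umap a p g x"
proof -
  obtain D where D: "D 0 = f" "schwartz_derivs D" using f by (auto simp: schwartz_plus_iff)
  obtain E where E: "E 0 = g" "schwartz_derivs E" using g by (auto simp: schwartz_plus_iff)
  define n where "n = nat \<lfloor>a\<rfloor> + 1"
  have g: "0 < real n - a" "real n - a \<le> 1" using a unfolding n_def by linarith+
  have c: "0 < 1 / p + a" "0 < 1 / p" using a p by (auto simp: add_pos_nonneg)
  let ?k = "complex_of_real (1 / (Gamma (a + 1) * Gamma (real n - a)))"
  let ?c = "corr (cekern (real n - a) (1 / p + a))"
  have "AE x in lborel. ?c (\<lambda>x. 1 * hmap p D n x + (-1) * hmap p E n x) x = 1 * ?c (hmap p D n) x + (-1) * ?c (hmap p E n) x"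
    by (intro corr_lincomb[OF p] cekern_integrable g c hmap_Lp D E p)
  moreover have "hmap p (\<lambda>k t. D k t - E k t) n = (\<lambda>x. 1 * hmap p D n x + (-1) * hmap p E n x)"
    by (auto simp: hmap_def fun_eq_iff algebra_simps)
  ultimately have "AE x in lborel. ?c (hmap p (\<lambda>k t. D k t - E k t) n) x = ?c (hmap p D n) x - ?c (hmap p E n) x" by simp
  then show ?thesis
  proof eventually_elim
    case (elim x)
    then show ?case
      using umap_eq_corr[OF D(2) a n_def, of p x] umap_eq_corr[OF E(2) a n_def, of p x]
        umap_eq_corr[OF schwartz_derivs_diff[OF D(2) E(2)] a n_def, of p x] D(1) E(1)
      by (simp add: right_diff_distrib)
  qed
qed

text \<open>Since \<open>umap a p f\<close> is in L^p, the extended integral in \<open>wnorm\<close>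
  is finite and \<open>enn2real\<close> returns its true value.\<close>

lemma wnorm_eq:
  assumes f: "f \<in> schwartz_plus" and a: "0 \<le> a" and p: "1 < p"
  shows "wnorm a p f = Lp_norm p (umap a p f)"
proof -
  let ?G = "Gamma (a + 1)"
  have G: "?G > 0" using a by (intro Gamma_real_pos) auto
  let ?g = "\<lambda>t. of_real (t powr a) * weyl_der a f t"
  have e: "psi p ?g = (\<lambda>x. of_real ?G * umap a p f x)"
    using G by (auto simp: umap_def psi_def fun_eq_iff)
  have L: "Lp p (psi p ?g)" unfolding e by (rule Lp_scale(1)[OF umap_Lp(1)[OF assms] p])
  have "(\<integral>\<^sup>+ t. ennreal (norm (weyl_der a f t) powr p * t powr (a * p)) * indicator {0<..} t \<partial>lborel) = lp_pow p ?g"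
    unfolding lp_pow_def
    by (intro nn_integral_cong) (auto simp: norm_mult powr_mult powr_powr mult.commute split: split_indicator)
  also have "\<dots> = ennreal (Lp_norm p (psi p ?g) powr p)" by (rule lp_pow_eq[OF L p])
  finally have "wnorm a p f = Lp_norm p (psi p ?g) / ?G"
    unfolding wnorm_def using p by (simp add: powr_powr)
  then show ?thesis unfolding e Lp_scale(2)[OF umap_Lp(1)[OF assms] p] using G by simp
qed

section \<open>The operator \<open>vmap\<close> on all of L^p\<close>

lemma vmap_Lp:
  assumes a: "0 \<le> a" and p: "1 < p" and F: "Lp p F"
  shows "Lp p (vmap a p F)"
  unfolding vmap_def using Lp_corr(2)[OF p vmap_kernel_integrable[OF a _ p] F] F by simp

lemma vmap_norm_le:
  assumes a: "0 \<le> a" and p: "1 < p"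
  obtains B where "0 \<le> B" "\<And>F. Lp p F \<Longrightarrow> Lp_norm p (vmap a p F) \<le> B * Lp_norm p F"
proof (cases "a = 0")
  case True
  show thesis by (rule that[of 1]) (use True in \<open>auto simp: vmap_def\<close>)
next
  case False
  show thesis
    by (rule that[of "\<integral>y. norm (complex_of_real a * cekern a (1 / p) y) \<partial>lborel"])
       (use False Lp_corr(3)[OF p vmap_kernel_integrable[OF a False p]] in \<open>auto simp: vmap_def\<close>)
qed

lemma vmap_lincomb:
  assumes a: "0 \<le> a" and p: "1 < p" and F: "Lp p F" and G: "Lp p G"
  shows "AE x in lborel. vmap a p (\<lambda>x. b * F x + c * G x) x = b * vmap a p F x + c * vmap a p G x"
  unfolding vmap_def using corr_lincomb[OF p vmap_kernel_integrable[OF a _ p] F G] by simp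

lemma vmap_cong_AE:
  assumes a: "0 \<le> a" and p: "1 < p" and F: "F \<in> borel_measurable borel" and G: "G \<in> borel_measurable borel"
    and "AE x in lborel. F x = G x"
  shows "AE x in lborel. vmap a p F x = vmap a p G x"
proof (cases "a = 0")
  case False
  have "(\<lambda>y. complex_of_real a * cekern a (1 / p) y) \<in> borel_measurable borel" by measurable
  then show ?thesis using corr_cong_AE[OF assms(5) _ F G] False by (simp add: vmap_def)
qed (use assms in \<open>simp add: vmap_def\<close>)

lemma vmap_injective:
  assumes a: "0 \<le> a" and p: "1 < p" and F: "Lp p F" and 0: "AE x in lborel. vmap a p F x = 0"
  shows "AE x in lborel. F x = 0"
proof (cases "a = 0")
  case False
  with a have a0: "0 < a" by simp
  have "vmap a p F x = of_real a * corr (cekern a (1 / p)) F x" for x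
    using False by (simp add: vmap_def corr_def mult.assoc)
  with 0 have "AE x in lborel. corr (cekern a (1 / p)) F x = 0" using False by simp
  then show ?thesis using p by (intro corr_cekern_injective[OF p a0 _ F]) auto
qed (use 0 in \<open>simp add: vmap_def\<close>)

lemma vmap_corr_commute:
  assumes a: "0 \<le> a" and p: "1 < p" and F: "Lp p F" and k: "integrable lborel k"
  shows "AE x in lborel. vmap a p (corr k F) x = corr k (vmap a p F) x"
  unfolding vmap_def using corr_commute[OF p vmap_kernel_integrable[OF a _ p] k F] by simp

section \<open>Density\<close>

lemma Lp_dominated_convergence:
  assumes p: "1 < p" and W: "Lp p W" and [measurable]: "\<And>k. F k \<in> borel_measurable borel" "G \<in> borel_measurable borel"
    and lim: "AE x in lborel. (\<lambda>k. F k x) \<longlonglongrightarrow> G x"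
    and b: "\<And>k x. norm (F k x - G x) \<le> norm (W x)"
  shows "(\<lambda>k. Lp_norm p (\<lambda>x. F k x - G x)) \<longlonglongrightarrow> 0"
proof -
  have "(\<lambda>k. \<integral>x. norm (F k x - G x) powr p \<partial>lborel) \<longlonglongrightarrow> (\<integral>x. 0 \<partial>(lborel :: real measure))"
  proof (rule integral_dominated_convergence[OF _ _ Lp_integrable[OF W]])
    show "AE x in lborel. (\<lambda>k. norm (F k x - G x) powr p) \<longlonglongrightarrow> 0"
      using lim
    proof eventually_elim
      case (elim x)
      have "(\<lambda>k. norm (F k x - G x)) \<longlonglongrightarrow> 0" using elim by (simp add: LIM_zero tendsto_norm_zero)
      then have "(\<lambda>k. norm (F k x - G x) powr p) \<longlonglongrightarrow> 0 powr p"
        using p by (intro tendsto_powr2) auto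
      then show ?case by simp
    qed
    show "AE x in lborel. norm (norm (F k x - G x) powr p) \<le> norm (W x) powr p" for k
      using b p by (auto intro!: AE_I2 powr_mono2)
  qed measurable
  then have "(\<lambda>k. (\<integral>x. norm (F k x - G x) powr p \<partial>lborel) powr (1 / p)) \<longlonglongrightarrow> 0 powr (1 / p)"
    using p by (intro tendsto_powr2) auto
  then show ?thesis by (simp add: Lp_norm_def)
qed

lemma Lp_indicator_cbox:
  assumes "1 < p"
  shows "Lp p (\<lambda>x. of_real (c * indicator {- R..R::real} x))"
proof -
  have "integrable lborel (\<lambda>x. \<bar>c\<bar> powr p * indicator {- R..R::real} x)"
    by (intro integrable_mult_right integrable_real_indicator) (auto simp: emeasure_lborel_Icc_eq)
  moreover have "(\<lambda>x. norm (complex_of_real (c * indicator {- R..R::real} x)) powr p) = (\<lambda>x. \<bar>c\<bar> powr p * indicator {- R..R::real} x)"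
    by (auto simp: fun_eq_iff abs_mult split: split_indicator)
  ultimately show ?thesis by (simp add: Lp_def)
qed

text \<open>Truncation makes the function bounded with bounded support. A measurable function is an
  almost everywhere limit of continuous ones; these are clipped to the same bound and cut off
  outside a slightly larger interval, so that a multiple of an indicator dominates the
  error.\<close>

lemma Lp_approx_continuous:
  assumes p: "1 < p" and F: "Lp p F" and e: "0 < e"
  obtains G R where "0 < R" "continuous_on UNIV G" "\<And>x. R \<le> \<bar>x\<bar> \<Longrightarrow> G x = 0" "Lp p G" "Lp_norm p (\<lambda>x. F x - G x) < e"
proof -
  have [measurable]: "F \<in> borel_measurable borel" using F by (auto simp: Lp_def)
  define B where "B n x = (if \<bar>x\<bar> \<le> real n \<and> norm (F x) \<le> real n then F x else 0)" for n x
  have [measurable]: "B n \<in> borel_measurable borel" for n unfolding B_def by measurable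
  have "(\<lambda>n. Lp_norm p (\<lambda>x. B n x - F x)) \<longlonglongrightarrow> 0"
  proof (rule Lp_dominated_convergence[OF p F])
    show "AE x in lborel. (\<lambda>n. B n x) \<longlonglongrightarrow> F x"
    proof (rule AE_I2)
      fix x
      obtain n0 where n0: "\<bar>x\<bar> + norm (F x) < real n0" using reals_Archimedean2 by blast
      have "\<forall>\<^sub>F n in sequentially. B n x = F x"
        using eventually_ge_at_top[of n0]
      proof eventually_elim
        case (elim n)
        then have "real n0 \<le> real n" by simp
        then have "\<bar>x\<bar> \<le> real n" "norm (F x) \<le> real n" using n0 norm_ge_zero[of "F x"] by linarith+
        then show ?case by (simp add: B_def)
      qed
      then show "(\<lambda>n. B n x) \<longlonglongrightarrow> F x" by (rule tendsto_eventually)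
    qed
    show "norm (B n x - F x) \<le> norm (F x)" for n x by (simp add: B_def)
  qed measurable
  from order_tendstoD(2)[OF this, of "e / 2"] e
  have "\<forall>\<^sub>F n in sequentially. Lp_norm p (\<lambda>x. B n x - F x) < e / 2" by simp
  then have "\<forall>\<^sub>F n in sequentially. 1 \<le> n \<and> Lp_norm p (\<lambda>x. B n x - F x) < e / 2"
    using eventually_ge_at_top[of 1] by eventually_elim simp
  then obtain n where n: "1 \<le> n" "Lp_norm p (\<lambda>x. B n x - F x) < e / 2"
    using eventually_happens[of _ sequentially] by auto
  define N where "N = real n"
  have N: "1 \<le> N" using n(1) by (simp add: N_def)
  have BN: "norm (B n x) \<le> N" "N < \<bar>x\<bar> \<Longrightarrow> B n x = 0" for x using N by (auto simp: B_def N_def)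
  have LB: "Lp p (B n)"
    by (rule Lp_bound(1)[OF F p, of _ 1]) (auto simp: B_def)
  have "B n \<in> borel_measurable lebesgue" by (rule measurable_completion) simp
  then have "B n measurable_on UNIV" by (intro lebesgue_measurable_imp_measurable_on) auto
  then obtain S g where S: "negligible S" and g: "\<And>k. continuous_on UNIV (g k)" "\<And>x. x \<notin> S \<Longrightarrow> (\<lambda>k. g k x) \<longlonglongrightarrow> B n x"
    by (auto simp: measurable_on_def)
  \<comment> \<open>The radial retraction of the plane onto the disc of radius N. It is continuous
    and fixes the values of \<open>B n\<close>, so it preserves the pointwise limit.\<close>
  define clip where "clip w = (N / max N (norm w)) *\<^sub>R (w :: complex)" for w
  have m0: "max N (norm w) \<noteq> 0" for w :: complex using N by auto
  have cc: "continuous_on UNIV clip" unfolding clip_def using m0 by (intro continuous_intros) auto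
  have cn: "norm (clip w) \<le> N" for w
  proof -
    have "norm (clip w) = N * (norm w / max N (norm w))" using N by (simp add: clip_def)
    also have "\<dots> \<le> N * 1" using N by (intro mult_left_mono) (auto simp: divide_le_eq)
    finally show ?thesis by simp
  qed
  have ce: "clip w = w" if "norm w \<le> N" for w using that N by (simp add: clip_def max_def)
  define ch where "ch x = max 0 (min 1 (N + 1 - \<bar>x\<bar>))" for x :: real
  have ch: "0 \<le> ch x" "ch x \<le> 1" "N + 1 \<le> \<bar>x\<bar> \<Longrightarrow> ch x = 0" "\<bar>x\<bar> \<le> N \<Longrightarrow> ch x = 1" for x by (auto simp: ch_def)
  define G where "G k x = ch x *\<^sub>R clip (g k x)" for k x
  have cG: "continuous_on UNIV (G k)" for k
    unfolding G_def ch_def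
    by (intro continuous_intros continuous_on_compose2[OF cc g(1)]) auto
  have [measurable]: "G k \<in> borel_measurable borel" for k using cG by (rule borel_measurable_continuous_onI)
  have G0: "G k x = 0" if "N + 1 \<le> \<bar>x\<bar>" for k x using ch(3)[OF that] by (simp add: G_def)
  have Gn: "norm (G k x) \<le> N" for k x
  proof -
    have "norm (G k x) = ch x * norm (clip (g k x))" using ch by (simp add: G_def)
    also have "\<dots> \<le> 1 * N" using ch cn N by (intro mult_mono) auto
    finally show ?thesis by simp
  qed
  have "(\<lambda>k. Lp_norm p (\<lambda>x. G k x - B n x)) \<longlonglongrightarrow> 0"
  proof (rule Lp_dominated_convergence[OF p Lp_indicator_cbox[OF p, of "2 * N" "N + 1"]])
    have "AE x in lebesgue. x \<notin> S" using S by (intro AE_not_in) (simp add: negligible_iff_null_sets)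
    then have "AE x in lborel. x \<notin> S" by (simp add: AE_completion_iff)
    then show "AE x in lborel. (\<lambda>k. G k x) \<longlonglongrightarrow> B n x"
    proof eventually_elim
      case (elim x)
      have "isCont clip (B n x)" using cc by (simp add: continuous_on_eq_continuous_at)
      then have "(\<lambda>k. G k x) \<longlonglongrightarrow> ch x *\<^sub>R clip (B n x)"
        unfolding G_def by (intro tendsto_intros isCont_tendsto_compose[OF _ g(2)[OF elim]])
      moreover have "ch x *\<^sub>R clip (B n x) = B n x"
        using ce[OF BN(1)] ce[of 0] N BN(2)[of x] ch(4)[of x] by (cases "N < \<bar>x\<bar>") auto
      ultimately show ?case by simp
    qed
    show "norm (G k x - B n x) \<le> norm (complex_of_real (2 * N * indicator {- (N + 1)..N + 1} x))" for k x
    proof (cases "\<bar>x\<bar> \<le> N + 1")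
      case True
      then have "x \<in> {- (N + 1)..N + 1}" by auto
      moreover have "norm (G k x - B n x) \<le> N + N" by (rule order_trans[OF norm_triangle_ineq4 add_mono[OF Gn BN(1)]])
      ultimately show ?thesis using N by simp
    next
      case False
      then show ?thesis using G0[of x k] BN(2)[of x] by simp
    qed
  qed measurable
  from order_tendstoD(2)[OF this, of "e / 2"] e
  have "\<forall>\<^sub>F k in sequentially. Lp_norm p (\<lambda>x. G k x - B n x) < e / 2" by simp
  then obtain k where k: "Lp_norm p (\<lambda>x. G k x - B n x) < e / 2"
    using eventually_happens[of _ sequentially] by auto
  have LG: "Lp p (G k)"
  proof (rule Lp_bound(1)[OF Lp_indicator_cbox[OF p, of N "N + 1"] p, of _ 1])
    show "AE x in lborel. norm (G k x) \<le> 1 * norm (complex_of_real (N * indicator {- (N + 1)..N + 1} x))"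
    proof (rule AE_I2)
      fix x
      show "norm (G k x) \<le> 1 * norm (complex_of_real (N * indicator {- (N + 1)..N + 1} x))"
        using Gn[of k x] G0[of x k] N by (cases "\<bar>x\<bar> \<le> N + 1") (auto split: split_indicator simp: abs_le_iff)
    qed
  qed auto
  have "Lp_norm p (\<lambda>x. F x - G k x) = Lp_norm p (\<lambda>x. (B n x - G k x) - (B n x - F x))" by simp
  also have "\<dots> \<le> Lp_norm p (\<lambda>x. B n x - G k x) + Lp_norm p (\<lambda>x. B n x - F x)"
    by (intro Lp_diff(2) Lp_diff(1) LB LG F p)
  also have "\<dots> < e" using n(2) k by (subst Lp_norm_minus_commute) simp
  finally show thesis using N cG G0 LG by (intro that[of "N + 1" "G k"]) auto
qed

lemma schwartz_derivs_exp_sum: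
  fixes c :: "nat \<Rightarrow> complex"
  shows "schwartz_derivs (\<lambda>k t. \<Sum>j\<le>m. c j * of_real ((- (real j + 1)) ^ k * exp (- ((real j + 1) * t))))"
  unfolding schwartz_derivs_def
proof (intro conjI allI impI)
  fix k :: nat and t :: real
  have "((\<lambda>t. c j * of_real ((- (real j + 1)) ^ k * exp (- ((real j + 1) * t)))) has_vector_derivative
      c j * of_real ((- (real j + 1)) ^ Suc k * exp (- ((real j + 1) * t)))) (at t within {0..})" for j
  proof -
    have "((\<lambda>t. (- (real j + 1)) ^ k * exp (- ((real j + 1) * t))) has_real_derivative (- (real j + 1)) ^ Suc k * exp (- ((real j + 1) * t))) (at t within {0..})"
      by (auto intro!: derivative_eq_intros)
    then have "((\<lambda>t. complex_of_real ((- (real j + 1)) ^ k * exp (- ((real j + 1) * t)))) has_vector_derivative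
        of_real ((- (real j + 1)) ^ Suc k * exp (- ((real j + 1) * t)))) (at t within {0..})"
      by (rule has_vector_derivative_of_real)
    then show ?thesis by (rule has_vector_derivative_mult_right)
  qed
  then show "((\<lambda>t. \<Sum>j\<le>m. c j * of_real ((- (real j + 1)) ^ k * exp (- ((real j + 1) * t)))) has_vector_derivative
      (\<Sum>j\<le>m. c j * of_real ((- (real j + 1)) ^ Suc k * exp (- ((real j + 1) * t))))) (at t within {0..})"
    by (intro has_vector_derivative_sum)
next
  fix k l :: nat
  have e: "t ^ l * exp (- t) \<le> fact l" if "t \<ge> 0" for t :: real
  proof -
    have "t ^ l / fact l \<le> exp t"
    proof -
      have "(\<lambda>n. t ^ n /\<^sub>R fact n) sums exp t" by (rule exp_converges)
      moreover have "(\<Sum>n\<in>{l}. t ^ n /\<^sub>R fact n) \<le> (\<Sum>n. t ^ n /\<^sub>R fact n)"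
        by (rule sum_le_suminf) (use that calculation in \<open>auto simp: sums_iff\<close>)
      ultimately show ?thesis by (simp add: sums_iff divide_inverse mult.commute)
    qed
    then have "t ^ l / fact l * exp (- t) \<le> exp t * exp (- t)" by (intro mult_right_mono) auto
    then show ?thesis by (simp add: field_simps flip: exp_add)
  qed
  have "t ^ l * norm (\<Sum>j\<le>m. c j * of_real ((- (real j + 1)) ^ k * exp (- ((real j + 1) * t)))) \<le> (\<Sum>j\<le>m. norm (c j) * (real j + 1) ^ k * fact l)"
    if t: "t \<ge> 0" for t :: real
  proof -
    have "norm (\<Sum>j\<le>m. c j * of_real ((- (real j + 1)) ^ k * exp (- ((real j + 1) * t)))) \<le>
        (\<Sum>j\<le>m. norm (c j) * ((real j + 1) ^ k * exp (- ((real j + 1) * t))))"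
      by (rule order_trans[OF norm_sum]) (auto simp: norm_mult abs_mult power_abs add.commute[of 1] intro!: sum_mono simp del: of_real_mult)
    then have "t ^ l * norm (\<Sum>j\<le>m. c j * of_real ((- (real j + 1)) ^ k * exp (- ((real j + 1) * t)))) \<le>
        t ^ l * (\<Sum>j\<le>m. norm (c j) * ((real j + 1) ^ k * exp (- ((real j + 1) * t))))"
      using t by (intro mult_left_mono) auto
    also have "\<dots> = (\<Sum>j\<le>m. norm (c j) * (real j + 1) ^ k * (t ^ l * exp (- ((real j + 1) * t))))"
      by (simp add: sum_distrib_left mult_ac)
    also have "\<dots> \<le> (\<Sum>j\<le>m. norm (c j) * (real j + 1) ^ k * fact l)"
    proof (intro sum_mono mult_left_mono)
      fix j
      have "exp (- ((real j + 1) * t)) \<le> exp (- t)" using t by (simp add: algebra_simps)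
      then have "t ^ l * exp (- ((real j + 1) * t)) \<le> t ^ l * exp (- t)" using t by (intro mult_left_mono) auto
      also have "\<dots> \<le> fact l" by (rule e[OF t])
      finally show "t ^ l * exp (- ((real j + 1) * t)) \<le> fact l" .
    qed auto
    finally show ?thesis .
  qed
  then show "\<exists>C. \<forall>t\<ge>0. t ^ l * norm (\<Sum>j\<le>m. c j * of_real ((- (real j + 1)) ^ k * exp (- ((real j + 1) * t)))) \<le> C" by blast
qed

text \<open>Each exponential exp(-(j+1)t) is an eigenfunction of the Weyl derivative with eigenvalue
  (j+1)^a: n derivatives contribute (j+1)^n, up to the sign that the definition cancels, and the
  Weyl integral contributes (j+1)^(a-n).\<close>

lemma umap_exp_sum:
  fixes c :: "nat \<Rightarrow> complex" and m :: nat
  assumes a: "0 \<le> a"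
  defines "f \<equiv> \<lambda>t. \<Sum>j\<le>m. c j * of_real (exp (- ((real j + 1) * t)))"
  shows "f \<in> schwartz_plus"
    and "umap a p f x = of_real (exp ((1 / p + a) * x) / Gamma (a + 1)) *
      (\<Sum>j\<le>m. c j * of_real ((real j + 1) powr a * exp (- ((real j + 1) * exp x))))"
proof -
  let ?D = "\<lambda>k t. \<Sum>j\<le>m. c j * complex_of_real ((- (real j + 1)) ^ k * exp (- ((real j + 1) * t)))"
  have D: "schwartz_derivs ?D" by (rule schwartz_derivs_exp_sum)
  have f: "?D 0 = f" by (simp add: f_def)
  show "f \<in> schwartz_plus" unfolding schwartz_plus_iff by (intro exI[of _ ?D] conjI f D)
  define n where "n = nat \<lfloor>a\<rfloor> + 1"
  have g: "0 < real n - a" using a unfolding n_def by linarith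
  let ?G = "complex_of_real (Gamma (real n - a))"
  have G: "Gamma (real n - a) > 0" using g by (rule Gamma_real_pos)
  let ?h = "\<lambda>t j s. indicator {t<..} s *\<^sub>R (complex_of_real ((s - t) powr (real n - a - 1)) * of_real (exp (- ((real j + 1) * s))))"
  have hv: "(\<integral>s. ?h t j s \<partial>lborel) = of_real (Gamma (real n - a) * (real j + 1) powr (- (real n - a)) * exp (- ((real j + 1) * t)))" for t j
    using integral_Gamma_shift[OF g, of "real j + 1" t] by simp
  \<comment> \<open>A non-integrable function has Bochner integral 0 by convention, while the
    computed value is a nonzero Gamma expression; so integrability follows from the value.\<close>
  have hi: "integrable lborel (?h t j)" for t j
  proof (rule ccontr)
    assume "\<not> integrable lborel (?h t j)"
    then have "(\<integral>s. ?h t j s \<partial>lborel) = 0" by (rule not_integrable_integral_eq)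
    then show False unfolding hv using G by simp
  qed
  have w: "weyl_der a f t = (\<Sum>j\<le>m. c j * of_real ((real j + 1) powr a * exp (- ((real j + 1) * t))))" if t: "0 < t" for t
  proof -
    have "weyl_der a f t = weyl_int (real n - a) (\<lambda>s. (-1) ^ n * ?D n s) t"
      using weyl_der_schwartz[OF D a t n_def] unfolding f .
    also have "\<dots> = of_real (1 / Gamma (real n - a)) * (\<integral>s. (\<Sum>j\<le>m. c j * of_real ((real j + 1) ^ n) * ?h t j s) \<partial>lborel)"
    proof -
      have "(- 1) ^ n * complex_of_real ((- (real j + 1)) ^ n * exp (- ((real j + 1) * s))) = of_real ((real j + 1) ^ n) * of_real (exp (- ((real j + 1) * s)))" for j s
      proof -
        have "(-1::real) ^ n * (- (real j + 1)) ^ n = (real j + 1) ^ n" by (simp add: add.commute flip: power_mult_distrib)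
        then have "complex_of_real ((-1) ^ n * (- (real j + 1)) ^ n) = complex_of_real ((real j + 1) ^ n)" by (rule arg_cong)
        then show ?thesis by (simp add: mult.assoc[symmetric])
      qed
      then have "(- 1) ^ n * (c j * complex_of_real ((- (real j + 1)) ^ n * exp (- ((real j + 1) * s)))) = c j * of_real ((real j + 1) ^ n) * of_real (exp (- ((real j + 1) * s)))" for j s
        by (metis (no_types, lifting) mult.assoc mult.left_commute)
      then have "(- 1) ^ n * ?D n s = (\<Sum>j\<le>m. c j * of_real ((real j + 1) ^ n) * of_real (exp (- ((real j + 1) * s))))" for s
        by (simp only: sum_distrib_left)
      then have "indicator {t<..} s *\<^sub>R (of_real ((s - t) powr (real n - a - 1)) * ((-1) ^ n * ?D n s)) =
          (\<Sum>j\<le>m. indicator {t<..} s *\<^sub>R (of_real ((s - t) powr (real n - a - 1)) * (c j * of_real ((real j + 1) ^ n) * of_real (exp (- ((real j + 1) * s))))))" for s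
        by (simp only: sum_distrib_left scaleR_sum_right)
      also have "\<dots> s = (\<Sum>j\<le>m. c j * of_real ((real j + 1) ^ n) * ?h t j s)" for s
        by (intro sum.cong refl) (simp only: mult_scaleR_right mult.left_commute[of "complex_of_real ((s - t) powr (real n - a - 1))"])
      finally have "indicator {t<..} s *\<^sub>R (of_real ((s - t) powr (real n - a - 1)) * ((-1) ^ n * ?D n s)) = (\<Sum>j\<le>m. c j * of_real ((real j + 1) ^ n) * ?h t j s)" for s .
      then show ?thesis unfolding weyl_int_def set_lebesgue_integral_def by (simp only:)
    qed
    also have "(\<integral>s. (\<Sum>j\<le>m. c j * of_real ((real j + 1) ^ n) * ?h t j s) \<partial>lborel) = (\<Sum>j\<le>m. c j * of_real ((real j + 1) ^ n) * (\<integral>s. ?h t j s \<partial>lborel))"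
      by (subst Bochner_Integration.integral_sum) (auto intro!: integrable_mult_right hi simp only: integral_mult_right_zero)
    also have "of_real (1 / Gamma (real n - a)) * \<dots> = (\<Sum>j\<le>m. c j * of_real ((real j + 1) powr a * exp (- ((real j + 1) * t))))"
      unfolding sum_distrib_left
    proof (intro sum.cong refl)
      fix j
      have "(real j + 1) ^ n * (real j + 1) powr (- (real n - a)) = (real j + 1) powr a"
        by (simp add: powr_realpow[symmetric] del: powr_realpow flip: powr_add)
      then have "1 / Gamma (real n - a) * ((real j + 1) ^ n * (Gamma (real n - a) * (real j + 1) powr (- (real n - a)) * exp (- ((real j + 1) * t))))
          = (real j + 1) powr a * exp (- ((real j + 1) * t))"
        using G by (simp add: mult.assoc[symmetric])
      then have "complex_of_real (1 / Gamma (real n - a) * ((real j + 1) ^ n * (Gamma (real n - a) * (real j + 1) powr (- (real n - a)) * exp (- ((real j + 1) * t)))))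
          = complex_of_real ((real j + 1) powr a * exp (- ((real j + 1) * t)))" by (rule arg_cong)
      then show "of_real (1 / Gamma (real n - a)) * (c j * of_real ((real j + 1) ^ n) * (\<integral>s. ?h t j s \<partial>lborel)) = c j * of_real ((real j + 1) powr a * exp (- ((real j + 1) * t)))"
        unfolding hv by (simp only: of_real_mult mult_ac)
    qed
    finally show ?thesis .
  qed
  have e: "exp (x / p) * exp x powr a = exp ((1 / p + a) * x)"
    by (simp add: exp_powr_real algebra_simps flip: exp_add)
  have "umap a p f x = of_real (exp (x / p) * exp x powr a / Gamma (a + 1)) * weyl_der a f (exp x)"
    by (simp add: umap_def psi_def)
  then show "umap a p f x = of_real (exp ((1 / p + a) * x) / Gamma (a + 1)) *
      (\<Sum>j\<le>m. c j * of_real ((real j + 1) powr a * exp (- ((real j + 1) * exp x))))"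
    unfolding e using w[of "exp x"] by simp
qed

section \<open>The completed spaces\<close>

text \<open>In the variable u = exp(-exp x), which lies in (0, 1), the images of exponential sums
  are the weight w times arbitrary polynomials in u. A continuous compactly supported target is w
  times a continuous function of u, which Stone-Weierstrass approximates uniformly on [0, 1];
  multiplying by w, itself in L^p as the image of exp(-t), turns this into an L^p
  approximation.\<close>

theorem umap_dense:
  assumes a: "0 \<le> a" and p: "1 < p" and F: "Lp p F" and e: "0 < e"
  obtains f where "f \<in> schwartz_plus" "Lp_norm p (\<lambda>x. F x - umap a p f x) < e"
proof -
  define w where "w x = exp ((1 / p + a) * x) / Gamma (a + 1) * exp (- exp x)" for x
  have G1: "Gamma (a + 1) > 0" using a by (intro Gamma_real_pos) auto
  have w0: "w x > 0" for x using G1 by (simp add: w_def)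
  have wc: "continuous_on UNIV w" unfolding w_def using G1 by (intro continuous_intros) auto
  have Lw: "Lp p (\<lambda>x. of_real (w x))"
  proof -
    let ?f = "\<lambda>t. \<Sum>j\<le>0. 1 * complex_of_real (exp (- ((real j + 1) * t)))"
    have u: "umap a p ?f = (\<lambda>x. of_real (w x))"
      by (rule ext) (simp only: umap_exp_sum(2)[OF a, where c = "\<lambda>_. 1" and m = 0], simp add: w_def)
    have "Lp p (umap a p ?f)"
      by (rule umap_Lp(1)[OF umap_exp_sum(1)[OF a, where c = "\<lambda>_. 1" and m = 0] a p])
    then show ?thesis unfolding u .
  qed
  obtain G R where R: "0 < R" and Gc: "continuous_on UNIV G" and G0: "\<And>x. R \<le> \<bar>x\<bar> \<Longrightarrow> G x = 0"
    and LG: "Lp p G" and FG: "Lp_norm p (\<lambda>x. F x - G x) < e / 2"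
    by (rule Lp_approx_continuous[OF p F, of "e / 2"]) (use e in auto)
  \<comment> \<open>The values of u at x = R and x = -R. Clamping u to [A, B] makes the inverse
    coordinate \<open>y\<close> continuous everywhere; outside it takes the values R or -R, where G
    vanishes, so \<open>H\<close> still represents G.\<close>
  define A B where "A = exp (- exp R)" and "B = exp (- exp (- R))"
  have AB: "0 < A" "A \<le> B" "B < 1" using R by (auto simp: A_def B_def)
  define cl where "cl u = max A (min B u)" for u
  have cl: "0 < cl u" "cl u < 1" for u using AB by (auto simp: cl_def max_def min_def)
  define y where "y u = ln (- ln (cl u))" for u
  have yc: "continuous_on UNIV y"
    unfolding y_def
  proof (intro continuous_intros ballI)
    show "continuous_on UNIV cl" unfolding cl_def by (intro continuous_intros)
    fix u show "cl u \<noteq> 0" "- ln (cl u) \<noteq> 0" using cl[of u] by auto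
  qed
  define H where "H u = G (y u) / of_real (w (y u))" for u
  have Hc: "continuous_on UNIV H"
    unfolding H_def using w0
    by (intro continuous_intros continuous_on_compose2[OF Gc yc] continuous_on_compose2[OF wc yc]) (auto simp: less_imp_neq[THEN not_sym])
  have yA: "y (exp (- exp x)) = (if \<bar>x\<bar> \<le> R then x else if x > R then R else - R)" for x
  proof -
    consider "\<bar>x\<bar> \<le> R" | "x > R" | "x < - R" by linarith
    then show ?thesis
    proof cases
      case 1
      then have "A \<le> exp (- exp x)" "exp (- exp x) \<le> B" by (auto simp: A_def B_def)
      then have "cl (exp (- exp x)) = exp (- exp x)" by (simp add: cl_def)
      then show ?thesis using 1 by (simp add: y_def)
    next
      case 2
      then have "exp (- exp x) \<le> A" by (simp add: A_def)
      then have "cl (exp (- exp x)) = A" using AB by (simp add: cl_def)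
      then show ?thesis using 2 R by (simp add: y_def A_def)
    next
      case 3
      then have "B \<le> exp (- exp x)" by (simp add: B_def)
      then have "cl (exp (- exp x)) = B" using AB by (simp add: cl_def)
      then show ?thesis using 3 R by (simp add: y_def B_def)
    qed
  qed
  have HG: "of_real (w x) * H (exp (- exp x)) = G x" for x
  proof (cases "\<bar>x\<bar> \<le> R")
    case True
    then show ?thesis using w0[of x] by (simp add: H_def yA)
  next
    case False
    then have "G (y (exp (- exp x))) = 0" using R by (auto simp: yA intro!: G0)
    moreover have "G x = 0" using False by (intro G0) auto
    ultimately show ?thesis by (simp add: H_def)
  qed
  \<comment> \<open>Real and imaginary parts are each approximated within d, so the total error is
    at most 2d times the norm of w, below e/2 by this choice. The added 1 keeps the denominator
    positive.\<close>
  define d where "d = e / (4 * (Lp_norm p (\<lambda>x. of_real (w x)) + 1))"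
  have d: "0 < d" using e by (auto simp: d_def intro!: divide_pos_pos add_nonneg_pos)
  have cI: "compact {0..1::real}" "continuous_on {0..1} (\<lambda>u. Re (H u))" "continuous_on {0..1} (\<lambda>u. Im (H u))"
    by (auto intro!: continuous_on_Re continuous_on_Im continuous_on_subset[OF Hc])
  obtain P1 where P1: "real_polynomial_function P1" "\<And>u. u \<in> {0..1} \<Longrightarrow> \<bar>Re (H u) - P1 u\<bar> < d"
    using Stone_Weierstrass_real_polynomial_function[OF cI(1,2) d] by blast
  obtain P2 where P2: "real_polynomial_function P2" "\<And>u. u \<in> {0..1} \<Longrightarrow> \<bar>Im (H u) - P2 u\<bar> < d"
    using Stone_Weierstrass_real_polynomial_function[OF cI(1,3) d] by blast
  obtain a1 n1 where a1: "P1 = (\<lambda>u. \<Sum>i\<le>n1. a1 i * u ^ i)" using P1(1) real_polynomial_function_iff_sum by blast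
  obtain a2 n2 where a2: "P2 = (\<lambda>u. \<Sum>i\<le>n2. a2 i * u ^ i)" using P2(1) real_polynomial_function_iff_sum by blast
  define m where "m = max n1 n2"
  define b1 b2 where "b1 i = (if i \<le> n1 then a1 i else 0)" and "b2 i = (if i \<le> n2 then a2 i else 0)" for i
  have b1: "P1 u = (\<Sum>i\<le>m. b1 i * u ^ i)" for u
    unfolding a1 b1_def m_def by (rule sum.mono_neutral_cong_left) auto
  have b2: "P2 u = (\<Sum>i\<le>m. b2 i * u ^ i)" for u
    unfolding a2 b2_def m_def by (rule sum.mono_neutral_cong_left) auto
  define b where "b i = Complex (b1 i) (b2 i)" for i
  have Hb: "norm (H u - (\<Sum>i\<le>m. b i * of_real (u ^ i))) \<le> 2 * d" if "u \<in> {0..1}" for u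
  proof -
    have "Re (H u - (\<Sum>i\<le>m. b i * of_real (u ^ i))) = Re (H u) - P1 u" "Im (H u - (\<Sum>i\<le>m. b i * of_real (u ^ i))) = Im (H u) - P2 u"
      by (auto simp: b1 b2 b_def simp del: of_real_power)
    then have "norm (H u - (\<Sum>i\<le>m. b i * of_real (u ^ i))) \<le> \<bar>Re (H u) - P1 u\<bar> + \<bar>Im (H u) - P2 u\<bar>"
      using cmod_le[of "H u - (\<Sum>i\<le>m. b i * of_real (u ^ i))"] by simp
    then show ?thesis using P1(2)[OF that] P2(2)[OF that] by linarith
  qed
  \<comment> \<open>The power cancels the eigenvalue (j+1)^a. The exponents j + 1 match the
    polynomial degree j because one factor exp(-exp x) already belongs to w.\<close>
  define c where "c j = b j * of_real ((real j + 1) powr (- a))" for j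
  define f where "f t = (\<Sum>j\<le>m. c j * of_real (exp (- ((real j + 1) * t))))" for t
  have fS: "f \<in> schwartz_plus" unfolding f_def[abs_def] by (rule umap_exp_sum(1)[OF a])
  have uf: "umap a p f x = of_real (w x) * (\<Sum>i\<le>m. b i * of_real ((exp (- exp x)) ^ i))" for x
  proof -
    have "umap a p f x = of_real (exp ((1 / p + a) * x) / Gamma (a + 1)) *
      (\<Sum>j\<le>m. c j * of_real ((real j + 1) powr a * exp (- ((real j + 1) * exp x))))"
      unfolding f_def[abs_def] by (rule umap_exp_sum(2)[OF a])
    also have "(\<Sum>j\<le>m. c j * complex_of_real ((real j + 1) powr a * exp (- ((real j + 1) * exp x)))) =
        (\<Sum>j\<le>m. of_real (exp (- exp x)) * (b j * of_real ((exp (- exp x)) ^ j)))"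
    proof (intro sum.cong refl)
      fix j
      have "(real j + 1) powr (- a) * ((real j + 1) powr a * exp (- ((real j + 1) * exp x))) = exp (- exp x) * (exp (- exp x)) ^ j"
      proof -
        have "(real j + 1) powr (- a) * (real j + 1) powr a = 1" by (simp flip: powr_add)
        moreover have "exp (- ((real j + 1) * exp x)) = exp (- exp x) * (exp (- exp x)) ^ j"
          by (simp add: exp_of_nat_mult[symmetric] algebra_simps flip: exp_add)
        ultimately show ?thesis by (simp add: mult.assoc[symmetric])
      qed
      then have "complex_of_real ((real j + 1) powr (- a) * ((real j + 1) powr a * exp (- ((real j + 1) * exp x)))) = complex_of_real (exp (- exp x) * (exp (- exp x)) ^ j)"
        by (rule arg_cong)
      then show "c j * complex_of_real ((real j + 1) powr a * exp (- ((real j + 1) * exp x))) = of_real (exp (- exp x)) * (b j * of_real ((exp (- exp x)) ^ j))"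
        unfolding c_def by (simp only: of_real_mult mult.assoc) (simp only: mult.left_commute)
    qed
    also have "\<dots> = of_real (exp (- exp x)) * (\<Sum>i\<le>m. b i * of_real ((exp (- exp x)) ^ i))"
      by (rule sum_distrib_left[symmetric])
    finally show ?thesis by (simp only: w_def of_real_mult mult.assoc)
  qed
  have Lu: "Lp p (umap a p f)" by (rule umap_Lp(1)[OF fS a p])
  have "Lp_norm p (\<lambda>x. G x - umap a p f x) \<le> 2 * d * Lp_norm p (\<lambda>x. of_real (w x))"
  proof (rule Lp_bound(2)[OF Lw p])
    show "(\<lambda>x. G x - umap a p f x) \<in> borel_measurable borel" using LG Lu by (auto simp: Lp_def)
    show "AE x in lborel. norm (G x - umap a p f x) \<le> 2 * d * norm (complex_of_real (w x))"
    proof (rule AE_I2)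
      fix x :: real
      let ?u = "exp (- exp x)"
      have "G x - umap a p f x = of_real (w x) * (H ?u - (\<Sum>i\<le>m. b i * of_real (?u ^ i)))"
        unfolding uf HG[of x, symmetric] by (rule right_diff_distrib[symmetric])
      then have "norm (G x - umap a p f x) = w x * norm (H ?u - (\<Sum>i\<le>m. b i * of_real (?u ^ i)))"
        using w0[of x] by (simp only: norm_mult norm_of_real abs_of_pos)
      also have "\<dots> \<le> w x * (2 * d)" using w0[of x] by (intro mult_left_mono Hb) auto
      finally show "norm (G x - umap a p f x) \<le> 2 * d * norm (complex_of_real (w x))" using w0[of x] by (simp add: mult.commute)
    qed
  qed (use d in auto)
  also have "\<dots> < e / 2"
  proof -
    let ?W = "Lp_norm p (\<lambda>x. of_real (w x))"
    have "0 < ?W + 1" by (simp add: add_nonneg_pos)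
    moreover have "4 * (e / (4 * v)) * v = e" if "0 < v" for v using that by simp
    ultimately have "4 * d * (?W + 1) = e" unfolding d_def by blast
    then show ?thesis using d by (simp add: algebra_simps)
  qed
  finally have Gu: "Lp_norm p (\<lambda>x. G x - umap a p f x) < e / 2" .
  have "Lp_norm p (\<lambda>x. F x - umap a p f x) = Lp_norm p (\<lambda>x. (F x - G x) + (G x - umap a p f x))" by simp
  also have "\<dots> \<le> Lp_norm p (\<lambda>x. F x - G x) + Lp_norm p (\<lambda>x. G x - umap a p f x)"
    by (intro Lp_add(2) Lp_diff(1) F LG Lu p)
  also have "\<dots> < e" using FG Gu by simp
  finally show thesis using fS by (rule that[rotated])
qed

section \<open>Identification of the completion and its norm\<close>

lemma psi_diff: "psi p (\<lambda>t. f t - g t) = (\<lambda>x. psi p f x - psi p g x)"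
  by (simp add: psi_def fun_eq_iff right_diff_distrib)

lemma psi_scale: "psi p (\<lambda>t. z * f t) = (\<lambda>x. z * psi p f x)"
  by (simp add: psi_def fun_eq_iff mult.left_commute)

lemma schwartz_psi_Lp:
  assumes f: "f \<in> schwartz_plus" and p: "1 < p"
  shows "Lp p (psi p f)"
proof -
  obtain D where D: "D 0 = f" "schwartz_derivs D" using f by (auto simp: schwartz_plus_iff)
  show ?thesis using hmap_Lp[OF D(2) p, of 0] D(1) by (simp add: hmap_0)
qed

lemma lp_pow_diff_tendsto_iff:
  assumes p: "1 < p" and "\<And>n. Lp p (psi p (h n))" and "Lp p (psi p f)"
  shows "(\<lambda>n. lp_pow p (\<lambda>t. h n t - f t)) \<longlonglongrightarrow> 0 \<longleftrightarrow> (\<lambda>n. Lp_norm p (\<lambda>x. psi p (h n) x - psi p f x)) \<longlonglongrightarrow> 0"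
proof -
  let ?x = "\<lambda>n. Lp_norm p (\<lambda>x. psi p (h n) x - psi p f x)"
  have e: "lp_pow p (\<lambda>t. h n t - f t) = ennreal (?x n powr p)" for n
    using lp_pow_eq[of p "\<lambda>t. h n t - f t"] Lp_diff(1)[OF assms(2,3) p] p unfolding psi_diff by simp
  have "(\<lambda>n. lp_pow p (\<lambda>t. h n t - f t)) \<longlonglongrightarrow> 0 \<longleftrightarrow> (\<lambda>n. ?x n powr p) \<longlonglongrightarrow> 0"
    unfolding e using tendsto_ennreal_iff[of "\<lambda>n. ?x n powr p" sequentially 0] by simp
  also have "\<dots> \<longleftrightarrow> ?x \<longlonglongrightarrow> 0"
  proof
    assume "(\<lambda>n. ?x n powr p) \<longlonglongrightarrow> 0"
    then have "(\<lambda>n. (?x n powr p) powr (1 / p)) \<longlonglongrightarrow> 0 powr (1 / p)"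
      using p by (intro tendsto_powr2) auto
    then show "?x \<longlonglongrightarrow> 0" using p by (simp add: powr_powr)
  next
    assume "?x \<longlonglongrightarrow> 0"
    then have "(\<lambda>n. ?x n powr p) \<longlonglongrightarrow> 0 powr p" using p by (intro tendsto_powr2) auto
    then show "(\<lambda>n. ?x n powr p) \<longlonglongrightarrow> 0" by simp
  qed
  finally show ?thesis .
qed

context
  fixes a p :: real
  assumes a: "0 \<le> a" and p: "1 < p"
begin

lemma vmap_diff_norm_tendsto:
  assumes F: "\<And>n. Lp p (F n)" and G: "Lp p G" and lim: "(\<lambda>n. Lp_norm p (\<lambda>x. F n x - G x)) \<longlonglongrightarrow> 0"
  shows "(\<lambda>n. Lp_norm p (\<lambda>x. vmap a p (F n) x - vmap a p G x)) \<longlonglongrightarrow> 0"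
proof -
  obtain B where B: "0 \<le> B" "\<And>F. Lp p F \<Longrightarrow> Lp_norm p (vmap a p F) \<le> B * Lp_norm p F"
    using vmap_norm_le[OF a p] by blast
  have le: "Lp_norm p (\<lambda>x. vmap a p (F n) x - vmap a p G x) \<le> B * Lp_norm p (\<lambda>x. F n x - G x)" for n
  proof -
    have "AE x in lborel. vmap a p (\<lambda>x. F n x - G x) x = vmap a p (F n) x - vmap a p G x"
      using vmap_lincomb[OF a p F G, of 1 n "-1"] by simp
    then have "Lp_norm p (vmap a p (\<lambda>x. F n x - G x)) = Lp_norm p (\<lambda>x. vmap a p (F n) x - vmap a p G x)"
      by (intro Lp_norm_cong_AE Lp_measurable[of p] vmap_Lp Lp_diff(1) a p F G)
    then show ?thesis using B(2)[OF Lp_diff(1)[OF F G p], of n] by simp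
  qed
  show ?thesis
  proof (rule tendsto_sandwich[OF _ _ tendsto_const])
    show "(\<lambda>n. B * Lp_norm p (\<lambda>x. F n x - G x)) \<longlonglongrightarrow> 0" using tendsto_mult_right_zero[OF lim] .
  qed (use le in auto)
qed

text \<open>A Cauchy sequence for \<open>wnorm\<close> has images under \<open>umap\<close> that are
  Cauchy in L^p, hence converge to some G. Boundedness of \<open>vmap\<close> makes
  \<open>vmap a p G\<close> the L^p limit of the sequence itself, and limits are unique.\<close>

lemma approx_seq_limit:
  assumes ap: "approx_seq a p h f" and f: "Lp p (psi p f)"
  obtains G where "Lp p G" "AE x in lborel. psi p f x = vmap a p G x"
    "(\<lambda>n. Lp_norm p (\<lambda>x. umap a p (h n) x - G x)) \<longlonglongrightarrow> 0"
proof -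
  have h: "h n \<in> schwartz_plus" for n using ap by (simp add: approx_seq_def)
  have Lu: "Lp p (umap a p (h n))" for n by (rule umap_Lp(1)[OF h a p])
  have wd: "wnorm a p (\<lambda>t. h m t - h n t) = Lp_norm p (\<lambda>x. umap a p (h m) x - umap a p (h n) x)" for m n
    unfolding wnorm_eq[OF schwartz_plus_diff[OF h h] a p]
    by (intro Lp_norm_cong_AE umap_diff h a p Lp_measurable[of p] umap_Lp(1) schwartz_plus_diff Lp_diff(1))
  obtain G where G: "Lp p G" "(\<lambda>n. Lp_norm p (\<lambda>x. umap a p (h n) x - G x)) \<longlonglongrightarrow> 0"
  proof (rule Lp_complete[OF Lu p])
    show "\<exists>N. \<forall>m\<ge>N. \<forall>n\<ge>N. Lp_norm p (\<lambda>x. umap a p (h m) x - umap a p (h n) x) < e" if "0 < e" for e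
      using ap that unfolding approx_seq_def wd by blast
  qed
  have v: "Lp_norm p (\<lambda>x. vmap a p (umap a p (h n)) x - vmap a p G x) = Lp_norm p (\<lambda>x. psi p (h n) x - vmap a p G x)" for n
  proof (rule Lp_norm_cong_AE)
    show "AE x in lborel. vmap a p (umap a p (h n)) x - vmap a p G x = psi p (h n) x - vmap a p G x"
      using umap_Lp(2)[OF h a p, of n] by eventually_elim simp
  qed (intro Lp_measurable[of p] Lp_diff(1) vmap_Lp Lu a p G(1) schwartz_psi_Lp h)+
  have "AE x in lborel. vmap a p G x = psi p f x"
  proof (rule Lp_limit_unique[OF schwartz_psi_Lp[OF h p] vmap_Lp[OF a p G(1)] f p])
    show "(\<lambda>n. Lp_norm p (\<lambda>x. psi p (h n) x - vmap a p G x)) \<longlonglongrightarrow> 0"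
      using vmap_diff_norm_tendsto[OF Lu G] unfolding v .
    show "(\<lambda>n. Lp_norm p (\<lambda>x. psi p (h n) x - psi p f x)) \<longlonglongrightarrow> 0"
      using ap lp_pow_diff_tendsto_iff[OF p schwartz_psi_Lp[OF h p] f] by (simp add: approx_seq_def)
  qed
  then have "AE x in lborel. psi p f x = vmap a p G x" by eventually_elim simp
  with G show thesis using that by blast
qed

lemma wnorm_tendsto:
  assumes h: "\<And>n. h n \<in> schwartz_plus" and G: "Lp p G" and lim: "(\<lambda>n. Lp_norm p (\<lambda>x. umap a p (h n) x - G x)) \<longlonglongrightarrow> 0"
  shows "(\<lambda>n. wnorm a p (h n)) \<longlonglongrightarrow> Lp_norm p G"
proof -
  have "(\<lambda>n. wnorm a p (h n) - Lp_norm p G) \<longlonglongrightarrow> 0"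
    by (rule Lim_null_comparison[OF _ lim])
       (use Lp_norm_diff_le[OF umap_Lp(1)[OF h a p] G p] in \<open>auto simp: wnorm_eq[OF h a p]\<close>)
  then show ?thesis by (rule LIM_zero_cancel)
qed

text \<open>The converse of the limit statement: density of the images under \<open>umap\<close>
  provides Schwartz functions approaching G, and boundedness of \<open>vmap\<close> makes them
  approach f as well.\<close>

lemma approx_seq_exists:
  assumes G: "Lp p G" and f: "Lp p (psi p f)" and fG: "AE x in lborel. psi p f x = vmap a p G x"
  obtains h where "approx_seq a p h f" "(\<lambda>n. wnorm a p (h n)) \<longlonglongrightarrow> Lp_norm p G"
proof -
  have "\<exists>g. g \<in> schwartz_plus \<and> Lp_norm p (\<lambda>x. G x - umap a p g x) < 1 / real (Suc n)" for n
    using umap_dense[OF a p G, of "1 / real (Suc n)"] by auto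
  then obtain h where h: "\<And>n. h n \<in> schwartz_plus" "\<And>n. Lp_norm p (\<lambda>x. G x - umap a p (h n) x) < 1 / real (Suc n)"
    by metis
  have Lu: "Lp p (umap a p (h n))" for n by (rule umap_Lp(1)[OF h(1) a p])
  have lim: "(\<lambda>n. Lp_norm p (\<lambda>x. umap a p (h n) x - G x)) \<longlonglongrightarrow> 0"
  proof (rule tendsto_sandwich[OF _ _ tendsto_const])
    show "(\<lambda>n. 1 / real (Suc n)) \<longlonglongrightarrow> 0" using LIMSEQ_inverse_real_of_nat by (simp add: inverse_eq_divide)
    show "\<forall>\<^sub>F n in sequentially. Lp_norm p (\<lambda>x. umap a p (h n) x - G x) \<le> 1 / real (Suc n)"
      using h(2) unfolding Lp_norm_minus_commute[of p G] by (intro always_eventually allI less_imp_le)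
  qed auto
  have wd: "wnorm a p (\<lambda>t. h m t - h n t) = Lp_norm p (\<lambda>x. umap a p (h m) x - umap a p (h n) x)" for m n
    unfolding wnorm_eq[OF schwartz_plus_diff[OF h(1) h(1)] a p]
    by (intro Lp_norm_cong_AE umap_diff h a p Lp_measurable[of p] umap_Lp(1) schwartz_plus_diff Lp_diff(1))
  have v: "Lp_norm p (\<lambda>x. vmap a p (umap a p (h n)) x - vmap a p G x) = Lp_norm p (\<lambda>x. psi p (h n) x - psi p f x)" for n
  proof (rule Lp_norm_cong_AE)
    show "AE x in lborel. vmap a p (umap a p (h n)) x - vmap a p G x = psi p (h n) x - psi p f x"
      using umap_Lp(2)[OF h(1) a p, of n] fG by eventually_elim simp
  qed (intro Lp_measurable[of p] Lp_diff(1) vmap_Lp Lu a p G schwartz_psi_Lp h f)+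
  have "approx_seq a p h f"
    unfolding approx_seq_def
  proof (intro conjI allI impI)
    show "h n \<in> schwartz_plus" for n by (rule h)
    show "(\<lambda>n. lp_pow p (\<lambda>t. h n t - f t)) \<longlonglongrightarrow> 0"
      unfolding lp_pow_diff_tendsto_iff[OF p schwartz_psi_Lp[OF h(1) p] f]
      using vmap_diff_norm_tendsto[OF Lu G lim] unfolding v .
    fix e :: real assume e: "0 < e"
    from LIMSEQ_D[OF lim, of "e / 2"] e
    obtain N where N: "\<And>n. n \<ge> N \<Longrightarrow> Lp_norm p (\<lambda>x. umap a p (h n) x - G x) < e / 2" by auto
    show "\<exists>N. \<forall>m\<ge>N. \<forall>n\<ge>N. wnorm a p (\<lambda>t. h m t - h n t) < e"
    proof (intro exI[of _ N] allI impI)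
      fix m n assume mn: "m \<ge> N" "n \<ge> N"
      have "wnorm a p (\<lambda>t. h m t - h n t) = Lp_norm p (\<lambda>x. (umap a p (h m) x - G x) - (umap a p (h n) x - G x))"
        unfolding wd by simp
      also have "\<dots> \<le> Lp_norm p (\<lambda>x. umap a p (h m) x - G x) + Lp_norm p (\<lambda>x. umap a p (h n) x - G x)"
        by (intro Lp_diff(2) Lp_diff(1) Lu G p)
      also have "\<dots> < e" using N[OF mn(1)] N[OF mn(2)] by simp
      finally show "wnorm a p (\<lambda>t. h m t - h n t) < e" .
    qed
  qed
  then show thesis using wnorm_tendsto[OF h(1) G lim] by (rule that)
qed

theorem Tspace_iff: "f \<in> Tspace a p \<longleftrightarrow> Lp p (psi p f) \<and> (\<exists>G. Lp p G \<and> (AE x in lborel. psi p f x = vmap a p G x))"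
proof
  assume "f \<in> Tspace a p"
  then obtain h where f: "Lp p (psi p f)" and h: "approx_seq a p h f" by (auto simp: Tspace_def in_Lp_iff[OF p])
  then show "Lp p (psi p f) \<and> (\<exists>G. Lp p G \<and> (AE x in lborel. psi p f x = vmap a p G x))"
    using approx_seq_limit[OF h f] by blast
next
  assume "Lp p (psi p f) \<and> (\<exists>G. Lp p G \<and> (AE x in lborel. psi p f x = vmap a p G x))"
  then obtain G where G: "Lp p (psi p f)" "Lp p G" "AE x in lborel. psi p f x = vmap a p G x" by blast
  then show "f \<in> Tspace a p"
    using approx_seq_exists[OF G(2,1,3)] by (auto simp: Tspace_def in_Lp_iff[OF p])
qed

text \<open>The description in \<open>Tnorm\<close> is unique because every approximating sequence
  leads to some preimage of f under \<open>vmap\<close>, and injectivity makes all preimages agree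
  almost everywhere.\<close>

theorem Tnorm_eq:
  assumes f: "Lp p (psi p f)" and G: "Lp p G" and fG: "AE x in lborel. psi p f x = vmap a p G x"
  shows "Tnorm a p f = Lp_norm p G"
  unfolding Tnorm_def
proof (rule the_equality)
  show "\<exists>h. approx_seq a p h f \<and> (\<lambda>n. wnorm a p (h n)) \<longlonglongrightarrow> Lp_norm p G"
    using approx_seq_exists[OF G f fG] by blast
  fix r assume "\<exists>h. approx_seq a p h f \<and> (\<lambda>n. wnorm a p (h n)) \<longlonglongrightarrow> r"
  then obtain h where h: "approx_seq a p h f" "(\<lambda>n. wnorm a p (h n)) \<longlonglongrightarrow> r" by blast
  obtain G' where G': "Lp p G'" "AE x in lborel. psi p f x = vmap a p G' x"
    "(\<lambda>n. Lp_norm p (\<lambda>x. umap a p (h n) x - G' x)) \<longlonglongrightarrow> 0"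
    using approx_seq_limit[OF h(1) f] by blast
  have hS: "h n \<in> schwartz_plus" for n using h(1) by (simp add: approx_seq_def)
  have "r = Lp_norm p G'" using wnorm_tendsto[OF hS G'(1,3)] h(2) by (rule LIMSEQ_unique[rotated])
  moreover have "AE x in lborel. G x = G' x"
  proof -
    have "AE x in lborel. vmap a p (\<lambda>x. G x - G' x) x = vmap a p G x - vmap a p G' x"
      using vmap_lincomb[OF a p G G'(1), of 1 "-1"] by simp
    with fG G'(2) have "AE x in lborel. vmap a p (\<lambda>x. G x - G' x) x = 0" by eventually_elim simp
    from vmap_injective[OF a p Lp_diff(1)[OF G G'(1) p] this] show ?thesis by simp
  qed
  ultimately show "r = Lp_norm p G"
    using Lp_norm_cong_AE[OF Lp_measurable[OF G] Lp_measurable[OF G'(1)]] by simp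
qed

end

section \<open>The spectrum\<close>

text \<open>Applied to H, the kernel equation for \<open>r\<close> says that z minus correlation
  with \<open>k\<close> cancels against 1/z plus correlation with \<open>r\<close>. The inverse is
  two-sided because correlations commute.\<close>

lemma resolvent_apply:
  assumes p: "1 < p" and z: "z \<noteq> 0" and k: "integrable lborel k" and r: "integrable lborel r"
    and eq: "AE x in lborel. z * r x = k x / z + conv k r x" and H: "Lp p H"
  defines "R \<equiv> \<lambda>H x. inverse z * H x + corr r H x"
  shows "Lp p (R H)"
    and "AE x in lborel. z * R H x - corr k (R H) x = H x"
    and "AE x in lborel. R (\<lambda>x. z * H x - corr k H x) x = H x"
proof -
  have m[measurable]: "k \<in> borel_measurable borel" "r \<in> borel_measurable borel" "H \<in> borel_measurable borel"
    using k r H by (auto simp: Lp_def)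
  note Lk = Lp_corr(2)[OF p k H] and Lr = Lp_corr(2)[OF p r H]
  show "Lp p (R H)" unfolding R_def by (intro Lp_add(1)[OF Lp_scale(1)[OF H p] Lr p])
  have key: "AE x in lborel. z * corr r H x = inverse z * corr k H x + corr k (corr r H) x"
  proof -
    have "corr (\<lambda>y. z * r y) H x = corr (\<lambda>y. inverse z * k y + 1 * conv k r y) H x" for x
      by (rule corr_kernel_cong_AE) (use eq in \<open>auto simp: divide_inverse mult.commute\<close>)
    moreover have "corr (\<lambda>y. z * r y) H x = z * corr r H x" for x by (simp add: corr_def mult.assoc)
    moreover have "AE x in lborel. corr (\<lambda>y. inverse z * k y + 1 * conv k r y) H x = inverse z * corr k H x + 1 * corr (conv k r) H x"
      by (rule corr_kernel_lincomb[OF p k conv_integrable(1)[OF k r] H])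
    ultimately have "AE x in lborel. z * corr r H x = inverse z * corr k H x + corr (conv k r) H x" by simp
    then show ?thesis using corr_corr[OF p k r H] by eventually_elim simp
  qed
  have "AE x in lborel. corr k (\<lambda>x. inverse z * H x + 1 * corr r H x) x = inverse z * corr k H x + 1 * corr k (corr r H) x"
    by (rule corr_lincomb[OF p k H Lr])
  with key show "AE x in lborel. z * R H x - corr k (R H) x = H x"
  proof eventually_elim
    case (elim x)
    have "z * R H x = H x + z * corr r H x" using z by (simp add: R_def distrib_left mult.assoc[symmetric])
    then show ?case using elim by (simp add: R_def)
  qed
  have "AE x in lborel. corr r (\<lambda>x. z * H x + (-1) * corr k H x) x = z * corr r H x + (-1) * corr r (corr k H) x"
    by (rule corr_lincomb[OF p r H Lk])
  with key corr_commute[OF p k r H] show "AE x in lborel. R (\<lambda>x. z * H x - corr k H x) x = H x"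
  proof eventually_elim
    case (elim x)
    have "inverse z * (z * H x - corr k H x) = H x - inverse z * corr k H x" using z by (simp add: right_diff_distrib mult.assoc[symmetric])
    then show ?case using elim by (simp add: R_def)
  qed
qed

context
  fixes a p \<beta> :: real
  assumes a: "0 \<le> a" and p: "1 < p" and \<beta>: "0 < \<beta>"
begin

abbreviation (input) "ck \<equiv> \<lambda>y. complex_of_real (cesaro_kernel \<beta> p y)"

lemma ck_integrable: "integrable lborel ck"
  using cesaro_kernel_integrable[OF \<beta> p] by simp

lemma shifted_cesaro_Lp: "Lp p G \<Longrightarrow> Lp p (\<lambda>x. z * G x - corr ck G x)"
  by (intro Lp_diff(1) Lp_scale(1) Lp_corr(2) ck_integrable p)

text \<open>Since \<open>vmap\<close> commutes with correlations, the operator z - C on the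
  completed space is carried to z minus correlation with the Cesaro kernel on L^p, whatever the
  order a.\<close>

lemma psi_shifted_cesaro:
  assumes f: "Lp p (psi p f)" and G: "Lp p G" and fG: "AE x in lborel. psi p f x = vmap a p G x"
  shows "Lp p (psi p (\<lambda>t. z * f t - cesaro \<beta> f t))"
    and "AE x in lborel. psi p (\<lambda>t. z * f t - cesaro \<beta> f t) x = vmap a p (\<lambda>x. z * G x - corr ck G x) x"
proof -
  have m: "set_borel_measurable lborel {0<..} f"
    using f by (intro set_borel_measurable_if_psi[of p]) (auto simp: Lp_def)
  have e: "psi p (\<lambda>t. z * f t - cesaro \<beta> f t) = (\<lambda>x. z * psi p f x - corr ck (psi p f) x)"
    unfolding psi_diff psi_scale using psi_cesaro[OF m p, of \<beta>] by (simp add: fun_eq_iff)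
  show "Lp p (psi p (\<lambda>t. z * f t - cesaro \<beta> f t))" unfolding e by (rule shifted_cesaro_Lp[OF f])
  have LG: "Lp p (corr ck G)" by (rule Lp_corr(2)[OF p ck_integrable G])
  have li: "AE x in lborel. vmap a p (\<lambda>x. z * G x + (-1) * corr ck G x) x = z * vmap a p G x + (-1) * vmap a p (corr ck G) x"
    by (rule vmap_lincomb[OF a p G LG])
  have cg: "corr ck (psi p f) x = corr ck (vmap a p G) x" for x
    by (rule corr_cong_AE[OF fG borel_measurable_integrable[OF ck_integrable, simplified] Lp_measurable[OF f] Lp_measurable[OF vmap_Lp[OF a p G]]])
  show "AE x in lborel. psi p (\<lambda>t. z * f t - cesaro \<beta> f t) x = vmap a p (\<lambda>x. z * G x - corr ck G x) x"
    unfolding e cg using li vmap_corr_commute[OF a p G ck_integrable] fG by eventually_elim simp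
qed

lemma Tspace_of_Lp:
  assumes G: "Lp p G"
  obtains f where "f \<in> Tspace a p" "Lp p (psi p f)" "AE x in lborel. psi p f x = vmap a p G x"
proof -
  let ?f = "\<lambda>t. of_real (exp (- (ln t / p))) * vmap a p G (ln t)"
  have "psi p ?f = vmap a p G" by (rule psi_ln)
  then have "Lp p (psi p ?f)" "AE x in lborel. psi p ?f x = vmap a p G x" using vmap_Lp[OF a p G] by auto
  then show thesis using that G by (auto simp: Tspace_iff[OF a p])
qed

lemma op_invertible_off_curve:
  assumes z: "z \<notin> closure (range (ftrans ck))"
  shows "op_invertible a p (cesaro \<beta>) z"
proof -
  obtain r where z0: "z \<noteq> 0" and r: "integrable lborel r"
    and eq: "AE x in lborel. z * r x = ck x / z + conv ck r x"
    using cesaro_resolvent_kernel[OF \<beta> p z] by blast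
  define R where "R H x = inverse z * H x + corr r H x" for H x
  have res: "Lp p (R H)" "AE x in lborel. z * R H x - corr ck (R H) x = H x"
    "AE x in lborel. R (\<lambda>x. z * H x - corr ck H x) x = H x" if "Lp p H" for H
    unfolding R_def[abs_def] using resolvent_apply[OF p z0 ck_integrable r eq that] by auto
  \<comment> \<open>Young's inequality for the resolvent 1/z + corr r. The resulting lower bound on
    z - corr gives both injectivity and the norm estimate of \<open>op_invertible\<close>.\<close>
  define B where "B = norm (inverse z) + (\<integral>y. norm (r y) \<partial>lborel)"
  have bound: "Lp_norm p G \<le> B * Lp_norm p (\<lambda>x. z * G x - corr ck G x)" if G: "Lp p G" for G
  proof -
    let ?H = "\<lambda>x. z * G x - corr ck G x"
    have H: "Lp p ?H" by (rule shifted_cesaro_Lp[OF G])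
    have "Lp_norm p G = Lp_norm p (R ?H)"
      using res(3)[OF G] by (intro Lp_norm_cong_AE Lp_measurable[of p] G res(1) H) (auto elim!: eventually_mono)
    also have "\<dots> \<le> Lp_norm p (\<lambda>x. inverse z * ?H x) + Lp_norm p (corr r ?H)"
      unfolding R_def by (intro Lp_add(2) Lp_scale(1) Lp_corr(2) H p r)
    also have "\<dots> \<le> B * Lp_norm p ?H"
      unfolding Lp_scale(2)[OF H p] B_def using Lp_corr(3)[OF p r H] by (simp add: distrib_right)
    finally show ?thesis .
  qed
  show ?thesis
    unfolding op_invertible_def
  proof (intro conjI ballI impI)
    fix f assume "f \<in> Tspace a p" and 0: "ae_eq (\<lambda>t. z * f t - cesaro \<beta> f t) (\<lambda>t. 0)"
    then obtain G where f: "Lp p (psi p f)" and G: "Lp p G" and fG: "AE x in lborel. psi p f x = vmap a p G x"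
      by (auto simp: Tspace_iff[OF a p])
    note ps = psi_shifted_cesaro[OF f G fG, of z]
    have m: "set_borel_measurable lborel {0<..} h" if "Lp p (psi p h)" for h
      using that by (intro set_borel_measurable_if_psi[of p]) (auto simp: Lp_def)
    have m0: "set_borel_measurable lborel {0<..} (\<lambda>t::real. 0::complex)" by (simp add: set_borel_measurable_def)
    have p0: "psi p (\<lambda>t. 0) = (\<lambda>x. 0)" by (simp add: psi_def fun_eq_iff)
    have "AE x in lborel. psi p (\<lambda>t. z * f t - cesaro \<beta> f t) x = 0"
      using 0 unfolding ae_eq_iff[OF m[OF ps(1)] m0, of p] p0 .
    with ps(2) have "AE x in lborel. vmap a p (\<lambda>x. z * G x - corr ck G x) x = 0" by eventually_elim simp
    then have "AE x in lborel. z * G x - corr ck G x = 0" by (rule vmap_injective[OF a p shifted_cesaro_Lp[OF G]])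
    then have "Lp_norm p (\<lambda>x. z * G x - corr ck G x) = 0" using Lp_norm_eq_0_iff[OF shifted_cesaro_Lp[OF G] p] by blast
    then have "Lp_norm p G = 0" using bound[OF G] Lp_norm_nonneg[of p G] by simp
    then have "AE x in lborel. G x = 0" using Lp_norm_eq_0_iff[OF G p] by blast
    then have "AE x in lborel. vmap a p G x = vmap a p (\<lambda>x. 0) x"
      by (intro vmap_cong_AE a p Lp_measurable[OF G]) auto
    moreover have "vmap a p (\<lambda>x. 0) x = 0" for x by (simp add: vmap_def corr_def)
    ultimately have "AE x in lborel. psi p f x = 0" using fG by auto
    then show "ae_eq f (\<lambda>t. 0)" unfolding ae_eq_iff[OF m[OF f] m0, of p] p0 .
  next
    fix g assume "g \<in> Tspace a p"
    then obtain H where g: "Lp p (psi p g)" and H: "Lp p H" and gH: "AE x in lborel. psi p g x = vmap a p H x"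
      by (auto simp: Tspace_iff[OF a p])
    obtain f where fT: "f \<in> Tspace a p" and f: "Lp p (psi p f)" and fR: "AE x in lborel. psi p f x = vmap a p (R H) x"
      using Tspace_of_Lp[OF res(1)[OF H]] by blast
    note ps = psi_shifted_cesaro[OF f res(1)[OF H] fR, of z]
    have "AE x in lborel. vmap a p (\<lambda>x. z * R H x - corr ck (R H) x) x = vmap a p H x"
      by (rule vmap_cong_AE[OF a p Lp_measurable[OF shifted_cesaro_Lp[OF res(1)[OF H]]] Lp_measurable[OF H] res(2)[OF H]])
    with ps(2) gH have "AE x in lborel. psi p (\<lambda>t. z * f t - cesaro \<beta> f t) x = psi p g x" by eventually_elim simp
    moreover have m: "set_borel_measurable lborel {0<..} h" if "Lp p (psi p h)" for h
      using that by (intro set_borel_measurable_if_psi[of p]) (auto simp: Lp_def)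
    ultimately have "ae_eq (\<lambda>t. z * f t - cesaro \<beta> f t) g" by (simp add: ae_eq_iff[OF m[OF ps(1)] m[OF g], of p])
    with fT show "\<exists>f\<in>Tspace a p. ae_eq (\<lambda>t. z * f t - cesaro \<beta> f t) g" by blast
  next
    show "\<exists>K. \<forall>f\<in>Tspace a p. Tnorm a p f \<le> K * Tnorm a p (\<lambda>t. z * f t - cesaro \<beta> f t)"
    proof (intro exI[of _ B] ballI)
      fix f assume "f \<in> Tspace a p"
      then obtain G where f: "Lp p (psi p f)" and G: "Lp p G" and fG: "AE x in lborel. psi p f x = vmap a p G x"
        by (auto simp: Tspace_iff[OF a p])
      show "Tnorm a p f \<le> B * Tnorm a p (\<lambda>t. z * f t - cesaro \<beta> f t)"
        using bound[OF G] Tnorm_eq[OF a p f G fG]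
          Tnorm_eq[OF a p psi_shifted_cesaro(1)[OF f G fG] shifted_cesaro_Lp[OF G] psi_shifted_cesaro(2)[OF f G fG], of z] by simp
    qed
  qed
qed

lemma not_op_invertible_on_curve:
  assumes z: "z \<in> closure (range (ftrans ck))"
  shows "\<not> op_invertible a p (cesaro \<beta>) z"
proof
  assume "op_invertible a p (cesaro \<beta>) z"
  then obtain K where K: "\<And>f. f \<in> Tspace a p \<Longrightarrow> Tnorm a p f \<le> K * Tnorm a p (\<lambda>t. z * f t - cesaro \<beta> f t)"
    unfolding op_invertible_def by blast
  \<comment> \<open>Small enough that K e <= 1/2, also for K = 0 or negative K, so that the assumed
    estimate would give a norm at most half of itself.\<close>
  define e where "e = 1 / (2 * (\<bar>K\<bar> + 1))"
  have e: "0 < e" by (simp add: e_def add_nonneg_pos)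
  obtain F where F: "Lp p F" "0 < Lp_norm p F" and Fe: "Lp_norm p (\<lambda>x. z * F x - corr ck F x) \<le> e * Lp_norm p F"
    using cesaro_approximate_eigenvector[OF \<beta> p z e] by blast
  obtain f where fT: "f \<in> Tspace a p" and f: "Lp p (psi p f)" and fF: "AE x in lborel. psi p f x = vmap a p F x"
    using Tspace_of_Lp[OF F(1)] by blast
  have "Lp_norm p F \<le> K * Lp_norm p (\<lambda>x. z * F x - corr ck F x)"
    using K[OF fT] Tnorm_eq[OF a p f F(1) fF]
      Tnorm_eq[OF a p psi_shifted_cesaro(1)[OF f F(1) fF] shifted_cesaro_Lp[OF F(1)] psi_shifted_cesaro(2)[OF f F(1) fF], of z] by simp
  also have "\<dots> \<le> (\<bar>K\<bar> + 1) * (e * Lp_norm p F)" using Fe by (intro mult_mono) auto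
  also have "\<dots> = Lp_norm p F / 2"
  proof -
    have "(\<bar>K\<bar> + 1) * e = 1 / 2" using add_nonneg_pos[OF abs_ge_zero[of K] zero_less_one] by (simp add: e_def)
    then show ?thesis by (simp add: mult.assoc[symmetric])
  qed
  finally show False using F(2) by simp
qed

lemma op_spectrum_cesaro: "op_spectrum a p (cesaro \<beta>) = closure (range (ftrans ck))"
  using op_invertible_off_curve not_op_invertible_on_curve by (auto simp: op_spectrum_def)

end

theorem theorem3p5:
  fixes p \<alpha> \<beta> :: real
  assumes "1 < p" and "0 \<le> \<alpha>" and "0 < \<beta>"
  shows "op_spectrum \<alpha> p (cesaro \<beta>) =
           (\<lambda>z. complex_of_real (Gamma (\<beta> + 1)) * z) `
             closure ((\<lambda>t::real. Gamma (complex_of_real (1 - 1 / p) + \<i> * complex_of_real t) /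
                               Gamma (complex_of_real (\<beta> + 1 - 1 / p) + \<i> * complex_of_real t)) ` UNIV)
       \<and> (\<lambda>z. complex_of_real (Gamma (\<beta> + 1)) * z) `
             closure ((\<lambda>t::real. Gamma (complex_of_real (1 - 1 / p) + \<i> * complex_of_real t) /
                               Gamma (complex_of_real (\<beta> + 1 - 1 / p) + \<i> * complex_of_real t)) ` UNIV)
         = (\<lambda>z. complex_of_real \<beta> * z) `
             closure ((\<lambda>t::real. Beta (complex_of_real \<beta>) (complex_of_real (1 - 1 / p) + \<i> * complex_of_real t)) ` UNIV)"
proof -
  let ?q = "ftrans (\<lambda>y. complex_of_real (cesaro_kernel \<beta> p y))"
  let ?A = "\<lambda>t::real. Gamma (complex_of_real (1 - 1 / p) + \<i> * complex_of_real t) /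
      Gamma (complex_of_real (\<beta> + 1 - 1 / p) + \<i> * complex_of_real t)"
  let ?B = "\<lambda>t::real. Beta (complex_of_real \<beta>) (complex_of_real (1 - 1 / p) + \<i> * complex_of_real t)"
  \<comment> \<open>Both scalars are real, so they pass through the closure; all sets then become
    closures of the range of one function.\<close>
  have cl: "(\<lambda>z. complex_of_real c * z) ` closure S = closure ((\<lambda>z. complex_of_real c * z) ` S)" for c S
    using closure_scaleR[of c S] by (simp add: scaleR_conv_of_real[abs_def])
  have B: "of_real \<beta> * ?B t = ?q t" for t
    using ftrans_cesaro_kernel[OF assms(3,1), of t] by simp
  have A: "of_real (Gamma (\<beta> + 1)) * ?A t = of_real \<beta> * ?B t" for t
  proof -
    have "Gamma (\<beta> + 1) = \<beta> * Gamma \<beta>" using assms(3) by (intro Gamma_plus1) (auto elim!: nonpos_Ints_cases)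
    then have G: "complex_of_real (Gamma (\<beta> + 1)) = of_real \<beta> * Gamma (of_real \<beta>)" by (simp add: Gamma_complex_of_real)
    have s: "complex_of_real (\<beta> + 1 - 1 / p) + \<i> * complex_of_real t = of_real \<beta> + (of_real (1 - 1 / p) + \<i> * of_real t)" by simp
    show ?thesis unfolding s G Beta_def by simp
  qed
  have "(\<lambda>z. complex_of_real (Gamma (\<beta> + 1)) * z) ` closure (?A ` UNIV) = closure (range ?q)"
    unfolding cl image_image A B ..
  moreover have "(\<lambda>z. complex_of_real \<beta> * z) ` closure (?B ` UNIV) = closure (range ?q)"
    unfolding cl image_image B ..
  ultimately show ?thesis using op_spectrum_cesaro[OF assms(2,1,3)] by simp
qed

end
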